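(* Let $\theta_1,\dots,\theta_n$ be i.i.d. from $\pi_\star\in\mathcal P([-M,M])$, let $(X_i,\theta_i)$ be coupled for each $i$ with the pairs $(X_i,\theta_i)$, $i=1,\dots,n$, independent (the conditional law of $X_i$ given $\theta_i$ need not be normal), and let $\mu_i$ be the marginal law of $X_i$. Let $\hat\pi_n\in\mathcal P([-M,M])$ satisfy, for a fixed $q\ge0$, $$\frac1n\sum_{i=1}^n\log\int\phi(X_i-\theta;\sigma_i)\,d\hat\pi_n(\theta)\ \ge\ \frac1n\sum_{i=1}^n\log\int\phi(X_i-\theta;\sigma_i)\,d\pi_\star(\theta)-\frac{q\log n}{n}.$$ Suppose that: (i) there exist $C_1>0$, $C_2>1$ such that for all $t\ge1$, $\max_{1\le i\le n}\mathbb P(|X_i|>t)\le C_1\exp(-C_2t^2)$; (ii) there exist $0<k<K<\infty$ such that $k<\min_{1\le i\le n}\sigma_i\le\max_{1\le i\le n}\sigma_i<K$ for all $n\ge1$; (iii) for each $i\in\{1,\dots,n\}$, $\mu_i$ is an $(r_{1,i},r_{2,i})$-approximate normal convolution of $\pi_\star$ at scale $\sigma_i$. Define $\rho_n^2:=\frac{\log^4 n}{n}+\frac1n\sum_{i=1}^n r_{1,i}+\frac1n\sum_{i=1}^n r_{2,i}$. Then $$\left(\mathrm{Regret}_n\right)_+^2\ \lesssim\ \rho_n^2\log^3 n+\mathcal W_n^2 .$$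
   Context: $\mathcal P([-M,M])$ is the set of probability measures on $[-M,M]$, $M>0$ fixed; $\phi(\cdot;\sigma)$ is the density of $N(0,\sigma^2)$; $f_{\pi,\sigma}(x):=\int\phi(x-\theta;\sigma)\,d\pi(\theta)$; $\mathrm{Hel}^2(p,q):=\frac12\int(\sqrt{p(x)}-\sqrt{q(x)})^2dx$; $(a)_+=\max(a,0)$. $a\lesssim b$ means $a\le Cb$ for a constant $C$ not depending on $n$. Normal posterior mean: $h_\pi(x;\sigma):=\dfrac{\int\theta\,\phi(x-\theta;\sigma)\,d\pi(\theta)}{f_{\pi,\sigma}(x)}$. Let $Z_i:=\theta_i+\varepsilon_i$ with $\varepsilon_i\sim N(0,\sigma_i^2)$ independent of each other and of $(\theta_1,\dots,\theta_n)$. Define $$\mathrm{Regret}_n:=\sqrt{\frac1n\sum_{i=1}^n\mathbb E|\theta_i-h_{\hat\pi_n}(X_i;\sigma_i)|^2}-\sqrt{\frac1n\sum_{i=1}^n\mathbb E|\theta_i-h_{\pi_\star}(Z_i;\sigma_i)|^2},$$ $$\mathcal W_n^2:=\frac1n\sum_{i=1}^n\mathbb E_{\theta_i\sim\pi_\star}\left[W_2^2\left(\mathrm{Law}(X_i\mid\theta_i),N(\theta_i,\sigma_i^2)\right)\right],$$ where $W_2$ is the Wasserstein-2 distance. For $T\ge1$ set $g_T(y):=y\log^2(T/y)$ for $y>0$ and $g_T(0):=0$. Definition. Fix $M>0$, $T\ge1$ and constants $c_1,c_2>0$ (all treated as fixed, not depending on $i$ or $n$). Let $\mu$ be a probability measure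 on $\mathbb R$, $\sigma>0$, $\pi_\star\in\mathcal P([-M,M])$. Then $\mu$ is an $(r_1,r_2)$-approximate normal convolution of $\pi_\star$ at scale $\sigma$ if $r_1,r_2\ge0$ and for every $\pi\in\mathcal P([-M,M])$, $$\mathbb E_{X\sim\mu}\log\frac{f_{\pi,\sigma}(X)}{f_{\pi_\star,\sigma}(X)}\le c_1\left(-\mathrm{Hel}^2(f_{\pi,\sigma},f_{\pi_\star,\sigma})+r_1\right),$$ $$\mathbb E_{X\sim\mu}\log^2\frac{f_{\pi,\sigma}(X)}{f_{\pi_\star,\sigma}(X)}\le c_2\left(g_T\left(\mathrm{Hel}^2(f_{\pi,\sigma},f_{\pi_\star,\sigma})\right)+r_2\right).$$
   Formalization: The bound is stated for all n ≥ 2 with one constant C; n = 1 is excluded because log 1 = 0 makes the right-hand side equal to W_1^2, which can vanish while the regret is positive. *)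

theory Defs
  imports "HOL-Probability.Probability"
begin

(* Probability measures on [-M,M], carried as Borel measures on the whole line. *)
definition prob_on :: "real \<Rightarrow> real measure set" where
  "prob_on M = {\<pi> \<in> space (prob_algebra borel). measure \<pi> {-M..M} = 1}"

definition normal_mix :: "real measure \<Rightarrow> real \<Rightarrow> real \<Rightarrow> real" where
  "normal_mix \<pi> \<sigma> x = (LINT t|\<pi>. normal_density 0 \<sigma> (x - t))"

definition post_mean :: "real measure \<Rightarrow> real \<Rightarrow> real \<Rightarrow> real" where
  "post_mean \<pi> \<sigma> x = (LINT t|\<pi>. t * normal_density 0 \<sigma> (x - t)) / normal_mix \<pi> \<sigma> x"

definition hellinger_sq :: "(real \<Rightarrow> real) \<Rightarrow> (real \<Rightarrow> real) \<Rightarrow> real" where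
  "hellinger_sq p q = 1/2 * (LINT x|lborel. (sqrt (p x) - sqrt (q x))\<^sup>2)"

definition g_fun :: "real \<Rightarrow> real \<Rightarrow> real" where
  "g_fun T y = (if y > 0 then y * (ln (T / y))\<^sup>2 else 0)"

(* The second moment is taken in the extended reals, so that the second inequality forces
   the log-ratio to be square-integrable under \<mu>. For a probability measure \<mu> the Bochner
   integral in the first inequality then exists, i.e. it is not the default value 0 of a
   non-integrable function. *)
definition approx_normal_conv ::
    "real \<Rightarrow> real \<Rightarrow> real \<Rightarrow> real \<Rightarrow> real measure \<Rightarrow> real measure \<Rightarrow> real \<Rightarrow> real \<Rightarrow> real \<Rightarrow> bool" where
  "approx_normal_conv M T c1 c2 \<mu> \<pi>s \<sigma> r1 r2 \<longleftrightarrow>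
     r1 \<ge> 0 \<and> r2 \<ge> 0 \<and>
     (\<forall>\<pi>\<in>prob_on M.
        (LINT x|\<mu>. ln (normal_mix \<pi> \<sigma> x / normal_mix \<pi>s \<sigma> x))
          \<le> c1 * (- hellinger_sq (normal_mix \<pi> \<sigma>) (normal_mix \<pi>s \<sigma>) + r1) \<and>
        (\<integral>\<^sup>+x. ennreal ((ln (normal_mix \<pi> \<sigma> x / normal_mix \<pi>s \<sigma> x))\<^sup>2) \<partial>\<mu>)
          \<le> ennreal (c2 * (g_fun T (hellinger_sq (normal_mix \<pi> \<sigma>) (normal_mix \<pi>s \<sigma>)) + r2)))"

definition couplings :: "real measure \<Rightarrow> real measure \<Rightarrow> (real \<times> real) measure set" where
  "couplings \<mu> \<nu> = {\<gamma> \<in> space (prob_algebra (borel \<Otimes>\<^sub>M borel)).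
     distr \<gamma> borel fst = \<mu> \<and> distr \<gamma> borel snd = \<nu>}"

(* The square of the Wasserstein-2 distance, possibly infinite. *)
definition wasserstein2_sq :: "real measure \<Rightarrow> real measure \<Rightarrow> ennreal" where
  "wasserstein2_sq \<mu> \<nu> = (INF \<gamma>\<in>couplings \<mu> \<nu>. \<integral>\<^sup>+z. ennreal (\<bar>fst z - snd z\<bar>\<^sup>2) \<partial>\<gamma>)"

(* \<kappa> is a regular version of the conditional law of X given Y: the law of X given Y = t
   is \<kappa> t. Such a version exists for real random variables and is unique up to null sets
   of the law of Y. *)
definition is_cond_law ::
    "'a measure \<Rightarrow> ('a \<Rightarrow> real) \<Rightarrow> ('a \<Rightarrow> real) \<Rightarrow> (real \<Rightarrow> real measure) \<Rightarrow> bool" where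
  "is_cond_law P X Y \<kappa> \<longleftrightarrow>
     \<kappa> \<in> borel \<rightarrow>\<^sub>M prob_algebra borel \<and>
     (\<forall>A\<in>sets borel. \<forall>B\<in>sets borel.
        emeasure P {\<omega> \<in> space P. Y \<omega> \<in> A \<and> X \<omega> \<in> B}
          = (\<integral>\<^sup>+t\<in>A. emeasure (\<kappa> t) B \<partial>distr P borel Y))"

(* \<pi>h is the random measure plugged in as the estimated prior. *)
definition regret ::
    "'a measure \<Rightarrow> nat \<Rightarrow> (nat \<Rightarrow> 'a \<Rightarrow> real) \<Rightarrow> (nat \<Rightarrow> 'a \<Rightarrow> real) \<Rightarrow> (nat \<Rightarrow> 'a \<Rightarrow> real) \<Rightarrow>
     (nat \<Rightarrow> real) \<Rightarrow> ('a \<Rightarrow> real measure) \<Rightarrow> real measure \<Rightarrow> real" where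
  "regret P n \<theta> X Z \<sigma> \<pi>h \<pi>s =
     sqrt (1 / real n * (\<Sum>i=1..n. LINT \<omega>|P. \<bar>\<theta> i \<omega> - post_mean (\<pi>h \<omega>) (\<sigma> i) (X i \<omega>)\<bar>\<^sup>2))
     - sqrt (1 / real n * (\<Sum>i=1..n. LINT \<omega>|P. \<bar>\<theta> i \<omega> - post_mean \<pi>s (\<sigma> i) (Z i \<omega>)\<bar>\<^sup>2))"

definition mean_wasserstein_sq ::
    "nat \<Rightarrow> (nat \<Rightarrow> real \<Rightarrow> real measure) \<Rightarrow> (nat \<Rightarrow> real) \<Rightarrow> real measure \<Rightarrow> ennreal" where
  "mean_wasserstein_sq n \<kappa> \<sigma> \<pi>s =
     ennreal (1 / real n) *
       (\<Sum>i=1..n. \<integral>\<^sup>+t. wasserstein2_sq (\<kappa> i t) (density lborel (normal_density t (\<sigma> i))) \<partial>\<pi>s)"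

definition rho_sq :: "nat \<Rightarrow> (nat \<Rightarrow> real) \<Rightarrow> (nat \<Rightarrow> real) \<Rightarrow> real" where
  "rho_sq n r1 r2 =
     (ln (real n)) ^ 4 / real n + 1 / real n * (\<Sum>i=1..n. r1 i) + 1 / real n * (\<Sum>i=1..n. r2 i)"

end

theory Submission
  imports Defs
begin

text \<open>
  Write \<open>h\<close> for the oracle rule, the posterior mean under the true prior \<open>\<pi>s\<close>, and \<open>hh\<close> for
  the one under the estimated prior.  Evaluate \<open>h\<close> at the actual observations \<open>X i\<close> and apply
  Minkowski's inequality twice: the regret is at most the root mean square of
  \<open>hh (X i) - h (X i)\<close> plus the price of feeding \<open>X i\<close> instead of \<open>Z i\<close> to \<open>h\<close>.

  The second term is a transport cost.  A posterior mean over \<open>[-M, M]\<close> is Lipschitz with constant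
  \<open>M\<^sup>2 / \<sigma>\<^sup>2\<close> (\<open>post_mean_lipschitz\<close>), so coupling the law of \<open>X i\<close> given \<open>\<theta> i\<close> with the normal law
  costs at most \<open>M\<^sup>2 / k\<^sup>2\<close> times the Wasserstein distance (\<open>second_moment_transfer\<close>).

  For the first term the estimated prior depends on all observations, which calls for a bound that is
  uniform over priors.  It rests on the factorisation of the mixture density into the normal density
  and an exponential moment of the prior, and on three consequences of it.

  \<^item> \<open>prior_net\<close>: for \<open>\<bar>x\<bar> \<le> sqrt (2 * ln n)\<close> the exponential is a polynomial in the parameter, of
    degree of order \<open>ln n\<close>, up to an error below \<open>1 / n\<close>.  Hence a prior matters only through that
    many moments, and rounding them gives \<open>exp (C * (ln n)\<^sup>2)\<close> priors that represent all others, for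
    log densities and posterior means and for all scales at once.

  \<^item> \<open>post_mean_L2_hellinger\<close>: under the true mixture, the mean square distance of two posterior means
    is at most \<open>C * (ln n)\<^sup>3 * (H + 1 / n)\<close>, where \<open>H\<close> is the squared Hellinger distance of the
    mixtures.  The difference of the posterior means is governed by the derivative of the difference
    of the exponential moments; integration by parts makes the norms of its successive derivatives
    log-convex up to a drift of order \<open>sqrt (ln n)\<close>.  A first derivative that is large compared with
    the difference itself would thus force growth over about \<open>ln n\<close> further derivatives, faster than
    the geometric growth that the bounded support permits.

  \<^item> \<open>estimated_rule_excess\<close>: for a fixed prior consider the sum over \<open>i\<close> of \<open>\<lambda>\<close> times the
    log-likelihood ratio plus \<open>\<beta>\<close> times the squared difference of the rules, with
    \<open>\<lambda> = a / (ln n)\<^sup>2\<close> and \<open>\<beta> = b * \<lambda> / (ln n)\<^sup>3\<close>.  In its exponential moment the negative drift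
    \<open>- c1 * \<lambda> * H\<close> of the first part pays for the variance \<open>\<lambda>\<^sup>2 * g_T H\<close> and for the mean of the second
    part.  A union bound over the net costs \<open>(ln n)\<^sup>2\<close>, and at the estimated prior the first part is at
    least \<open>- \<lambda> * (q * ln n + 1)\<close>, so the squared differences are controlled directly, without passing
    through a convergence rate for the estimated mixture.  Division by \<open>n * \<beta>\<close> produces
    \<open>(ln n)^7 / n\<close> together with \<open>(ln n)^3\<close> times the averages of \<open>r1\<close> and \<open>r2\<close>.
\<close>


section \<open>Exponential moments of a prior and its posterior mean\<close>

text \<open>Expanding the square in the normal density leaves, next to \<open>normal_density 0 \<sigma> x\<close>, the factor
  \<open>exp (x * u - t\<^sup>2 / (2 * \<sigma>\<^sup>2))\<close> with \<open>u = t / \<sigma>\<^sup>2\<close>.  Its moments in \<open>u\<close> are the successive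
  \<open>x\<close>-derivatives of the moment of order zero, which is why they are indexed by \<open>j\<close>.\<close>
definition tilt :: "real measure \<Rightarrow> real \<Rightarrow> nat \<Rightarrow> real \<Rightarrow> real" where
  "tilt \<pi> \<sigma> j x = (LINT t|\<pi>. (t / \<sigma>\<^sup>2) ^ j * exp (x * (t / \<sigma>\<^sup>2) - t\<^sup>2 / (2 * \<sigma>\<^sup>2)))"

lemma prob_onD:
  assumes "\<pi> \<in> prob_on M"
  shows "prob_space \<pi>" "sets \<pi> = sets borel" "AE t in \<pi>. \<bar>t\<bar> \<le> M"
proof -
  show p: "prob_space \<pi>" and s: "sets \<pi> = sets borel"
    using assms by (auto simp: prob_on_def space_prob_algebra)
  interpret prob_space \<pi> by (rule p)
  have "prob {-M..M} = 1"
    using assms by (auto simp: prob_on_def)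
  then have "AE t in \<pi>. t \<in> {-M..M}"
    using AE_prob_1 by blast
  then show "AE t in \<pi>. \<bar>t\<bar> \<le> M"
    by eventually_elim auto
qed

lemma tilt_integrable:
  assumes "\<pi> \<in> prob_on M"
  shows "integrable \<pi> (\<lambda>t. (t / \<sigma>\<^sup>2) ^ j * exp (x * (t / \<sigma>\<^sup>2) - t\<^sup>2 / (2 * \<sigma>\<^sup>2)))"
proof -
  note p = prob_onD[OF assms]
  interpret prob_space \<pi> by (rule p)
  note [measurable_cong] = p(2)
  show ?thesis
  proof (rule integrable_const_bound[where B="(M / \<sigma>\<^sup>2) ^ j * exp (\<bar>x\<bar> * (M / \<sigma>\<^sup>2))"])
    show "AE t in \<pi>. norm ((t / \<sigma>\<^sup>2) ^ j * exp (x * (t / \<sigma>\<^sup>2) - t\<^sup>2 / (2 * \<sigma>\<^sup>2)))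
        \<le> (M / \<sigma>\<^sup>2) ^ j * exp (\<bar>x\<bar> * (M / \<sigma>\<^sup>2))"
      using p(3)
    proof eventually_elim
      case (elim t)
      have 1: "\<bar>t / \<sigma>\<^sup>2\<bar> \<le> M / \<sigma>\<^sup>2"
        using elim by (simp add: divide_right_mono)
      have "x * (t / \<sigma>\<^sup>2) \<le> \<bar>x\<bar> * \<bar>t / \<sigma>\<^sup>2\<bar>"
        by (metis abs_ge_self abs_mult)
      also have "\<dots> \<le> \<bar>x\<bar> * (M / \<sigma>\<^sup>2)"
        by (rule mult_left_mono[OF 1]) simp
      finally have 2: "x * (t / \<sigma>\<^sup>2) - t\<^sup>2 / (2 * \<sigma>\<^sup>2) \<le> \<bar>x\<bar> * (M / \<sigma>\<^sup>2)"
        by (smt (verit) zero_le_divide_iff zero_le_power2)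
      have "\<bar>t / \<sigma>\<^sup>2\<bar> ^ j \<le> (M / \<sigma>\<^sup>2) ^ j"
        by (rule power_mono[OF 1]) simp
      then show ?case
        using 2 order_trans[OF abs_ge_zero 1]
        by (auto simp: abs_mult power_abs simp del: zero_le_divide_iff divide_le_0_iff intro!: mult_mono)
    qed
  qed measurable
qed

context
  fixes M \<sigma> :: real and \<pi> :: "real measure"
  assumes \<pi>: "\<pi> \<in> prob_on M" and \<sigma>: "\<sigma> > 0"
begin

lemma prob_on_bound_nonneg: "M \<ge> 0"
proof (rule ccontr)
  assume "\<not> M \<ge> 0"
  note p = prob_onD[OF \<pi>]
  interpret prob_space \<pi> by (rule p)
  have "AE t in \<pi>. False"
    using p(3) by eventually_elim (use \<open>\<not> M \<ge> 0\<close> in auto)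
  then show False by simp
qed

lemma tilt_0_lower: "exp (- (\<bar>x\<bar> * (M / \<sigma>\<^sup>2) + M\<^sup>2 / (2 * \<sigma>\<^sup>2))) \<le> tilt \<pi> \<sigma> 0 x"
proof -
  note p = prob_onD[OF \<pi>]
  interpret prob_space \<pi> by (rule p)
  show ?thesis
    unfolding tilt_def
  proof (rule integral_ge_const)
    show "AE t in \<pi>. exp (- (\<bar>x\<bar> * (M / \<sigma>\<^sup>2) + M\<^sup>2 / (2 * \<sigma>\<^sup>2)))
        \<le> (t / \<sigma>\<^sup>2) ^ 0 * exp (x * (t / \<sigma>\<^sup>2) - t\<^sup>2 / (2 * \<sigma>\<^sup>2))"
      using p(3)
    proof eventually_elim
      case (elim t)
      have 1: "\<bar>t / \<sigma>\<^sup>2\<bar> \<le> M / \<sigma>\<^sup>2"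
        using elim by (simp add: divide_right_mono)
      have "\<bar>x * (t / \<sigma>\<^sup>2)\<bar> \<le> \<bar>x\<bar> * (M / \<sigma>\<^sup>2)"
        unfolding abs_mult by (rule mult_left_mono[OF 1]) simp
      moreover have "\<bar>t\<bar>\<^sup>2 \<le> M\<^sup>2"
        by (rule power_mono[OF elim]) simp
      then have "t\<^sup>2 / (2 * \<sigma>\<^sup>2) \<le> M\<^sup>2 / (2 * \<sigma>\<^sup>2)"
        by (simp add: divide_right_mono)
      moreover have "- (x * (t / \<sigma>\<^sup>2)) \<le> \<bar>x * (t / \<sigma>\<^sup>2)\<bar>"
        by (rule abs_ge_minus_self)
      ultimately have "- (\<bar>x\<bar> * (M / \<sigma>\<^sup>2) + M\<^sup>2 / (2 * \<sigma>\<^sup>2)) \<le> x * (t / \<sigma>\<^sup>2) - t\<^sup>2 / (2 * \<sigma>\<^sup>2)"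
        by (smt (verit))
      then show ?case by simp
    qed
  qed (rule tilt_integrable[OF \<pi>])
qed

lemma tilt_0_pos: "tilt \<pi> \<sigma> 0 x > 0"
  using tilt_0_lower[of x] by (meson exp_gt_zero less_le_trans)

lemma tilt_0_upper: "tilt \<pi> \<sigma> 0 x \<le> exp (\<bar>x\<bar> * (M / \<sigma>\<^sup>2))"
proof -
  note p = prob_onD[OF \<pi>]
  interpret prob_space \<pi> by (rule p)
  show ?thesis
    unfolding tilt_def
  proof (rule integral_le_const)
    show "AE t in \<pi>. (t / \<sigma>\<^sup>2) ^ 0 * exp (x * (t / \<sigma>\<^sup>2) - t\<^sup>2 / (2 * \<sigma>\<^sup>2)) \<le> exp (\<bar>x\<bar> * (M / \<sigma>\<^sup>2))"
      using p(3)
    proof eventually_elim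
      case (elim t)
      have 1: "\<bar>t / \<sigma>\<^sup>2\<bar> \<le> M / \<sigma>\<^sup>2"
        using elim by (simp add: divide_right_mono)
      have "\<bar>x * (t / \<sigma>\<^sup>2)\<bar> \<le> \<bar>x\<bar> * (M / \<sigma>\<^sup>2)"
        unfolding abs_mult by (rule mult_left_mono[OF 1]) simp
      moreover have "0 \<le> t\<^sup>2 / (2 * \<sigma>\<^sup>2)"
        by simp
      ultimately have "x * (t / \<sigma>\<^sup>2) - t\<^sup>2 / (2 * \<sigma>\<^sup>2) \<le> \<bar>x\<bar> * (M / \<sigma>\<^sup>2)"
        by linarith
      then show ?case by simp
    qed
  qed (rule tilt_integrable[OF \<pi>])
qed

text \<open>Since \<open>\<bar>t\<bar> \<le> M\<close>, every derivative costs at most a factor \<open>M / \<sigma>\<^sup>2\<close>.  This geometric growth is the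
  quantitative form of analyticity used below.\<close>
lemma tilt_abs_bound: "\<bar>tilt \<pi> \<sigma> j x\<bar> \<le> (M / \<sigma>\<^sup>2) ^ j * tilt \<pi> \<sigma> 0 x"
proof -
  note p = prob_onD[OF \<pi>]
  interpret prob_space \<pi> by (rule p)
  let ?e = "\<lambda>t. exp (x * (t / \<sigma>\<^sup>2) - t\<^sup>2 / (2 * \<sigma>\<^sup>2))"
  have i0: "integrable \<pi> ?e"
    using tilt_integrable[OF \<pi>, of \<sigma> 0] by simp
  have "\<bar>tilt \<pi> \<sigma> j x\<bar> \<le> (LINT t|\<pi>. \<bar>(t / \<sigma>\<^sup>2) ^ j * ?e t\<bar>)"
    unfolding tilt_def by (rule integral_abs_bound)
  also have "\<dots> \<le> (LINT t|\<pi>. (M / \<sigma>\<^sup>2) ^ j * ?e t)"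
  proof (rule integral_mono_AE)
    show "AE t in \<pi>. \<bar>(t / \<sigma>\<^sup>2) ^ j * ?e t\<bar> \<le> (M / \<sigma>\<^sup>2) ^ j * ?e t"
      using p(3)
    proof eventually_elim
      case (elim t)
      have 1: "\<bar>t / \<sigma>\<^sup>2\<bar> \<le> M / \<sigma>\<^sup>2"
        using elim by (simp add: divide_right_mono)
      have "\<bar>t / \<sigma>\<^sup>2\<bar> ^ j \<le> (M / \<sigma>\<^sup>2) ^ j"
        by (rule power_mono[OF 1]) simp
      then show ?case by (simp add: abs_mult power_abs)
    qed
  qed (use tilt_integrable[OF \<pi>, of \<sigma> j x] i0 in auto)
  also have "\<dots> = (M / \<sigma>\<^sup>2) ^ j * tilt \<pi> \<sigma> 0 x"
    by (simp add: tilt_def)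
  finally show ?thesis .
qed

text \<open>Differentiation under the integral: on the bounded support the second order remainder of the
  exponential is at most a constant times \<open>h\<^sup>2\<close>, uniformly in \<open>t\<close>.\<close>
lemma DERIV_tilt: "(tilt \<pi> \<sigma> j has_real_derivative tilt \<pi> \<sigma> (Suc j) x) (at x)"
proof -
  note p = prob_onD[OF \<pi>]
  interpret prob_space \<pi> by (rule p)
  note [measurable_cong] = p(2)
  define B where "B = M / \<sigma>\<^sup>2"
  have B0: "B \<ge> 0" using prob_on_bound_nonneg by (simp add: B_def)
  define g where "g = (\<lambda>y t. (t / \<sigma>\<^sup>2) ^ j * exp (y * (t / \<sigma>\<^sup>2) - t\<^sup>2 / (2 * \<sigma>\<^sup>2)))"
  define g1 where "g1 = (\<lambda>y t. (t / \<sigma>\<^sup>2) ^ Suc j * exp (y * (t / \<sigma>\<^sup>2) - t\<^sup>2 / (2 * \<sigma>\<^sup>2)))"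
  have int: "integrable \<pi> (g y)" "integrable \<pi> (g1 y)" for y
    using tilt_integrable[OF \<pi>] unfolding g_def g1_def by blast+
  define C where "C = B ^ (j + 2) * exp ((\<bar>x\<bar> + 1) * B)"
  have main: "\<bar>tilt \<pi> \<sigma> j (x + h) - tilt \<pi> \<sigma> j x - h * tilt \<pi> \<sigma> (Suc j) x\<bar> \<le> C * h\<^sup>2"
    if h: "\<bar>h\<bar> \<le> 1" for h
  proof -
    have "tilt \<pi> \<sigma> j (x + h) - tilt \<pi> \<sigma> j x - h * tilt \<pi> \<sigma> (Suc j) x
        = (LINT t|\<pi>. g (x + h) t - g x t - h * g1 x t)"
    proof -
      have "tilt \<pi> \<sigma> j y = (LINT t|\<pi>. g y t)" "tilt \<pi> \<sigma> (Suc j) y = (LINT t|\<pi>. g1 y t)" for y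
        unfolding tilt_def g_def g1_def by (rule refl)+
      then show ?thesis
        using int by simp
    qed
    also have "\<bar>\<dots>\<bar> \<le> (LINT t|\<pi>. \<bar>g (x + h) t - g x t - h * g1 x t\<bar>)"
      by (rule integral_abs_bound)
    also have "\<dots> \<le> C * h\<^sup>2"
    proof (rule integral_le_const)
      show "integrable \<pi> (\<lambda>t. \<bar>g (x + h) t - g x t - h * g1 x t\<bar>)"
        using int by auto
      show "AE t in \<pi>. \<bar>g (x + h) t - g x t - h * g1 x t\<bar> \<le> C * h\<^sup>2"
        using p(3)
      proof eventually_elim
        case (elim t)
        define u where "u = t / \<sigma>\<^sup>2"
        have u: "\<bar>u\<bar> \<le> B"
          using elim by (simp add: divide_right_mono u_def B_def)
        have "\<bar>exp (h * u) - (\<Sum>m<2. (h * u) ^ m / fact m)\<bar> \<le> exp \<bar>h * u\<bar> * \<bar>h * u\<bar> ^ 2 / fact 2"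
        proof -
          obtain s where s: "\<bar>s\<bar> \<le> \<bar>h * u\<bar>"
            "exp (h * u) = (\<Sum>m<2. (h * u) ^ m / fact m) + exp s / fact 2 * (h * u) ^ 2"
            using Maclaurin_exp_le[of "h * u" 2] by blast
          have "exp s \<le> exp \<bar>h * u\<bar>" using s(1) by simp
          then show ?thesis
            unfolding s(2) by (simp add: mult_right_mono divide_right_mono)
        qed
        also have "(\<Sum>m<2. (h * u) ^ m / fact m) = 1 + h * u"
          by (simp add: numeral_2_eq_2)
        also have "exp \<bar>h * u\<bar> * \<bar>h * u\<bar> ^ 2 / fact 2 \<le> exp B * (h\<^sup>2 * B\<^sup>2)"
        proof -
          have 1: "\<bar>h * u\<bar> \<le> \<bar>h\<bar> * B"
            unfolding abs_mult by (rule mult_left_mono[OF u]) simp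
          also have 2: "\<dots> \<le> 1 * B"
            by (rule mult_right_mono[OF h B0])
          finally have 3: "exp \<bar>h * u\<bar> \<le> exp B" by simp
          have "\<bar>h * u\<bar> ^ 2 \<le> (\<bar>h\<bar> * B)\<^sup>2"
            by (rule power_mono[OF 1]) simp
          also have "\<dots> = h\<^sup>2 * B\<^sup>2" by (simp add: power_mult_distrib)
          finally have "exp \<bar>h * u\<bar> * \<bar>h * u\<bar> ^ 2 \<le> exp B * (h\<^sup>2 * B\<^sup>2)"
            by (intro mult_mono 3) auto
          moreover have "exp \<bar>h * u\<bar> * \<bar>h * u\<bar> ^ 2 / fact 2 \<le> exp \<bar>h * u\<bar> * \<bar>h * u\<bar> ^ 2"
            by simp
          ultimately show ?thesis by linarith
        qed
        finally have e: "\<bar>exp (h * u) - (1 + h * u)\<bar> \<le> exp B * (h\<^sup>2 * B\<^sup>2)" .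
        have e2: "exp (x * u - t\<^sup>2 / (2 * \<sigma>\<^sup>2)) \<le> exp (\<bar>x\<bar> * B)"
        proof -
          have "\<bar>x * u\<bar> \<le> \<bar>x\<bar> * B"
            unfolding abs_mult by (rule mult_left_mono[OF u]) simp
          moreover have "0 \<le> t\<^sup>2 / (2 * \<sigma>\<^sup>2)" by simp
          ultimately have "x * u - t\<^sup>2 / (2 * \<sigma>\<^sup>2) \<le> \<bar>x\<bar> * B" by linarith
          then show ?thesis by simp
        qed
        have "g (x + h) t - g x t - h * g1 x t
            = u ^ j * (exp (x * u - t\<^sup>2 / (2 * \<sigma>\<^sup>2)) * (exp (h * u) - (1 + h * u)))"
        proof -
          have "exp ((x + h) * u - t\<^sup>2 / (2 * \<sigma>\<^sup>2)) = exp (x * u - t\<^sup>2 / (2 * \<sigma>\<^sup>2)) * exp (h * u)"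
            by (simp add: algebra_simps flip: exp_add)
          then show ?thesis
            unfolding g_def g1_def u_def[symmetric] by (simp add: algebra_simps)
        qed
        also have "\<bar>\<dots>\<bar> \<le> B ^ j * (exp (\<bar>x\<bar> * B) * (exp B * (h\<^sup>2 * B\<^sup>2)))"
          unfolding abs_mult power_abs
          by (intro mult_mono power_mono) (use u e e2 B0 in auto)
        also have "\<dots> = C * h\<^sup>2"
          by (simp add: C_def power_add algebra_simps exp_add power2_eq_square)
        finally show ?case .
      qed
    qed
    finally show ?thesis .
  qed
  have C0: "C \<ge> 0" using B0 by (simp add: C_def)
  show ?thesis
    unfolding DERIV_def
  proof (rule LIM_I)
    fix r :: real assume r: "r > 0"
    show "\<exists>s>0. \<forall>h. h \<noteq> 0 \<and> norm (h - 0) < s \<longrightarrow>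
        norm ((tilt \<pi> \<sigma> j (x + h) - tilt \<pi> \<sigma> j x) / h - tilt \<pi> \<sigma> (Suc j) x) < r"
    proof (intro exI conjI allI impI)
      show "min 1 (r / (C + 1)) > 0" using r C0 by auto
      fix h :: real assume h: "h \<noteq> 0 \<and> norm (h - 0) < min 1 (r / (C + 1))"
      then have h1: "\<bar>h\<bar> \<le> 1" "h \<noteq> 0" "\<bar>h\<bar> < r / (C + 1)" by auto
      have "norm ((tilt \<pi> \<sigma> j (x + h) - tilt \<pi> \<sigma> j x) / h - tilt \<pi> \<sigma> (Suc j) x)
          = \<bar>tilt \<pi> \<sigma> j (x + h) - tilt \<pi> \<sigma> j x - h * tilt \<pi> \<sigma> (Suc j) x\<bar> / \<bar>h\<bar>"
        using h1 by (simp add: field_simps flip: abs_divide)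
      also have "\<dots> \<le> C * h\<^sup>2 / \<bar>h\<bar>"
        using main[OF h1(1)] by (simp add: divide_right_mono)
      also have "\<dots> = C * \<bar>h\<bar>"
      proof -
        have "h\<^sup>2 = \<bar>h\<bar> * \<bar>h\<bar>" by (simp add: power2_eq_square)
        then have "h\<^sup>2 / \<bar>h\<bar> = \<bar>h\<bar>" using h1 by (simp only: nonzero_mult_div_cancel_right abs_eq_0 not_False_eq_True)
        then show ?thesis by (simp only: times_divide_eq_right[symmetric])
      qed
      also have "\<dots> \<le> (C + 1) * \<bar>h\<bar>" by (simp add: algebra_simps)
      also have "\<dots> < r" using h1(3) C0 by (simp add: field_simps)
      finally show "norm ((tilt \<pi> \<sigma> j (x + h) - tilt \<pi> \<sigma> j x) / h - tilt \<pi> \<sigma> (Suc j) x) < r" .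
    qed
  qed
qed

lemma continuous_tilt: "continuous_on S (tilt \<pi> \<sigma> j)"
  by (meson DERIV_isCont DERIV_tilt continuous_at_imp_continuous_on)

lemma borel_measurable_tilt [measurable]: "tilt \<pi> \<sigma> j \<in> borel_measurable borel"
  by (intro borel_measurable_continuous_onI continuous_tilt)

lemma normal_density_tilt:
  "normal_density 0 \<sigma> (x - t) = normal_density 0 \<sigma> x * exp (x * (t / \<sigma>\<^sup>2) - t\<^sup>2 / (2 * \<sigma>\<^sup>2))"
proof -
  have "- (x - t)\<^sup>2 / (2 * \<sigma>\<^sup>2) = - x\<^sup>2 / (2 * \<sigma>\<^sup>2) + (x * (t / \<sigma>\<^sup>2) - t\<^sup>2 / (2 * \<sigma>\<^sup>2))"
    using \<sigma> by (simp add: field_simps power2_eq_square)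
  then show ?thesis
    unfolding normal_density_def by (simp flip: exp_add)
qed

lemma normal_mix_tilt: "normal_mix \<pi> \<sigma> x = normal_density 0 \<sigma> x * tilt \<pi> \<sigma> 0 x"
  by (simp add: normal_mix_def tilt_def normal_density_tilt)

lemma normal_mix_pos: "normal_mix \<pi> \<sigma> x > 0"
  using normal_mix_tilt tilt_0_pos normal_density_pos[OF \<sigma>] by simp

lemma post_mean_tilt: "post_mean \<pi> \<sigma> x = \<sigma>\<^sup>2 * (tilt \<pi> \<sigma> 1 x / tilt \<pi> \<sigma> 0 x)"
proof -
  have "(LINT t|\<pi>. t * normal_density 0 \<sigma> (x - t))
      = (LINT t|\<pi>. (normal_density 0 \<sigma> x * \<sigma>\<^sup>2) * ((t / \<sigma>\<^sup>2) ^ 1 * exp (x * (t / \<sigma>\<^sup>2) - t\<^sup>2 / (2 * \<sigma>\<^sup>2))))"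
    by (rule Bochner_Integration.integral_cong) (use \<sigma> in \<open>auto simp: normal_density_tilt\<close>)
  also have "\<dots> = normal_density 0 \<sigma> x * \<sigma>\<^sup>2 * tilt \<pi> \<sigma> 1 x"
    by (subst integral_mult_right_zero) (simp add: tilt_def)
  finally show ?thesis
    unfolding post_mean_def normal_mix_tilt
    using normal_density_pos[OF \<sigma>, of 0 x] tilt_0_pos[of x] by (simp add: field_simps)
qed

lemma borel_measurable_normal_mix [measurable]: "normal_mix \<pi> \<sigma> \<in> borel_measurable borel"
  by (subst normal_mix_tilt[abs_def]) measurable

lemma borel_measurable_post_mean [measurable]: "post_mean \<pi> \<sigma> \<in> borel_measurable borel"
  by (subst post_mean_tilt[abs_def]) measurable

lemma tilt_ratio_bound: "\<bar>tilt \<pi> \<sigma> j x / tilt \<pi> \<sigma> 0 x\<bar> \<le> (M / \<sigma>\<^sup>2) ^ j"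
  using tilt_abs_bound[of j x] tilt_0_pos[of x] by (simp add: field_simps)

lemma post_mean_bound: "\<bar>post_mean \<pi> \<sigma> x\<bar> \<le> M"
proof -
  have "\<bar>post_mean \<pi> \<sigma> x\<bar> = \<sigma>\<^sup>2 * \<bar>tilt \<pi> \<sigma> 1 x / tilt \<pi> \<sigma> 0 x\<bar>"
    by (simp add: post_mean_tilt abs_mult)
  also have "\<dots> \<le> \<sigma>\<^sup>2 * (M / \<sigma>\<^sup>2) ^ 1"
    by (rule mult_left_mono[OF tilt_ratio_bound]) simp
  finally show ?thesis using \<sigma> by simp
qed

text \<open>The derivative of the posterior mean is the posterior variance divided by \<open>\<sigma>\<^sup>2\<close>, and the
  posterior second moment and squared mean both lie in \<open>[0, M\<^sup>2]\<close>.\<close>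
lemma post_mean_lipschitz: "\<bar>post_mean \<pi> \<sigma> x - post_mean \<pi> \<sigma> y\<bar> \<le> (M\<^sup>2 / \<sigma>\<^sup>2) * \<bar>x - y\<bar>"
proof -
  let ?A = "\<lambda>j x. tilt \<pi> \<sigma> j x"
  have d: "(post_mean \<pi> \<sigma> has_real_derivative
      \<sigma>\<^sup>2 * (?A 2 z / ?A 0 z - (?A 1 z / ?A 0 z)\<^sup>2)) (at z)" for z
  proof -
    have "((\<lambda>z. \<sigma>\<^sup>2 * (?A 1 z / ?A 0 z)) has_real_derivative
      \<sigma>\<^sup>2 * ((?A (Suc 1) z * ?A 0 z - ?A 1 z * ?A (Suc 0) z) / (?A 0 z * ?A 0 z))) (at z)"
      by (intro DERIV_cmult DERIV_divide DERIV_tilt) (use tilt_0_pos[of z] in simp)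
    moreover have "(?A (Suc 1) z * ?A 0 z - ?A 1 z * ?A (Suc 0) z) / (?A 0 z * ?A 0 z)
        = ?A 2 z / ?A 0 z - (?A 1 z / ?A 0 z)\<^sup>2"
      using tilt_0_pos[of z] by (simp add: numeral_2_eq_2 field_simps power2_eq_square)
    moreover have "post_mean \<pi> \<sigma> = (\<lambda>z. \<sigma>\<^sup>2 * (?A 1 z / ?A 0 z))"
      by (rule ext) (rule post_mean_tilt)
    ultimately show ?thesis
      by (simp only:)
  qed
  have b: "\<bar>\<sigma>\<^sup>2 * (?A 2 z / ?A 0 z - (?A 1 z / ?A 0 z)\<^sup>2)\<bar> \<le> M\<^sup>2 / \<sigma>\<^sup>2" for z
  proof -
    have "?A 2 z \<ge> 0"
      unfolding tilt_def by (rule integral_nonneg_AE) simp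
    then have 1: "0 \<le> ?A 2 z / ?A 0 z" using tilt_0_pos[of z] by simp
    have 2: "?A 2 z / ?A 0 z \<le> (M / \<sigma>\<^sup>2)\<^sup>2" using tilt_ratio_bound[of 2 z] by linarith
    have "\<bar>?A 1 z / ?A 0 z\<bar>\<^sup>2 \<le> (M / \<sigma>\<^sup>2)\<^sup>2"
      by (rule power_mono) (use tilt_ratio_bound[of 1 z] in simp_all)
    then have 3: "(?A 1 z / ?A 0 z)\<^sup>2 \<le> (M / \<sigma>\<^sup>2)\<^sup>2" by (simp only: power2_abs)
    have 4: "0 \<le> (?A 1 z / ?A 0 z)\<^sup>2" by simp
    have "\<bar>?A 2 z / ?A 0 z - (?A 1 z / ?A 0 z)\<^sup>2\<bar> \<le> (M / \<sigma>\<^sup>2)\<^sup>2"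
      using 1 2 3 4 by linarith
    then have "\<sigma>\<^sup>2 * \<bar>?A 2 z / ?A 0 z - (?A 1 z / ?A 0 z)\<^sup>2\<bar> \<le> \<sigma>\<^sup>2 * (M / \<sigma>\<^sup>2)\<^sup>2"
      by (rule mult_left_mono) simp
    also have "\<dots> = M\<^sup>2 / \<sigma>\<^sup>2"
      using \<sigma> by (simp add: power2_eq_square)
    finally show ?thesis by (simp add: abs_mult)
  qed
  have "norm (post_mean \<pi> \<sigma> x - post_mean \<pi> \<sigma> y) \<le> (M\<^sup>2 / \<sigma>\<^sup>2) * norm (x - y)"
    by (rule field_differentiable_bound[where S=UNIV and f'="\<lambda>z. \<sigma>\<^sup>2 * (?A 2 z / ?A 0 z - (?A 1 z / ?A 0 z)\<^sup>2)"])
      (use d b in auto)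
  then show ?thesis by simp
qed

end

section \<open>Auxiliary inequalities on the line\<close>

text \<open>Optimising Young's inequality over its parameter; the two degenerate cases are those where
  the optimal parameter would be zero or infinite.\<close>
lemma le_sqrt_mult_sqrt_if_young:
  fixes c P Q :: real
  assumes le: "\<And>s. s > 0 \<Longrightarrow> 2 * c \<le> s * P + Q / s" and P: "P \<ge> 0" and Q: "Q \<ge> 0"
  shows "c \<le> sqrt P * sqrt Q"
proof (cases "c \<le> 0")
  case True
  moreover have "0 \<le> sqrt P * sqrt Q" using P Q by simp
  ultimately show ?thesis by linarith
next
  case False
  have P0: "P > 0"
  proof (rule ccontr)
    assume "\<not> P > 0"
    then have P: "P = 0" using P by simp
    have "2 * c \<le> Q / ((Q + 1) / c)"
      using le[of "(Q + 1) / c"] False Q P by simp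
    also have "\<dots> = c * (Q / (Q + 1))" by simp
    also have "\<dots> \<le> c * 1"
      by (rule mult_left_mono) (use Q False in auto)
    finally show False using False by simp
  qed
  have Q0: "Q > 0"
  proof (rule ccontr)
    assume "\<not> Q > 0"
    then have Q: "Q = 0" using Q by simp
    show False using le[of "c / P"] False P0 Q by simp
  qed
  define s where "s = sqrt Q / sqrt P"
  have s: "s > 0" using P0 Q0 by (simp add: s_def)
  have 1: "s * P = sqrt P * sqrt Q"
    using P0 by (simp add: s_def field_simps)
  have 2: "Q / s = sqrt P * sqrt Q"
    using P0 Q0 by (simp add: s_def field_simps)
  show ?thesis using le[OF s] unfolding 1 2 by simp
qed

text \<open>Minkowski's inequality in a form that needs only bounds of the type of Young's inequality.  Such
  bounds survive averaging over indices, integration, and passing to an infimum over couplings.\<close>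
lemma sqrt_le_sqrt_add_sqrt_if_young:
  fixes S P Q :: real
  assumes le: "\<And>s. s > 0 \<Longrightarrow> S \<le> (1 + s) * P + (1 + 1 / s) * Q" and P: "P \<ge> 0" and Q: "Q \<ge> 0"
  shows "sqrt S \<le> sqrt P + sqrt Q"
proof -
  have "(S - P - Q) / 2 \<le> sqrt P * sqrt Q"
  proof (rule le_sqrt_mult_sqrt_if_young[OF _ P Q])
    fix s :: real assume "s > 0"
    then have *: "S - P - Q \<le> s * P + Q / s"
      using le[of s] by (simp add: algebra_simps)
    have "2 * ((S - P - Q) / 2) = S - P - Q" by simp
    then show "2 * ((S - P - Q) / 2) \<le> s * P + Q / s" using * by (simp only:)
  qed
  then have "S \<le> (sqrt P + sqrt Q)\<^sup>2"
    using P Q by (simp add: power2_sum)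
  then show ?thesis
    using P Q by (intro real_le_lsqrt) auto
qed

lemma Cauchy_Schwarz_integral_weighted:
  fixes f g V :: "'b \<Rightarrow> real"
  assumes "integrable N (\<lambda>x. (f x)\<^sup>2 * V x)" "integrable N (\<lambda>x. (g x)\<^sup>2 * V x)"
    and fg: "integrable N (\<lambda>x. f x * g x * V x)" and V: "\<And>x. V x \<ge> 0"
  shows "(LINT x|N. \<bar>f x * g x\<bar> * V x) \<le> sqrt (LINT x|N. (f x)\<^sup>2 * V x) * sqrt (LINT x|N. (g x)\<^sup>2 * V x)"
proof (rule le_sqrt_mult_sqrt_if_young)
  fix s :: real assume s: "s > 0"
  have i: "integrable N (\<lambda>x. \<bar>f x * g x\<bar> * V x)"
    using integrable_abs[OF fg] V by (simp add: abs_mult)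
  have "2 * (LINT x|N. \<bar>f x * g x\<bar> * V x) = (LINT x|N. 2 * (\<bar>f x * g x\<bar> * V x))"
    by simp
  also have "\<dots> \<le> (LINT x|N. s * ((f x)\<^sup>2 * V x) + ((g x)\<^sup>2 * V x) / s)"
  proof (rule integral_mono)
    fix x
    have "0 \<le> (sqrt s * \<bar>f x\<bar> - \<bar>g x\<bar> / sqrt s)\<^sup>2" by simp
    also have "\<dots> = s * (f x)\<^sup>2 - 2 * \<bar>f x * g x\<bar> + (g x)\<^sup>2 / s"
      using s by (simp add: power2_diff power_mult_distrib power_divide abs_mult)
    finally have "2 * \<bar>f x * g x\<bar> \<le> s * (f x)\<^sup>2 + (g x)\<^sup>2 / s" by simp
    then have "(2 * \<bar>f x * g x\<bar>) * V x \<le> (s * (f x)\<^sup>2 + (g x)\<^sup>2 / s) * V x"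
      by (rule mult_right_mono[OF _ V])
    then show "2 * (\<bar>f x * g x\<bar> * V x) \<le> s * ((f x)\<^sup>2 * V x) + ((g x)\<^sup>2 * V x) / s"
      by (simp add: algebra_simps)
  qed (use i assms in auto)
  also have "\<dots> = s * (LINT x|N. (f x)\<^sup>2 * V x) + (LINT x|N. (g x)\<^sup>2 * V x) / s"
    using assms by simp
  finally show "2 * (LINT x|N. \<bar>f x * g x\<bar> * V x) \<le> s * (LINT x|N. (f x)\<^sup>2 * V x) + (LINT x|N. (g x)\<^sup>2 * V x) / s" .
qed (use V in auto)

lemma integral_exp_minus_abs:
  fixes a :: real
  assumes a: "a > 0"
  shows "integrable lborel (\<lambda>x. exp (- (a * \<bar>x\<bar>)))" and "(LINT x|lborel. exp (- (a * \<bar>x\<bar>))) \<le> 2 / a"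
proof -
  interpret prob_space "density lborel (exponential_density a)"
    by (rule prob_space_exponential_density[OF a])
  have 1: "(\<integral>\<^sup>+x. ennreal (exponential_density a x) \<partial>lborel) = 1"
    using emeasure_space_1 by (simp add: emeasure_density)
  have 2: "(\<integral>\<^sup>+x. ennreal (exponential_density a (- x)) \<partial>lborel) = 1"
    using nn_integral_real_affine[of "\<lambda>x. ennreal (exponential_density a x)" "-1" 0] 1 by simp
  have 3: "(\<integral>\<^sup>+x. ennreal (exp (- (a * \<bar>x\<bar>))) \<partial>lborel) \<le> ennreal (2 / a)"
  proof -
    have "(\<integral>\<^sup>+x. ennreal (exp (- (a * \<bar>x\<bar>))) \<partial>lborel)
        \<le> (\<integral>\<^sup>+x. ennreal (1 / a) * (ennreal (exponential_density a x) + ennreal (exponential_density a (- x))) \<partial>lborel)"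
    proof (rule nn_integral_mono)
      fix x :: real
      have "exp (- (a * \<bar>x\<bar>)) \<le> 1 / a * (exponential_density a x + exponential_density a (- x))"
        using a by (auto simp: exponential_density_def abs_if field_simps)
      then show "ennreal (exp (- (a * \<bar>x\<bar>))) \<le> ennreal (1 / a) * (ennreal (exponential_density a x) + ennreal (exponential_density a (- x)))"
        using a exponential_density_nonneg[OF a]
        by (simp add: ennreal_mult'[symmetric] ennreal_plus[symmetric] del: ennreal_plus)
    qed
    also have "\<dots> = ennreal (1 / a) * (1 + 1)"
      using 1 2 by (simp add: nn_integral_cmult nn_integral_add)
    also have "\<dots> = ennreal (2 / a)"
      using a by (metis (no_types, opaque_lifting) ennreal_1 ennreal_mult'' ennreal_plus one_add_one times_divide_eq_left mult_1 zero_le_numeral zero_le_one)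
    finally show ?thesis .
  qed
  show i: "integrable lborel (\<lambda>x. exp (- (a * \<bar>x\<bar>)))"
    by (rule integrableI_bounded) (use 3 in \<open>auto simp: le_less_trans\<close>)
  show "(LINT x|lborel. exp (- (a * \<bar>x\<bar>))) \<le> 2 / a"
    using 3 a unfolding nn_integral_eq_integral[OF i, simplified] by simp
qed

lemma integral_deriv_eq_0:
  fixes f f' :: "real \<Rightarrow> real"
  assumes "\<And>x. (f has_real_derivative f' x) (at x)" and cont: "continuous_on UNIV f'"
    and i: "integrable lborel f'" and lim: "(f \<longlongrightarrow> 0) at_top" "(f \<longlongrightarrow> 0) at_bot"
  shows "(LINT x|lborel. f' x) = 0"
proof -
  have "(LBINT x=-\<infinity>..\<infinity>. f' x) = 0 - 0"
  proof (rule interval_integral_FTC_integrable)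
    show "(f has_vector_derivative f' x) (at x)" for x
      using assms(1) by (simp add: has_real_derivative_iff_has_vector_derivative)
    show "isCont f' x" for x using cont by (simp add: continuous_on_eq_continuous_at)
    show "set_integrable lborel (einterval (-\<infinity>) \<infinity>) f'"
      using i by (simp add: set_integrable_def)
    show "((f \<circ> real_of_ereal) \<longlongrightarrow> 0) (at_right (-\<infinity>))"
      using lim(2) by (simp add: ereal_tendsto_simps)
    show "((f \<circ> real_of_ereal) \<longlongrightarrow> 0) (at_left \<infinity>)"
      using lim(1) by (simp add: ereal_tendsto_simps)
  qed auto
  then show ?thesis
    by (simp add: interval_lebesgue_integral_def set_lebesgue_integral_def)
qed

lemma tendsto_0_if_le_exp_minus_abs:
  fixes f :: "real \<Rightarrow> real"
  assumes a: "a > 0" and b: "\<And>x. \<bar>f x\<bar> \<le> C * exp (- (a * \<bar>x\<bar>))"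
  shows "(f \<longlongrightarrow> 0) at_top" "(f \<longlongrightarrow> 0) at_bot"
proof -
  have 1: "((\<lambda>x. C * exp (- (a * x))) \<longlongrightarrow> C * 0) at_top"
    by (intro tendsto_intros filterlim_compose[OF exp_at_bot]
        filterlim_compose[OF filterlim_uminus_at_bot_at_top] filterlim_tendsto_pos_mult_at_top[OF tendsto_const a]
        filterlim_ident)
  have 2: "((\<lambda>x. C * exp (- (a * \<bar>x\<bar>))) \<longlongrightarrow> 0) at_top"
  proof (rule Lim_transform_eventually)
    show "((\<lambda>x. C * exp (- (a * x))) \<longlongrightarrow> 0) at_top" using 1 by simp
    show "\<forall>\<^sub>F x in at_top. C * exp (- (a * x)) = C * exp (- (a * \<bar>x\<bar>))"
      using eventually_ge_at_top[of 0] by eventually_elim simp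
  qed
  have 3: "((\<lambda>x. C * exp (- (a * \<bar>x\<bar>))) \<longlongrightarrow> 0) at_bot"
    unfolding at_bot_mirror filterlim_filtermap using 2 by simp
  show "(f \<longlongrightarrow> 0) at_top"
    by (rule Lim_null_comparison[OF _ 2]) (use b in simp)
  show "(f \<longlongrightarrow> 0) at_bot"
    by (rule Lim_null_comparison[OF _ 3]) (use b in simp)
qed

text \<open>Dividing the recursion by \<open>a j * a (j + 1)\<close> shows that the ratios \<open>a (j + 1) / a j\<close> drop by at
  most \<open>r\<close> from one index to the next.  If the first ratio exceeds \<open>2 * m * r\<close>, the first
  \<open>m\<close> ratios are all at least half as large; if it also exceeds \<open>2 * exp 1 * B\<close>, then \<open>a m\<close> would
  outgrow \<open>D * B ^ m\<close>.  The floor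
  \<open>e\<close> under \<open>a 0\<close> limits how many steps are needed for the contradiction.\<close>
lemma log_convex_up_to_drift_growth:
  fixes a :: "nat \<Rightarrow> real"
  assumes nonneg: "\<And>j. a j \<ge> 0" and rec: "\<And>j. (a (j + 1))\<^sup>2 \<le> a j * (a (j + 2) + r * a (j + 1))"
    and am: "a m \<le> D * B ^ m" and B: "B > 0" and r: "r \<ge> 0" and m: "m \<ge> 1"
    and e: "e > 0" and De: "D < exp 1 ^ m * e"
  shows "a 1 \<le> max (2 * real m * r) (2 * exp 1 * B) * max (a 0) e"
proof (rule ccontr)
  define t where "t = max (2 * real m * r) (2 * exp 1 * B)"
  define b where "b = max (a 0) e"
  assume "\<not> ?thesis"
  then have a1: "a 1 > t * b" by (simp add: t_def b_def)
  have t0: "t > 0" using B by (simp add: t_def less_max_iff_disj)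
  have b0: "b > 0" using e by (simp add: b_def)
  have a0: "a 0 > 0"
  proof (rule ccontr)
    assume "\<not> a 0 > 0"
    then have "a 0 = 0" using nonneg[of 0] by simp
    then have "a 1 = 0" using rec[of 0] by simp
    then show False using a1 mult_pos_pos[OF t0 b0] by simp
  qed
  have half: "t - real j * r \<ge> t / 2" if "j \<le> m" for j
  proof -
    have "real j * r \<le> real m * r" by (rule mult_right_mono) (use that r in auto)
    moreover have "2 * real m * r \<le> t" by (simp add: t_def)
    ultimately show ?thesis by simp
  qed
  have step: "a j > 0 \<and> a (Suc j) \<ge> (t - real j * r) * a j" if "j < m" for j
    using that
  proof (induction j)
    case 0
    have "t * a 0 \<le> t * b" by (rule mult_left_mono) (use t0 in \<open>auto simp: b_def\<close>)
    then show ?case using a0 a1 by simp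
  next
    case (Suc j)
    then have IH: "a j > 0" "a (Suc j) \<ge> (t - real j * r) * a j" by auto
    have "t - real j * r > 0" using half[of j] Suc t0 by simp
    then have p: "a (Suc j) > 0" using IH by (meson less_le_trans mult_pos_pos)
    have "(t - real j * r) * a j * a (Suc j) \<le> a (Suc j) * a (Suc j)"
      by (rule mult_right_mono[OF IH(2)]) (use p in simp)
    also have "\<dots> \<le> a j * (a (Suc (Suc j)) + r * a (Suc j))"
      using rec[of j] by (simp add: power2_eq_square)
    finally have "a j * ((t - real j * r) * a (Suc j)) \<le> a j * (a (Suc (Suc j)) + r * a (Suc j))"
      by (simp add: algebra_simps)
    then have "(t - real j * r) * a (Suc j) \<le> a (Suc (Suc j)) + r * a (Suc j)"
      using IH(1) by simp
    then show ?case using p by (simp add: algebra_simps)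
  qed
  have grow: "a (Suc j) \<ge> (t / 2) ^ j * a 1" if "j < m" for j
    using that
  proof (induction j)
    case (Suc j)
    have "(t / 2) ^ Suc j * a 1 = (t / 2) * ((t / 2) ^ j * a 1)" by simp
    also have "\<dots> \<le> (t / 2) * a (Suc j)"
      by (rule mult_left_mono) (use Suc t0 in auto)
    also have "\<dots> \<le> (t - real (Suc j) * r) * a (Suc j)"
      by (rule mult_right_mono) (use half[of "Suc j"] Suc nonneg in auto)
    also have "\<dots> \<le> a (Suc (Suc j))" using step[of "Suc j"] Suc by simp
    finally show ?case .
  qed simp
  have "(exp 1 * B) ^ m * e \<le> (t / 2) ^ m * b"
    by (intro mult_mono power_mono) (use B t0 e in \<open>auto simp: t_def b_def\<close>)
  also have "(t / 2) ^ m * b \<le> (t / 2) ^ (m - 1) * (t * b)"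
  proof -
    have "(t / 2) ^ m = (t / 2) ^ (m - 1) * (t / 2)"
      using m by (metis Suc_diff_1 less_le_trans power_Suc2 zero_less_one)
    then have "(t / 2) ^ m * b = (t / 2) ^ (m - 1) * (t * b) / 2" by simp
    moreover have "(t / 2) ^ (m - 1) * (t * b) \<ge> 0" using t0 b0 by simp
    ultimately show ?thesis by linarith
  qed
  also have "\<dots> \<le> (t / 2) ^ (m - 1) * a 1"
    by (rule mult_left_mono) (use a1 t0 in auto)
  also have "\<dots> \<le> a m"
    using grow[of "m - 1"] m by simp
  also have "\<dots> \<le> D * B ^ m" by (rule am)
  also have "\<dots> < exp 1 ^ m * e * B ^ m"
    by (rule mult_strict_right_mono[OF De]) (use B in simp)
  finally show False by (simp add: power_mult_distrib algebra_simps)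
qed

lemma DERIV_max_0_square: "((\<lambda>x::real. (max 0 x)\<^sup>2) has_real_derivative 2 * max 0 x) (at x)"
proof (cases x "0::real" rule: linorder_cases)
  case less
  have "((\<lambda>x::real. 0) has_real_derivative 2 * max 0 x) (at x)"
    using less by simp
  then show ?thesis
    by (rule has_field_derivative_transform_within_open[where S="{..<0}"]) (use less in auto)
next
  case greater
  have "((\<lambda>x::real. x\<^sup>2) has_real_derivative 2 * max 0 x) (at x)"
    using greater by (auto intro!: derivative_eq_intros)
  then show ?thesis
    by (rule has_field_derivative_transform_within_open[where S="{0<..}"]) (use greater in auto)
next
  case equal
  have "((\<lambda>h::real. (max 0 h)\<^sup>2 / h) \<longlongrightarrow> 0) (at 0)"
  proof (rule Lim_null_comparison[where g="\<lambda>h. \<bar>h\<bar>"])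
    show "\<forall>\<^sub>F h in at (0::real). norm ((max 0 h)\<^sup>2 / h) \<le> \<bar>h\<bar>"
      by (intro always_eventually) (auto simp: max_def power2_eq_square)
    show "((\<lambda>h::real. \<bar>h\<bar>) \<longlongrightarrow> 0) (at 0)"
      by (rule tendsto_eq_intros | simp)+
  qed
  then show ?thesis using equal by (simp add: DERIV_def)
qed

text \<open>Half the square for \<open>\<bar>x\<bar> \<le> R\<close>, continued by its tangents: the Huber function, written so
  that its derivative can be computed without a case distinction.\<close>
definition huber :: "real \<Rightarrow> real \<Rightarrow> real" where
  "huber R x = (x\<^sup>2 - (max 0 (x - R))\<^sup>2 - (max 0 (- x - R))\<^sup>2) / 2"

lemma DERIV_huber: "(huber R has_real_derivative x - max 0 (x - R) + max 0 (- x - R)) (at x)"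
proof -
  have 1: "((\<lambda>x. (max 0 (x - R))\<^sup>2) has_real_derivative 2 * max 0 (x - R) * 1) (at x)"
    by (rule DERIV_chain2[OF DERIV_max_0_square]) (auto intro!: derivative_eq_intros)
  have 2: "((\<lambda>x. (max 0 (- x - R))\<^sup>2) has_real_derivative 2 * max 0 (- x - R) * (- 1)) (at x)"
    by (rule DERIV_chain2[OF DERIV_max_0_square]) (auto intro!: derivative_eq_intros)
  show ?thesis
    unfolding huber_def[abs_def]
    by (rule derivative_eq_intros 1 2 | simp)+
qed

lemma huber_le: "huber R x \<le> x\<^sup>2 / 2"
  by (simp add: huber_def field_simps)

lemma huber_eq_square: "\<bar>x\<bar> \<le> R \<Longrightarrow> huber R x = x\<^sup>2 / 2"
  by (simp add: huber_def)

lemma huber_ge: "R \<ge> 0 \<Longrightarrow> huber R x \<ge> R * \<bar>x\<bar> - R\<^sup>2 / 2"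
proof -
  assume R: "R \<ge> 0"
  consider "\<bar>x\<bar> \<le> R" | "x > R" | "x < - R" by linarith
  then show ?thesis
  proof cases
    case 1
    have "0 \<le> (\<bar>x\<bar> - R)\<^sup>2" by simp
    then show ?thesis using huber_eq_square[OF 1] by (simp add: power2_diff algebra_simps)
  next
    case 2
    then show ?thesis using R by (simp add: huber_def power2_eq_square algebra_simps)
  next
    case 3
    then have "max 0 (x - R) = 0" "max 0 (- x - R) = - x - R" "\<bar>x\<bar> = - x" using R by auto
    then show ?thesis by (simp add: huber_def power2_eq_square field_simps)
  qed
qed

lemma huber_deriv_bound: "R \<ge> 0 \<Longrightarrow> \<bar>(x::real) - max 0 (x - R) + max 0 (- x - R)\<bar> \<le> R"
proof -
  assume R: "R \<ge> 0"
  consider "\<bar>x\<bar> \<le> R" | "x > R" | "x < - R" by linarith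
  then show ?thesis by cases (use R in \<open>auto simp: max_def\<close>)
qed

section \<open>Posterior means and the Hellinger distance\<close>

lemma nn_integral_normal_mixture:
  assumes \<pi>: "\<pi> \<in> prob_on M" and \<sigma>: "\<sigma> > 0" and g: "g \<in> borel_measurable borel"
  shows "(\<integral>\<^sup>+t. (\<integral>\<^sup>+z. g z \<partial>density lborel (normal_density t \<sigma>)) \<partial>\<pi>)
    = (\<integral>\<^sup>+z. g z * ennreal (normal_mix \<pi> \<sigma> z) \<partial>lborel)"
proof -
  note p = prob_onD[OF \<pi>]
  interpret prob_space \<pi> by (rule p)
  note [measurable_cong] = p(2)
  note [measurable] = g
  interpret pair_sigma_finite \<pi> lborel
    by (rule pair_sigma_finite.intro[OF sigma_finite_measure_axioms sigma_finite_lborel])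
  have nd: "normal_density t \<sigma> z = normal_density 0 \<sigma> (z - t)" for t z
    by (simp add: normal_density_def)
  have int: "integrable \<pi> (\<lambda>t. normal_density 0 \<sigma> (z - t))" for z
    using tilt_integrable[OF \<pi>, of \<sigma> 0 z] by (simp add: normal_density_tilt[OF \<pi> \<sigma>])
  have "(\<integral>\<^sup>+t. (\<integral>\<^sup>+z. g z \<partial>density lborel (normal_density t \<sigma>)) \<partial>\<pi>)
      = (\<integral>\<^sup>+t. (\<integral>\<^sup>+z. ennreal (normal_density 0 \<sigma> (z - t)) * g z \<partial>lborel) \<partial>\<pi>)"
  proof (rule nn_integral_cong)
    fix t
    show "(\<integral>\<^sup>+z. g z \<partial>density lborel (normal_density t \<sigma>)) = (\<integral>\<^sup>+z. ennreal (normal_density 0 \<sigma> (z - t)) * g z \<partial>lborel)"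
      unfolding nd[of t] by (rule nn_integral_density) measurable
  qed
  also have "\<dots> = (\<integral>\<^sup>+z. (\<integral>\<^sup>+t. ennreal (normal_density 0 \<sigma> (z - t)) * g z \<partial>\<pi>) \<partial>lborel)"
    by (rule Fubini'[symmetric]) measurable
  also have "\<dots> = (\<integral>\<^sup>+z. g z * ennreal (normal_mix \<pi> \<sigma> z) \<partial>lborel)"
  proof (rule nn_integral_cong)
    fix z
    have "(\<integral>\<^sup>+t. ennreal (normal_density 0 \<sigma> (z - t)) * g z \<partial>\<pi>)
        = (\<integral>\<^sup>+t. ennreal (normal_density 0 \<sigma> (z - t)) \<partial>\<pi>) * g z"
      by (rule nn_integral_multc) measurable
    also have "(\<integral>\<^sup>+t. ennreal (normal_density 0 \<sigma> (z - t)) \<partial>\<pi>) = ennreal (normal_mix \<pi> \<sigma> z)"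
      unfolding normal_mix_def by (rule nn_integral_eq_integral[OF int]) simp
    finally show "(\<integral>\<^sup>+t. ennreal (normal_density 0 \<sigma> (z - t)) * g z \<partial>\<pi>) = g z * ennreal (normal_mix \<pi> \<sigma> z)"
      by (simp add: mult.commute)
  qed
  finally show ?thesis .
qed

lemma nn_integral_normal_mix_eq_1:
  assumes \<pi>: "\<pi> \<in> prob_on M" and \<sigma>: "\<sigma> > 0"
  shows "(\<integral>\<^sup>+z. ennreal (normal_mix \<pi> \<sigma> z) \<partial>lborel) = 1"
proof -
  note p = prob_onD[OF \<pi>]
  interpret prob_space \<pi> by (rule p)
  have "emeasure (density lborel (normal_density t \<sigma>)) UNIV = 1" for t
    using prob_space.emeasure_space_1[OF prob_space_normal_density[OF \<sigma>, of t]] by simp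
  then have "(\<integral>\<^sup>+t. (\<integral>\<^sup>+z. 1 \<partial>density lborel (normal_density t \<sigma>)) \<partial>\<pi>) = 1"
    by (simp add: emeasure_space_1)
  then show ?thesis
    using nn_integral_normal_mixture[OF \<pi> \<sigma>, of "\<lambda>_. 1"] by simp
qed

lemma integrable_normal_mix:
  assumes \<pi>: "\<pi> \<in> prob_on M" and \<sigma>: "\<sigma> > 0"
  shows "integrable lborel (normal_mix \<pi> \<sigma>)" "(LINT z|lborel. normal_mix \<pi> \<sigma> z) = 1"
proof -
  note [measurable] = borel_measurable_normal_mix[OF \<pi> \<sigma>]
  have pos: "AE z in lborel. 0 \<le> normal_mix \<pi> \<sigma> z"
    using normal_mix_pos[OF \<pi> \<sigma>] by (simp add: less_imp_le)
  show i: "integrable lborel (normal_mix \<pi> \<sigma>)"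
    by (rule integrableI_nn_integral_finite[where x=1])
      (use pos nn_integral_normal_mix_eq_1[OF \<pi> \<sigma>] in simp_all)
  show "(LINT z|lborel. normal_mix \<pi> \<sigma> z) = 1"
    using nn_integral_eq_integral[OF i pos] nn_integral_normal_mix_eq_1[OF \<pi> \<sigma>] by simp
qed

text \<open>Integrability and the range of the Hellinger distance follow from
  \<open>(sqrt u - sqrt v)\<^sup>2 \<le> u + v\<close>.\<close>
lemma hellinger_sq_normal_mix:
  assumes \<pi>: "\<pi> \<in> prob_on M" and \<rho>: "\<rho> \<in> prob_on M" and \<sigma>: "\<sigma> > 0"
  shows "integrable lborel (\<lambda>x. (sqrt (normal_mix \<pi> \<sigma> x) - sqrt (normal_mix \<rho> \<sigma> x))\<^sup>2)"
    and "0 \<le> hellinger_sq (normal_mix \<pi> \<sigma>) (normal_mix \<rho> \<sigma>)"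
    and "hellinger_sq (normal_mix \<pi> \<sigma>) (normal_mix \<rho> \<sigma>) \<le> 1"
proof -
  note [measurable] = borel_measurable_normal_mix[OF \<pi> \<sigma>] borel_measurable_normal_mix[OF \<rho> \<sigma>]
  have le: "(sqrt (normal_mix \<pi> \<sigma> x) - sqrt (normal_mix \<rho> \<sigma> x))\<^sup>2 \<le> normal_mix \<pi> \<sigma> x + normal_mix \<rho> \<sigma> x" for x
    using normal_mix_pos[OF \<pi> \<sigma>, of x] normal_mix_pos[OF \<rho> \<sigma>, of x]
    by (simp add: power2_diff)
  have i2: "integrable lborel (\<lambda>x. normal_mix \<pi> \<sigma> x + normal_mix \<rho> \<sigma> x)"
    using integrable_normal_mix[OF \<pi> \<sigma>] integrable_normal_mix[OF \<rho> \<sigma>] by simp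
  show i: "integrable lborel (\<lambda>x. (sqrt (normal_mix \<pi> \<sigma> x) - sqrt (normal_mix \<rho> \<sigma> x))\<^sup>2)"
  proof (rule Bochner_Integration.integrable_bound[OF i2])
    show "AE x in lborel. norm ((sqrt (normal_mix \<pi> \<sigma> x) - sqrt (normal_mix \<rho> \<sigma> x))\<^sup>2) \<le> norm (normal_mix \<pi> \<sigma> x + normal_mix \<rho> \<sigma> x)"
      using le by (intro AE_I2) (smt (verit) real_norm_def zero_le_power2)
  qed measurable
  show "0 \<le> hellinger_sq (normal_mix \<pi> \<sigma>) (normal_mix \<rho> \<sigma>)"
    by (simp add: hellinger_sq_def)
  have "(LINT x|lborel. (sqrt (normal_mix \<pi> \<sigma> x) - sqrt (normal_mix \<rho> \<sigma> x))\<^sup>2)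
      \<le> (LINT x|lborel. normal_mix \<pi> \<sigma> x + normal_mix \<rho> \<sigma> x)"
    by (rule integral_mono[OF i i2 le])
  also have "\<dots> = 2"
    using integrable_normal_mix[OF \<pi> \<sigma>] integrable_normal_mix[OF \<rho> \<sigma>] by simp
  finally show "hellinger_sq (normal_mix \<pi> \<sigma>) (normal_mix \<rho> \<sigma>) \<le> 1"
    by (simp add: hellinger_sq_def)
qed

context
  fixes M \<sigma> R :: real and \<pi> \<rho> :: "real measure"
  assumes \<pi>: "\<pi> \<in> prob_on M" and \<rho>: "\<rho> \<in> prob_on M" and \<sigma>: "\<sigma> > 0" and M: "M > 0" and R: "R > M"
begin

abbreviation (input) "tilt_rate \<equiv> M / \<sigma>\<^sup>2"

definition tsum :: "real \<Rightarrow> real" where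
  "tsum x = tilt \<pi> \<sigma> 0 x + tilt \<rho> \<sigma> 0 x"

definition tdiff :: "nat \<Rightarrow> real \<Rightarrow> real" where
  "tdiff j x = tilt \<pi> \<sigma> j x - tilt \<rho> \<sigma> j x"

text \<open>The normal density with its logarithm continued linearly beyond \<open>R\<close>.  Unlike the normal
  density it has a bounded logarithmic derivative, and it still dominates the normal density.\<close>
definition huber_kernel :: "real \<Rightarrow> real" where
  "huber_kernel x = 1 / sqrt (2 * pi * \<sigma>\<^sup>2) * exp (- (huber R x / \<sigma>\<^sup>2))"

text \<open>With this weight, the square of \<open>tdiff 0\<close> integrates to a chi-square type distance of the two
  mixtures, which is comparable with the squared Hellinger distance.\<close>
definition weight :: "real \<Rightarrow> real" where
  "weight x = huber_kernel x / tsum x"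

lemmas tilt_facts = tilt_0_pos[OF \<pi> \<sigma>] tilt_0_pos[OF \<rho> \<sigma>]

lemma tsum_pos: "tsum x > 0"
  using tilt_facts[of x] by (simp add: tsum_def add_pos_pos)

lemma huber_kernel_pos: "huber_kernel x > 0"
  using \<sigma> by (simp add: huber_kernel_def)

lemma weight_pos: "weight x > 0"
  using tsum_pos huber_kernel_pos by (simp add: weight_def)

lemma tdiff_bound: "\<bar>tdiff j x\<bar> \<le> tilt_rate ^ j * tsum x"
  unfolding tdiff_def tsum_def
  using tilt_abs_bound[OF \<pi> \<sigma>, of j x] tilt_abs_bound[OF \<rho> \<sigma>, of j x]
  by (simp add: algebra_simps)

lemma borel_measurable_tsum_tdiff_weight [measurable]:
  "tsum \<in> borel_measurable borel" "tdiff j \<in> borel_measurable borel"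
  "huber_kernel \<in> borel_measurable borel" "weight \<in> borel_measurable borel"
proof -
  note [measurable] = borel_measurable_tilt[OF \<pi> \<sigma>] borel_measurable_tilt[OF \<rho> \<sigma>]
  show [measurable]: "tsum \<in> borel_measurable borel" "tdiff j \<in> borel_measurable borel"
    unfolding tsum_def[abs_def] tdiff_def[abs_def] by measurable
  show [measurable]: "huber_kernel \<in> borel_measurable borel"
    unfolding huber_kernel_def[abs_def] huber_def[abs_def] by measurable
  show "weight \<in> borel_measurable borel"
    unfolding weight_def[abs_def] by measurable
qed

text \<open>The exponential moments grow at most like \<open>exp (M * \<bar>x\<bar> / \<sigma>\<^sup>2)\<close>; for \<open>R > M\<close> the linear tail of the
  kernel wins.\<close>
lemma tsum_kernel_bound:
  "tsum x * huber_kernel x \<le> 2 / \<sigma> * exp (R\<^sup>2 / (2 * \<sigma>\<^sup>2)) * exp (- ((R - M) / \<sigma>\<^sup>2 * \<bar>x\<bar>))"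
proof -
  have c: "1 / sqrt (2 * pi * \<sigma>\<^sup>2) \<le> 1 / \<sigma>"
  proof -
    have "1 * \<sigma>\<^sup>2 \<le> 2 * pi * \<sigma>\<^sup>2" by (rule mult_right_mono) (use pi_ge_two in auto)
    then have "\<sigma>\<^sup>2 \<le> 2 * pi * \<sigma>\<^sup>2" by simp
    then have "sqrt (\<sigma>\<^sup>2) \<le> sqrt (2 * pi * \<sigma>\<^sup>2)" by (rule real_sqrt_le_mono)
    then show ?thesis using \<sigma> by (simp add: frac_le)
  qed
  have "tsum x \<le> 2 * exp (\<bar>x\<bar> * tilt_rate)"
    using tilt_0_upper[OF \<pi> \<sigma>, of x] tilt_0_upper[OF \<rho> \<sigma>, of x] by (simp add: tsum_def)
  moreover have "huber_kernel x \<le> 1 / \<sigma> * exp (- ((R * \<bar>x\<bar> - R\<^sup>2 / 2) / \<sigma>\<^sup>2))"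
  proof -
    have "(R * \<bar>x\<bar> - R\<^sup>2 / 2) / \<sigma>\<^sup>2 \<le> huber R x / \<sigma>\<^sup>2"
      by (rule divide_right_mono[OF huber_ge]) (use R M in auto)
    then show ?thesis
      unfolding huber_kernel_def using c by (intro mult_mono) (use \<sigma> in auto)
  qed
  ultimately have "tsum x * huber_kernel x
      \<le> (2 * exp (\<bar>x\<bar> * tilt_rate)) * (1 / \<sigma> * exp (- ((R * \<bar>x\<bar> - R\<^sup>2 / 2) / \<sigma>\<^sup>2)))"
    by (intro mult_mono) (use tsum_pos[of x] huber_kernel_pos[of x] \<sigma> in auto)
  also have "\<dots> = 2 / \<sigma> * (exp (\<bar>x\<bar> * tilt_rate) * exp (- ((R * \<bar>x\<bar> - R\<^sup>2 / 2) / \<sigma>\<^sup>2)))"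
    by simp
  also have "exp (\<bar>x\<bar> * tilt_rate) * exp (- ((R * \<bar>x\<bar> - R\<^sup>2 / 2) / \<sigma>\<^sup>2))
      = exp (R\<^sup>2 / (2 * \<sigma>\<^sup>2)) * exp (- ((R - M) / \<sigma>\<^sup>2 * \<bar>x\<bar>))"
    unfolding exp_add[symmetric] using \<sigma> by (simp add: field_simps)
  finally show ?thesis
    by (simp only: mult.assoc)
qed

lemma decay_rate_pos: "(R - M) / \<sigma>\<^sup>2 > 0"
  using R \<sigma> by simp

lemma integrable_tsum_kernel: "integrable lborel (\<lambda>x. tsum x * huber_kernel x)"
proof -
  define C where "C = 2 / \<sigma> * exp (R\<^sup>2 / (2 * \<sigma>\<^sup>2))"
  have C: "C > 0" "\<And>x. tsum x * huber_kernel x \<le> C * exp (- ((R - M) / \<sigma>\<^sup>2 * \<bar>x\<bar>))"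
    using tsum_kernel_bound \<sigma> by (auto simp: C_def)
  have i: "integrable lborel (\<lambda>x. C * exp (- ((R - M) / \<sigma>\<^sup>2 * \<bar>x\<bar>)))"
    using integral_exp_minus_abs(1)[OF decay_rate_pos] by simp
  show ?thesis
    by (rule Bochner_Integration.integrable_bound[OF i])
      (use C tsum_pos huber_kernel_pos in \<open>auto simp: abs_mult less_imp_le\<close>)
qed

lemma tdiff_mult_weight_bound: "\<bar>tdiff i x * tdiff j x * weight x\<bar> \<le> tilt_rate ^ (i + j) * (tsum x * huber_kernel x)"
proof -
  have "\<bar>tdiff i x * tdiff j x * weight x\<bar> \<le> (tilt_rate ^ i * tsum x) * (tilt_rate ^ j * tsum x) * weight x"
    unfolding abs_mult using tdiff_bound[of i x] tdiff_bound[of j x] weight_pos[of x] tsum_pos[of x] M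
    by (intro mult_mono) auto
  also have "\<dots> = tilt_rate ^ (i + j) * (tsum x * huber_kernel x)"
    using tsum_pos[of x] by (simp add: weight_def power_add)
  finally show ?thesis .
qed

lemma integrable_tdiff_mult_weight: "integrable lborel (\<lambda>x. tdiff i x * tdiff j x * weight x)"
proof (rule Bochner_Integration.integrable_bound)
  show "integrable lborel (\<lambda>x. tilt_rate ^ (i + j) * (tsum x * huber_kernel x))"
    using integrable_tsum_kernel by simp
  show "AE x in lborel. norm (tdiff i x * tdiff j x * weight x) \<le> norm (tilt_rate ^ (i + j) * (tsum x * huber_kernel x))"
    unfolding real_norm_def by (intro AE_I2 order_trans[OF tdiff_mult_weight_bound abs_ge_self])
qed measurable

definition wnorm :: "nat \<Rightarrow> real" where
  "wnorm j = sqrt (LINT x|lborel. (tdiff j x)\<^sup>2 * weight x)"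

lemma wnorm_nonneg: "wnorm j \<ge> 0"
  unfolding wnorm_def using weight_pos by (intro real_sqrt_ge_zero integral_nonneg_AE) (auto simp: less_imp_le)

lemma wnorm_square: "(wnorm j)\<^sup>2 = (LINT x|lborel. (tdiff j x)\<^sup>2 * weight x)"
  unfolding wnorm_def using weight_pos by (intro real_sqrt_pow2 integral_nonneg_AE) (auto simp: less_imp_le)

lemma wnorm_bound: "wnorm j \<le> sqrt (LINT x|lborel. tsum x * huber_kernel x) * tilt_rate ^ j"
proof -
  have "(wnorm j)\<^sup>2 \<le> (LINT x|lborel. tilt_rate ^ (j + j) * (tsum x * huber_kernel x))"
    unfolding wnorm_square
  proof (rule integral_mono)
    show "integrable lborel (\<lambda>x. (tdiff j x)\<^sup>2 * weight x)"
      using integrable_tdiff_mult_weight[of j j] by (simp add: power2_eq_square)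
    show "integrable lborel (\<lambda>x. tilt_rate ^ (j + j) * (tsum x * huber_kernel x))"
      using integrable_tsum_kernel by simp
    show "(tdiff j x)\<^sup>2 * weight x \<le> tilt_rate ^ (j + j) * (tsum x * huber_kernel x)" for x
      using tdiff_mult_weight_bound[of j x j] by (simp only: power2_eq_square abs_le_iff)
  qed
  also have "\<dots> = (LINT x|lborel. tsum x * huber_kernel x) * (tilt_rate ^ j)\<^sup>2"
    by (simp add: power_add power2_eq_square)
  finally have "wnorm j \<le> sqrt ((LINT x|lborel. tsum x * huber_kernel x) * (tilt_rate ^ j)\<^sup>2)"
    by (rule real_le_rsqrt)
  also have "\<dots> = sqrt (LINT x|lborel. tsum x * huber_kernel x) * tilt_rate ^ j"
    using M by (simp add: real_sqrt_mult)
  finally show ?thesis .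
qed

lemma DERIV_tdiff: "(tdiff j has_real_derivative tdiff (Suc j) x) (at x)"
  unfolding tdiff_def[abs_def] by (intro DERIV_diff DERIV_tilt[OF \<pi> \<sigma>] DERIV_tilt[OF \<rho> \<sigma>])

text \<open>The logarithmic derivative of \<open>weight\<close>.\<close>
definition wdrift :: "real \<Rightarrow> real" where
  "wdrift x = - ((x - max 0 (x - R) + max 0 (- x - R)) / \<sigma>\<^sup>2) - (tilt \<pi> \<sigma> 1 x + tilt \<rho> \<sigma> 1 x) / tsum x"

lemma DERIV_weight: "(weight has_real_derivative wdrift x * weight x) (at x)"
proof -
  have 1: "(tsum has_real_derivative tilt \<pi> \<sigma> 1 x + tilt \<rho> \<sigma> 1 x) (at x)"
    unfolding tsum_def[abs_def] using DERIV_add[OF DERIV_tilt[OF \<pi> \<sigma>, of 0 x] DERIV_tilt[OF \<rho> \<sigma>, of 0 x]] by simp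
  have 2: "(huber_kernel has_real_derivative - ((x - max 0 (x - R) + max 0 (- x - R)) / \<sigma>\<^sup>2) * huber_kernel x) (at x)"
  proof -
    have "((\<lambda>x. exp (- (huber R x / \<sigma>\<^sup>2))) has_real_derivative
        exp (- (huber R x / \<sigma>\<^sup>2)) * - ((x - max 0 (x - R) + max 0 (- x - R)) / \<sigma>\<^sup>2)) (at x)"
      by (intro DERIV_fun_exp DERIV_minus DERIV_cdivide DERIV_huber)
    from DERIV_cmult[OF this, of "1 / sqrt (2 * pi * \<sigma>\<^sup>2)"] show ?thesis
      unfolding huber_kernel_def[abs_def] by (simp add: mult_ac)
  qed
  have "tsum x \<noteq> 0" using tsum_pos[of x] by simp
  have "((\<lambda>x. huber_kernel x / tsum x) has_real_derivative
     ((- ((x - max 0 (x - R) + max 0 (- x - R)) / \<sigma>\<^sup>2) * huber_kernel x) * tsum x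
       - huber_kernel x * (tilt \<pi> \<sigma> 1 x + tilt \<rho> \<sigma> 1 x)) / (tsum x * tsum x)) (at x)"
    by (rule DERIV_divide[OF 2 1 \<open>tsum x \<noteq> 0\<close>])
  moreover have "(d * h * t - h * e) / (t * t) = (d - e / t) * (h / t)" if "t \<noteq> 0" for d h t e :: real
    using that by (simp add: field_simps)
  ultimately show ?thesis
    unfolding weight_def[abs_def] wdrift_def using \<open>tsum x \<noteq> 0\<close> by (simp only: not_False_eq_True)
qed

lemma wdrift_bound: "\<bar>wdrift x\<bar> \<le> (R + M) / \<sigma>\<^sup>2"
proof -
  have "\<bar>tilt \<pi> \<sigma> 1 x + tilt \<rho> \<sigma> 1 x\<bar> \<le> tilt_rate * tsum x"
    using tilt_abs_bound[OF \<pi> \<sigma>, of 1 x] tilt_abs_bound[OF \<rho> \<sigma>, of 1 x]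
    by (simp add: tsum_def algebra_simps)
  then have "\<bar>(tilt \<pi> \<sigma> 1 x + tilt \<rho> \<sigma> 1 x) / tsum x\<bar> \<le> tilt_rate"
    using tsum_pos[of x] by (simp add: pos_divide_le_eq)
  moreover have "\<bar>(x - max 0 (x - R) + max 0 (- x - R)) / \<sigma>\<^sup>2\<bar> \<le> R / \<sigma>\<^sup>2"
    using huber_deriv_bound[of R x] R M by (simp add: divide_right_mono)
  ultimately show ?thesis
    unfolding wdrift_def by (simp add: add_divide_distrib del: abs_divide)
qed

lemma continuous_tdiff: "continuous_on S (tdiff j)"
  by (meson DERIV_isCont DERIV_tdiff continuous_at_imp_continuous_on)

lemma continuous_weight: "continuous_on S weight"
  by (meson DERIV_isCont DERIV_weight continuous_at_imp_continuous_on)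

lemma continuous_wdrift: "continuous_on S wdrift"
proof -
  have "tilt \<pi> \<sigma> 0 x + tilt \<rho> \<sigma> 0 x \<noteq> 0" for x using tsum_pos[of x] by (simp add: tsum_def)
  then show ?thesis
    unfolding wdrift_def[abs_def] tsum_def
    by (intro continuous_intros continuous_tilt[OF \<pi> \<sigma>] continuous_tilt[OF \<rho> \<sigma>]) (use \<sigma> in auto)
qed

text \<open>Integrate the derivative of \<open>tdiff j * tdiff (j + 1) * weight\<close> over the line.  The result is
  zero, and solving for the square of \<open>tdiff (j + 1)\<close> leaves the product of its two neighbours and a
  term with the drift of the weight; both are estimated by Cauchy-Schwarz.\<close>
lemma wnorm_rec: "(wnorm (j + 1))\<^sup>2 \<le> wnorm j * (wnorm (j + 2) + (R + M) / \<sigma>\<^sup>2 * wnorm (j + 1))"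
proof -
  let ?f = "\<lambda>x. tdiff j x * tdiff (Suc j) x * weight x"
  let ?A = "\<lambda>x. tdiff (Suc j) x * tdiff (Suc j) x * weight x"
  let ?B = "\<lambda>x. tdiff j x * tdiff (Suc (Suc j)) x * weight x"
  let ?D = "\<lambda>x. wdrift x * ?f x"
  have [measurable]: "wdrift \<in> borel_measurable borel"
    by (intro borel_measurable_continuous_onI continuous_wdrift)
  have iD: "integrable lborel ?D"
  proof (rule Bochner_Integration.integrable_bound)
    show "integrable lborel (\<lambda>x. (R + M) / \<sigma>\<^sup>2 * ?f x)"
      using integrable_tdiff_mult_weight by simp
    show "AE x in lborel. norm (?D x) \<le> norm ((R + M) / \<sigma>\<^sup>2 * ?f x)"
      unfolding norm_mult
      using order_trans[OF wdrift_bound abs_ge_self]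
      by (intro AE_I2 mult_right_mono) auto
  qed measurable
  have iA: "integrable lborel ?A" and iB: "integrable lborel ?B" and iF: "integrable lborel ?f"
    by (rule integrable_tdiff_mult_weight)+
  have "(LINT x|lborel. ?A x + ?B x + ?D x) = 0"
  proof (rule integral_deriv_eq_0)
    show "(?f has_real_derivative ?A x + ?B x + ?D x) (at x)" for x
    proof -
      have "(?f has_real_derivative
        (tdiff (Suc j) x * tdiff (Suc j) x + tdiff (Suc (Suc j)) x * tdiff j x) * weight x
          + (wdrift x * weight x) * (tdiff j x * tdiff (Suc j) x)) (at x)"
        by (rule DERIV_mult[OF DERIV_mult[OF DERIV_tdiff DERIV_tdiff] DERIV_weight])
      then show ?thesis by (simp add: algebra_simps)
    qed
    show "continuous_on UNIV (\<lambda>x. ?A x + ?B x + ?D x)"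
      by (intro continuous_intros continuous_tdiff continuous_weight continuous_wdrift)
    show "integrable lborel (\<lambda>x. ?A x + ?B x + ?D x)"
      using iA iB iD by simp
    define C where "C = 2 / \<sigma> * exp (R\<^sup>2 / (2 * \<sigma>\<^sup>2))"
  have C: "C > 0" "\<And>x. tsum x * huber_kernel x \<le> C * exp (- ((R - M) / \<sigma>\<^sup>2 * \<bar>x\<bar>))"
    using tsum_kernel_bound \<sigma> by (auto simp: C_def)
    have b: "\<bar>?f x\<bar> \<le> tilt_rate ^ (j + Suc j) * C * exp (- ((R - M) / \<sigma>\<^sup>2 * \<bar>x\<bar>))" for x
    proof -
      have "\<bar>?f x\<bar> \<le> tilt_rate ^ (j + Suc j) * (tsum x * huber_kernel x)"
        by (rule tdiff_mult_weight_bound)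
      also have "\<dots> \<le> tilt_rate ^ (j + Suc j) * (C * exp (- ((R - M) / \<sigma>\<^sup>2 * \<bar>x\<bar>)))"
        by (rule mult_left_mono[OF C(2)]) (use M in simp)
      finally show ?thesis by (simp only: mult.assoc)
    qed
    show "(?f \<longlongrightarrow> 0) at_top" "(?f \<longlongrightarrow> 0) at_bot"
      by (rule tendsto_0_if_le_exp_minus_abs[OF decay_rate_pos b])+
  qed
  then have eq: "(LINT x|lborel. ?A x) = - (LINT x|lborel. ?B x) - (LINT x|lborel. ?D x)"
    using iA iB iD by simp
  have CS: "(LINT x|lborel. \<bar>tdiff i x * tdiff l x\<bar> * weight x) \<le> wnorm i * wnorm l" for i l
    unfolding wnorm_def
  proof (rule Cauchy_Schwarz_integral_weighted)
    show "integrable lborel (\<lambda>x. (tdiff i x)\<^sup>2 * weight x)" "integrable lborel (\<lambda>x. (tdiff l x)\<^sup>2 * weight x)"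
      using integrable_tdiff_mult_weight[of i i] integrable_tdiff_mult_weight[of l l] by (simp_all add: power2_eq_square)
  qed (use weight_pos integrable_tdiff_mult_weight in \<open>auto simp: less_imp_le\<close>)
  have "- (LINT x|lborel. ?B x) \<le> (LINT x|lborel. \<bar>?B x\<bar>)"
    using integral_abs_bound[of lborel ?B] by linarith
  also have "\<dots> \<le> wnorm j * wnorm (Suc (Suc j))"
    using CS[of j "Suc (Suc j)"] weight_pos by (simp add: abs_mult less_imp_le)
  finally have 1: "- (LINT x|lborel. ?B x) \<le> wnorm j * wnorm (Suc (Suc j))" .
  have "- (LINT x|lborel. ?D x) \<le> (LINT x|lborel. \<bar>?D x\<bar>)"
    using integral_abs_bound[of lborel ?D] by linarith
  also have "\<dots> \<le> (LINT x|lborel. (R + M) / \<sigma>\<^sup>2 * \<bar>?f x\<bar>)"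
  proof (rule integral_mono)
    show "\<bar>?D x\<bar> \<le> (R + M) / \<sigma>\<^sup>2 * \<bar>?f x\<bar>" for x
      unfolding abs_mult[of "wdrift x"] by (rule mult_right_mono[OF wdrift_bound]) simp
  qed (use iD iF in auto)
  also have "\<dots> = (R + M) / \<sigma>\<^sup>2 * (LINT x|lborel. \<bar>?f x\<bar>)"
    by simp
  also have "\<dots> \<le> (R + M) / \<sigma>\<^sup>2 * (wnorm j * wnorm (Suc j))"
    using CS[of j "Suc j"] weight_pos R M by (intro mult_left_mono) (auto simp: abs_mult less_imp_le)
  finally have 2: "- (LINT x|lborel. ?D x) \<le> (R + M) / \<sigma>\<^sup>2 * (wnorm j * wnorm (Suc j))" .
  have "(wnorm (Suc j))\<^sup>2 = (LINT x|lborel. ?A x)"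
    by (subst wnorm_square) (simp add: power2_eq_square)
  then show ?thesis
    using eq 1 2 by (simp add: algebra_simps)
qed


lemma huber_kernel_ge: "normal_density 0 \<sigma> x \<le> huber_kernel x"
proof -
  have "huber R x / \<sigma>\<^sup>2 \<le> (x\<^sup>2 / 2) / \<sigma>\<^sup>2"
    by (rule divide_right_mono[OF huber_le]) simp
  then show ?thesis
    unfolding huber_kernel_def normal_density_def using \<sigma> by (intro mult_left_mono) auto
qed

lemma huber_kernel_eq: "\<bar>x\<bar> \<le> R \<Longrightarrow> huber_kernel x = normal_density 0 \<sigma> x"
  by (simp add: huber_kernel_def normal_density_def huber_eq_square)

text \<open>Factor \<open>u - v\<close> as a difference of squares and use \<open>(sqrt u + sqrt v)\<^sup>2 \<le> 2 * (u + v)\<close>.\<close>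
lemma diff_square_div_sum_le: "(u - v)\<^sup>2 / (u + v) \<le> 2 * (sqrt u - sqrt v)\<^sup>2" if "u > 0" "v > 0" for u v :: real
proof -
  have "u - v = (sqrt u - sqrt v) * (sqrt u + sqrt v)"
    using that by (simp add: algebra_simps)
  then have "(u - v)\<^sup>2 = (sqrt u - sqrt v)\<^sup>2 * (sqrt u + sqrt v)\<^sup>2"
    by (simp add: power_mult_distrib)
  also have "\<dots> \<le> (sqrt u - sqrt v)\<^sup>2 * (2 * (u + v))"
  proof (rule mult_left_mono)
    have "0 \<le> (sqrt u - sqrt v)\<^sup>2" by simp
    then show "(sqrt u + sqrt v)\<^sup>2 \<le> 2 * (u + v)"
      using that by (simp add: power2_sum power2_diff)
  qed simp
  finally show ?thesis using that by (simp add: pos_divide_le_eq algebra_simps)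
qed

context
  fixes L :: real
  assumes L: "L \<ge> 0" and R4: "R \<ge> 4 * (M + 1)" and RL: "R\<^sup>2 \<ge> 4 * \<sigma>\<^sup>2 * L"
begin

text \<open>A bound for the tilted kernel beyond \<open>R\<close>; the factor \<open>exp (- L)\<close> becomes \<open>1 / n\<close>.\<close>
definition kernel_tail :: "real \<Rightarrow> real" where
  "kernel_tail x = 2 / \<sigma> * exp (- L) * exp (- (1 / \<sigma>\<^sup>2 * \<bar>x\<bar>))"

lemma kernel_tail_nonneg: "kernel_tail x \<ge> 0"
  using \<sigma> by (simp add: kernel_tail_def)

lemma integral_kernel_tail: "integrable lborel kernel_tail" "(LINT x|lborel. kernel_tail x) \<le> 4 * \<sigma> * exp (- L)"
proof -
  have s: "1 / \<sigma>\<^sup>2 > 0" using \<sigma> by simp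
  show "integrable lborel kernel_tail"
    unfolding kernel_tail_def[abs_def] using integral_exp_minus_abs(1)[OF s] by simp
  have "(LINT x|lborel. kernel_tail x) = 2 / \<sigma> * exp (- L) * (LINT x|lborel. exp (- (1 / \<sigma>\<^sup>2 * \<bar>x\<bar>)))"
    unfolding kernel_tail_def by (rule integral_mult_right_zero)
  also have "\<dots> \<le> 2 / \<sigma> * exp (- L) * (2 / (1 / \<sigma>\<^sup>2))"
    by (rule mult_left_mono[OF integral_exp_minus_abs(2)[OF s]]) (use \<sigma> in auto)
  also have "\<dots> = 4 * \<sigma> * exp (- L)" using \<sigma> by (simp add: power2_eq_square)
  finally show "(LINT x|lborel. kernel_tail x) \<le> 4 * \<sigma> * exp (- L)" .
qed

text \<open>Of the decay rate \<open>R - M\<close>, one unit keeps the bound integrable and the rest, evaluated at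
  \<open>\<bar>x\<bar> = R\<close>, yields \<open>R\<^sup>2 / 4 \<ge> \<sigma>\<^sup>2 * L\<close> in the exponent.\<close>
lemma tsum_kernel_le_tail:
  assumes x: "\<bar>x\<bar> > R"
  shows "tsum x * huber_kernel x \<le> kernel_tail x"
proof -
  have "exp (R\<^sup>2 / (2 * \<sigma>\<^sup>2)) * exp (- ((R - M) / \<sigma>\<^sup>2 * \<bar>x\<bar>)) \<le> exp (- L) * exp (- (1 / \<sigma>\<^sup>2 * \<bar>x\<bar>))"
    unfolding exp_add[symmetric]
  proof (rule iffD2[OF exp_le_cancel_iff])
    have "(R - M - 1) * R \<le> (R - M - 1) * \<bar>x\<bar>"
      by (rule mult_left_mono) (use x R4 M in auto)
    moreover have "4 * (M + 1) * R \<le> R * R"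
      by (rule mult_right_mono) (use R4 M in auto)
    ultimately have "\<sigma>\<^sup>2 * L + \<bar>x\<bar> + R\<^sup>2 / 2 \<le> (R - M) * \<bar>x\<bar>"
      using RL by (simp add: algebra_simps power2_eq_square)
    then have "(\<sigma>\<^sup>2 * L + \<bar>x\<bar> + R\<^sup>2 / 2) / \<sigma>\<^sup>2 \<le> (R - M) * \<bar>x\<bar> / \<sigma>\<^sup>2"
      by (rule divide_right_mono) simp
    moreover have "(\<sigma>\<^sup>2 * L + \<bar>x\<bar> + R\<^sup>2 / 2) / \<sigma>\<^sup>2 = L + 1 / \<sigma>\<^sup>2 * \<bar>x\<bar> + R\<^sup>2 / (2 * \<sigma>\<^sup>2)"
      using \<sigma> by (simp add: add_divide_distrib)
    ultimately show "R\<^sup>2 / (2 * \<sigma>\<^sup>2) + - ((R - M) / \<sigma>\<^sup>2 * \<bar>x\<bar>) \<le> - L + - (1 / \<sigma>\<^sup>2 * \<bar>x\<bar>)"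
      by simp
  qed
  then have "2 / \<sigma> * (exp (R\<^sup>2 / (2 * \<sigma>\<^sup>2)) * exp (- ((R - M) / \<sigma>\<^sup>2 * \<bar>x\<bar>)))
      \<le> 2 / \<sigma> * (exp (- L) * exp (- (1 / \<sigma>\<^sup>2 * \<bar>x\<bar>)))"
    by (rule mult_left_mono) (use \<sigma> in simp)
  then show ?thesis
    using tsum_kernel_bound[of x] unfolding kernel_tail_def by (simp only: mult.assoc)
qed

lemma integral_tsum_kernel: "(LINT x|lborel. tsum x * huber_kernel x) \<le> 2 + 4 * \<sigma>"
proof -
  note i = integrable_normal_mix[OF \<pi> \<sigma>] integrable_normal_mix[OF \<rho> \<sigma>]
  have "(LINT x|lborel. tsum x * huber_kernel x)
      \<le> (LINT x|lborel. (normal_mix \<pi> \<sigma> x + normal_mix \<rho> \<sigma> x) + kernel_tail x)"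
  proof (rule integral_mono)
    fix x
    have f: "normal_mix \<pi> \<sigma> x + normal_mix \<rho> \<sigma> x = tsum x * normal_density 0 \<sigma> x"
      by (simp add: normal_mix_tilt[OF \<pi> \<sigma>] normal_mix_tilt[OF \<rho> \<sigma>] tsum_def algebra_simps)
    show "tsum x * huber_kernel x \<le> (normal_mix \<pi> \<sigma> x + normal_mix \<rho> \<sigma> x) + kernel_tail x"
    proof (cases "\<bar>x\<bar> \<le> R")
      case True
      then show ?thesis using kernel_tail_nonneg[of x] by (simp add: f huber_kernel_eq)
    next
      case False
      have "0 \<le> tsum x * normal_density 0 \<sigma> x" using tsum_pos[of x] by simp
      then show ?thesis using tsum_kernel_le_tail[of x] False by (simp add: f)
    qed
  qed (use integrable_tsum_kernel i integral_kernel_tail in auto)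
  also have "\<dots> = 2 + (LINT x|lborel. kernel_tail x)"
    using i integral_kernel_tail by simp
  also have "(LINT x|lborel. kernel_tail x) \<le> 4 * \<sigma> * 1"
    by (rule order_trans[OF integral_kernel_tail(2)], rule mult_left_mono) (use \<sigma> L in auto)
  finally show ?thesis by simp
qed

text \<open>Inside \<open>[-R, R]\<close> the kernel is the normal density and \<open>diff_square_div_sum_le\<close> gives the
  Hellinger integrand; outside, the tail bound takes over.\<close>
lemma wnorm_0_bound:
  "(wnorm 0)\<^sup>2 \<le> 4 * hellinger_sq (normal_mix \<pi> \<sigma>) (normal_mix \<rho> \<sigma>) + 4 * \<sigma> * exp (- L)"
proof -
  note h = hellinger_sq_normal_mix(1)[OF \<pi> \<rho> \<sigma>]
  have "(wnorm 0)\<^sup>2 \<le> (LINT x|lborel. 2 * (sqrt (normal_mix \<pi> \<sigma> x) - sqrt (normal_mix \<rho> \<sigma> x))\<^sup>2 + kernel_tail x)"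
    unfolding wnorm_square
  proof (rule integral_mono)
    show "integrable lborel (\<lambda>x. (tdiff 0 x)\<^sup>2 * weight x)"
      using integrable_tdiff_mult_weight[of 0 0] by (simp add: power2_eq_square)
    fix x
    show "(tdiff 0 x)\<^sup>2 * weight x \<le> 2 * (sqrt (normal_mix \<pi> \<sigma> x) - sqrt (normal_mix \<rho> \<sigma> x))\<^sup>2 + kernel_tail x"
    proof (cases "\<bar>x\<bar> \<le> R")
      case True
      have "(tdiff 0 x)\<^sup>2 * weight x = (tdiff 0 x)\<^sup>2 / tsum x * normal_density 0 \<sigma> x"
        by (simp add: weight_def huber_kernel_eq[OF True])
      also have "\<dots> \<le> 2 * (sqrt (tilt \<pi> \<sigma> 0 x) - sqrt (tilt \<rho> \<sigma> 0 x))\<^sup>2 * normal_density 0 \<sigma> x"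
        unfolding tdiff_def tsum_def
        by (rule mult_right_mono[OF diff_square_div_sum_le]) (use tilt_facts[of x] in auto)
      also have "\<dots> = 2 * ((sqrt (tilt \<pi> \<sigma> 0 x) - sqrt (tilt \<rho> \<sigma> 0 x)) * sqrt (normal_density 0 \<sigma> x))\<^sup>2"
        by (simp add: power_mult_distrib)
      also have "\<dots> = 2 * (sqrt (normal_mix \<pi> \<sigma> x) - sqrt (normal_mix \<rho> \<sigma> x))\<^sup>2"
        by (simp add: normal_mix_tilt[OF \<pi> \<sigma>] normal_mix_tilt[OF \<rho> \<sigma>] real_sqrt_mult algebra_simps)
      finally show ?thesis using kernel_tail_nonneg[of x] by simp
    next
      case False
      have "(tdiff 0 x)\<^sup>2 * weight x \<le> tsum x * huber_kernel x"
        using tdiff_mult_weight_bound[of 0 x 0] by (simp add: power2_eq_square abs_le_iff)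
      also have "\<dots> \<le> kernel_tail x" using tsum_kernel_le_tail[of x] False by simp
      also have "\<dots> \<le> 2 * (sqrt (normal_mix \<pi> \<sigma> x) - sqrt (normal_mix \<rho> \<sigma> x))\<^sup>2 + kernel_tail x"
        by simp
      finally show ?thesis .
    qed
  qed (use h integral_kernel_tail in auto)
  also have "\<dots> = 4 * hellinger_sq (normal_mix \<pi> \<sigma>) (normal_mix \<rho> \<sigma>) + (LINT x|lborel. kernel_tail x)"
    using h integral_kernel_tail by (simp add: hellinger_sq_def)
  finally show ?thesis using integral_kernel_tail(2) by linarith
qed

text \<open>If \<open>b\<close> and \<open>c\<close> are the two logarithmic derivatives, then both \<open>(b - c) * F\<close> and
  \<open>(b - c) * G\<close> are linear in the differences of \<open>F, F'\<close> and \<open>G, G'\<close>.  Adding the two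
  identities puts \<open>F + G\<close> in the denominator, which dominates the density of either mixture.\<close>
lemma post_mean_diff_pointwise:
  "(post_mean \<pi> \<sigma> x - post_mean \<rho> \<sigma> x)\<^sup>2 * normal_mix \<rho> \<sigma> x
    \<le> 8 * \<sigma> ^ 4 * ((tdiff 1 x)\<^sup>2 * weight x + tilt_rate\<^sup>2 * ((tdiff 0 x)\<^sup>2 * weight x))"
proof -
  define F F' G G' where FG: "F = tilt \<pi> \<sigma> 0 x" "F' = tilt \<pi> \<sigma> 1 x" "G = tilt \<rho> \<sigma> 0 x" "G' = tilt \<rho> \<sigma> 1 x"
  have pos: "F > 0" "G > 0" using tilt_facts[of x] by (simp_all add: FG)
  define b c where bc: "b = F' / F" "c = G' / G"
  have bb: "\<bar>b + c\<bar> \<le> 2 * tilt_rate"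
  proof -
    have "\<bar>b\<bar> \<le> tilt_rate" "\<bar>c\<bar> \<le> tilt_rate"
      using tilt_ratio_bound[OF \<pi> \<sigma>, of 1 x] tilt_ratio_bound[OF \<rho> \<sigma>, of 1 x]
      unfolding FG bc power_one_right by auto
    then show ?thesis using abs_triangle_ineq[of b c] by linarith
  qed
  have eq: "(b - c) * (F + G) = 2 * (F' - G') - (b + c) * (F - G)"
    using pos by (simp add: bc field_simps)
  have "((b - c) * (F + G))\<^sup>2 \<le> 8 * (F' - G')\<^sup>2 + 8 * tilt_rate\<^sup>2 * (F - G)\<^sup>2"
  proof -
    have sq: "(u - v)\<^sup>2 \<le> 2 * u\<^sup>2 + 2 * v\<^sup>2" for u v :: real
      using zero_le_power2[of "u + v"] by (simp add: power2_sum power2_diff)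
    have "((b + c) * (F - G))\<^sup>2 \<le> (2 * tilt_rate)\<^sup>2 * (F - G)\<^sup>2"
      unfolding power_mult_distrib[of "b + c"]
      by (rule mult_right_mono) (use power_mono[OF bb, of 2] in auto)
    then show ?thesis
    proof -
      have "(2 * (F' - G'))\<^sup>2 = 4 * (F' - G')\<^sup>2" "(2 * tilt_rate)\<^sup>2 * (F - G)\<^sup>2 = 4 * (tilt_rate\<^sup>2 * (F - G)\<^sup>2)"
        by (simp_all only: power_mult_distrib four_x_squared mult.assoc) simp
      then show ?thesis
        using sq[of "2 * (F' - G')" "(b + c) * (F - G)"] \<open>((b + c) * (F - G))\<^sup>2 \<le> (2 * tilt_rate)\<^sup>2 * (F - G)\<^sup>2\<close>
        unfolding eq mult.assoc by linarith
    qed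
  qed
  then have 1: "(b - c)\<^sup>2 * (F + G) \<le> (8 * (F' - G')\<^sup>2 + 8 * tilt_rate\<^sup>2 * (F - G)\<^sup>2) / (F + G)"
    using pos by (simp add: pos_le_divide_eq power_mult_distrib power2_eq_square mult_ac)
  have "(post_mean \<pi> \<sigma> x - post_mean \<rho> \<sigma> x)\<^sup>2 * normal_mix \<rho> \<sigma> x
      = \<sigma> ^ 4 * ((b - c)\<^sup>2 * G) * normal_density 0 \<sigma> x"
  proof -
    have "post_mean \<pi> \<sigma> x - post_mean \<rho> \<sigma> x = \<sigma>\<^sup>2 * (b - c)"
      by (simp add: post_mean_tilt[OF \<pi> \<sigma>] post_mean_tilt[OF \<rho> \<sigma>] bc FG algebra_simps)
    then show ?thesis
      by (simp add: normal_mix_tilt[OF \<rho> \<sigma>] FG power_mult_distrib flip: power_mult)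
  qed
  also have "\<dots> \<le> \<sigma> ^ 4 * ((b - c)\<^sup>2 * (F + G)) * huber_kernel x"
    by (intro mult_mono huber_kernel_ge) (use pos in \<open>auto intro!: mult_nonneg_nonneg\<close>)
  also have "\<dots> \<le> \<sigma> ^ 4 * ((8 * (F' - G')\<^sup>2 + 8 * tilt_rate\<^sup>2 * (F - G)\<^sup>2) / (F + G)) * huber_kernel x"
    by (intro mult_right_mono mult_left_mono 1) (use huber_kernel_pos[of x] in auto)
  also have "\<dots> = 8 * \<sigma> ^ 4 * ((tdiff 1 x)\<^sup>2 * weight x + tilt_rate\<^sup>2 * ((tdiff 0 x)\<^sup>2 * weight x))"
    by (simp add: tdiff_def weight_def tsum_def FG add_divide_distrib algebra_simps)
  finally show ?thesis .
qed

text \<open>By \<open>log_convex_up_to_drift_growth\<close> the norm of the first derivative exceeds that of the difference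
  itself by at most the factor \<open>\<tau>\<close>, where norms below \<open>exp (- L / 2)\<close> count as \<open>exp (- L / 2)\<close>.\<close>
lemma post_mean_L2_bound:
  assumes m: "m \<ge> 1" and D: "sqrt (2 + 4 * \<sigma>) < exp 1 ^ m * exp (- L / 2)"
  defines "\<tau> \<equiv> max (2 * real m * ((R + M) / \<sigma>\<^sup>2)) (2 * exp 1 * tilt_rate)"
    and "H \<equiv> hellinger_sq (normal_mix \<pi> \<sigma>) (normal_mix \<rho> \<sigma>)"
  shows "(LINT x|lborel. (post_mean \<pi> \<sigma> x - post_mean \<rho> \<sigma> x)\<^sup>2 * normal_mix \<rho> \<sigma> x)
    \<le> 8 * \<sigma> ^ 4 * (\<tau>\<^sup>2 + tilt_rate\<^sup>2) * (4 * H + (4 * \<sigma> + 1) * exp (- L))"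
proof -
  have i: "integrable lborel (\<lambda>x. (tdiff j x)\<^sup>2 * weight x)" for j
    using integrable_tdiff_mult_weight[of j j] by (simp add: power2_eq_square)
  have tilt_rate: "tilt_rate > 0" using M \<sigma> by simp
  have "wnorm 1 \<le> \<tau> * max (wnorm 0) (exp (- L / 2))"
    unfolding \<tau>_def
  proof (rule log_convex_up_to_drift_growth[OF wnorm_nonneg wnorm_rec _ tilt_rate _ m _ D])
    have "wnorm m \<le> sqrt (LINT x|lborel. tsum x * huber_kernel x) * tilt_rate ^ m"
      by (rule wnorm_bound)
    also have "\<dots> \<le> sqrt (2 + 4 * \<sigma>) * tilt_rate ^ m"
      by (intro mult_right_mono real_sqrt_le_mono integral_tsum_kernel) (use tilt_rate in simp)
    finally show "wnorm m \<le> sqrt (2 + 4 * \<sigma>) * tilt_rate ^ m" .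
  qed (use R M in auto)
  then have "(wnorm 1)\<^sup>2 \<le> (\<tau> * max (wnorm 0) (exp (- L / 2)))\<^sup>2"
    by (rule power_mono) (rule wnorm_nonneg)
  also have "\<dots> \<le> \<tau>\<^sup>2 * ((wnorm 0)\<^sup>2 + exp (- L))"
  proof -
    have "(exp (- L / 2))\<^sup>2 = exp (- L)" by (simp add: power2_eq_square flip: exp_add)
    then have "(max (wnorm 0) (exp (- L / 2)))\<^sup>2 \<le> (wnorm 0)\<^sup>2 + exp (- L)"
      by (simp add: max_def)
    then show ?thesis by (simp add: power_mult_distrib mult_left_mono)
  qed
  also have "\<dots> \<le> \<tau>\<^sup>2 * (4 * H + (4 * \<sigma> + 1) * exp (- L))"
    by (rule mult_left_mono) (use wnorm_0_bound in \<open>auto simp: H_def algebra_simps\<close>)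
  finally have w1: "(wnorm 1)\<^sup>2 \<le> \<tau>\<^sup>2 * (4 * H + (4 * \<sigma> + 1) * exp (- L))" .
  have w0: "tilt_rate\<^sup>2 * (wnorm 0)\<^sup>2 \<le> tilt_rate\<^sup>2 * (4 * H + (4 * \<sigma> + 1) * exp (- L))"
  proof (rule mult_left_mono)
    have "4 * \<sigma> * exp (- L) \<le> (4 * \<sigma> + 1) * exp (- L)" by simp
    then show "(wnorm 0)\<^sup>2 \<le> 4 * H + (4 * \<sigma> + 1) * exp (- L)"
      using wnorm_0_bound unfolding H_def by linarith
  qed simp
  have "(LINT x|lborel. (post_mean \<pi> \<sigma> x - post_mean \<rho> \<sigma> x)\<^sup>2 * normal_mix \<rho> \<sigma> x)
      \<le> (LINT x|lborel. 8 * \<sigma> ^ 4 * ((tdiff 1 x)\<^sup>2 * weight x + tilt_rate\<^sup>2 * ((tdiff 0 x)\<^sup>2 * weight x)))"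
  proof (rule integral_mono')
    show "integrable lborel (\<lambda>x. 8 * \<sigma> ^ 4 * ((tdiff 1 x)\<^sup>2 * weight x + tilt_rate\<^sup>2 * ((tdiff 0 x)\<^sup>2 * weight x)))"
      using i by simp
  qed (use post_mean_diff_pointwise weight_pos in \<open>auto simp: less_imp_le\<close>)
  also have "\<dots> = 8 * \<sigma> ^ 4 * ((wnorm 1)\<^sup>2 + tilt_rate\<^sup>2 * (wnorm 0)\<^sup>2)"
    unfolding wnorm_square using i by simp
  also have "\<dots> \<le> 8 * \<sigma> ^ 4 * (\<tau>\<^sup>2 * (4 * H + (4 * \<sigma> + 1) * exp (- L)) + tilt_rate\<^sup>2 * (4 * H + (4 * \<sigma> + 1) * exp (- L)))"
    by (rule mult_left_mono[OF add_mono[OF w1 w0]]) simp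
  finally show ?thesis by (simp only: distrib_right mult.assoc)
qed

end

end

lemma ln_nat_ge_half: "n \<ge> 2 \<Longrightarrow> ln (real n) \<ge> 1 / 2"
proof -
  assume "n \<ge> 2"
  then have "ln 2 \<le> ln (real n)" by simp
  moreover have "ln 2 \<ge> (1 / 2 :: real)" using ln2_ge_two_thirds by simp
  ultimately show ?thesis by linarith
qed

text \<open>With \<open>l = ln n\<close>, the tail bound asks for \<open>R\<close> of order \<open>sqrt l\<close> and the growth argument for
  \<open>m\<close> of order \<open>l\<close>.  The factor \<open>\<tau>\<close> is then of order \<open>m * R\<close>, that is \<open>l powr (3 / 2)\<close>, and its
  square is the announced third power.\<close>
proposition post_mean_L2_hellinger:
  assumes M: "M > 0" and k: "0 < k" "k < K"
  obtains C where "C > 0"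
    "\<And>n \<sigma> \<pi> \<rho>. n \<ge> (2::nat) \<Longrightarrow> k < \<sigma> \<Longrightarrow> \<sigma> < K \<Longrightarrow> \<pi> \<in> prob_on M \<Longrightarrow> \<rho> \<in> prob_on M \<Longrightarrow>
      (LINT x|lborel. (post_mean \<pi> \<sigma> x - post_mean \<rho> \<sigma> x)\<^sup>2 * normal_mix \<rho> \<sigma> x)
      \<le> C * ln n ^ 3 * (hellinger_sq (normal_mix \<pi> \<sigma>) (normal_mix \<rho> \<sigma>) + 1 / n)"
proof
  define D where "D = sqrt (2 + 4 * K)"
  have D1: "D \<ge> 1" using k by (simp add: D_def)
  \<comment> \<open>The constants \<open>a\<close> and \<open>b\<close> are those in \<open>m \<le> a * l\<close> and \<open>R + M \<le> b * sqrt l\<close>.\<close>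
  define a where "a = 2 * ln D + 5"
  define b where "b = 2 * K + 2 * (5 * M + 4)"
  define t where "t = (2 * a * b / k\<^sup>2)\<^sup>2 + 8 * (2 * exp 1 * (M / k\<^sup>2))\<^sup>2"
  define C where "C = 8 * K ^ 4 * (t + 8 * (M / k\<^sup>2)\<^sup>2) * (4 * K + 5)"
  have t0: "t \<ge> 0" by (simp add: t_def)
  have B0: "M / k\<^sup>2 > 0" using M k by simp
  show "C > 0" unfolding C_def
    using B0 t0 k by (intro mult_pos_pos add_nonneg_pos zero_less_power) auto
  fix n :: nat and \<sigma> and \<pi> \<rho> :: "real measure"
  assume n: "n \<ge> 2" and \<sigma>: "k < \<sigma>" "\<sigma> < K" and \<pi>: "\<pi> \<in> prob_on M" and \<rho>: "\<rho> \<in> prob_on M"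
  have s0: "\<sigma> > 0" using \<sigma> k by simp
  have "\<bar>k\<bar> \<le> \<bar>\<sigma>\<bar>" using \<sigma> k by simp
  then have k2: "k\<^sup>2 \<le> \<sigma>\<^sup>2" by (simp only: abs_le_square_iff)
  define l where "l = ln (real n)"
  have l: "l \<ge> 1 / 2" using ln_nat_ge_half[OF n] by (simp add: l_def)
  \<comment> \<open>Large enough for both \<open>R \<ge> 4 * (M + 1)\<close> and \<open>R\<^sup>2 \<ge> 4 * \<sigma>\<^sup>2 * l\<close>.\<close>
  define R where "R = 2 * K * sqrt l + 4 * (M + 1)"
  have sl: "1 \<le> 2 * sqrt l"
  proof -
    have "sqrt (1 / 4) \<le> sqrt l" using l by (intro real_sqrt_le_mono) simp
    then show ?thesis by (simp add: real_sqrt_divide)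
  qed
  have RM: "R > M" "R \<ge> 4 * (M + 1)" using k l M by (auto simp: R_def add_nonneg_pos)
  have Rl: "R\<^sup>2 \<ge> 4 * \<sigma>\<^sup>2 * l"
  proof -
    have "4 * \<sigma>\<^sup>2 * l = (2 * \<sigma> * sqrt l)\<^sup>2" using l by (simp add: power_mult_distrib)
    also have "\<dots> \<le> R\<^sup>2"
    proof (rule power_mono)
      have "2 * \<sigma> * sqrt l \<le> 2 * K * sqrt l"
        by (intro mult_right_mono) (use \<sigma> l in auto)
      then show "2 * \<sigma> * sqrt l \<le> R" using M by (simp add: R_def)
    qed (use s0 l in auto)
    finally show ?thesis .
  qed
  define m where "m = nat \<lceil>ln D + l / 2\<rceil> + 1"
  have nn: "0 \<le> ln D + l / 2" using D1 l by (simp add: ln_ge_zero)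
  have m1: "real m \<ge> ln D + l / 2 + 1"
    unfolding m_def using real_nat_ceiling_ge[of "ln D + l / 2"] by simp
  have m2: "real m \<le> ln D + l / 2 + 2"
    unfolding m_def using nn by (simp add: of_nat_nat) linarith
  have m3: "real m \<le> a * l"
  proof -
    have "ln D * 1 \<le> ln D * (2 * l)" by (rule mult_left_mono) (use l D1 in \<open>auto simp: ln_ge_zero\<close>)
    then show ?thesis using m2 l by (simp add: a_def algebra_simps)
  qed
  have De: "sqrt (2 + 4 * \<sigma>) < exp 1 ^ m * exp (- l / 2)"
  proof -
    have "sqrt (2 + 4 * \<sigma>) \<le> D" unfolding D_def using \<sigma> by (intro real_sqrt_le_mono) simp
    also have "D = exp (ln D)" using D1 by simp
    also have "\<dots> < exp (real m - l / 2)" using m1 by simp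
    also have "\<dots> = exp 1 ^ m * exp (- l / 2)"
    proof -
      have "exp 1 ^ m = exp (real m)" using exp_of_nat_mult[of m "1::real"] by simp
      then show ?thesis by (simp add: exp_add[symmetric])
    qed
    finally show ?thesis .
  qed
  define \<tau> where "\<tau> = max (2 * real m * ((R + M) / \<sigma>\<^sup>2)) (2 * exp 1 * (M / \<sigma>\<^sup>2))"
  define H where "H = hellinger_sq (normal_mix \<pi> \<sigma>) (normal_mix \<rho> \<sigma>)"
  have H0: "H \<ge> 0" unfolding H_def by (rule hellinger_sq_normal_mix[OF \<pi> \<rho> s0])
  have main: "(LINT x|lborel. (post_mean \<pi> \<sigma> x - post_mean \<rho> \<sigma> x)\<^sup>2 * normal_mix \<rho> \<sigma> x)
    \<le> 8 * \<sigma> ^ 4 * (\<tau>\<^sup>2 + (M / \<sigma>\<^sup>2)\<^sup>2) * (4 * H + (4 * \<sigma> + 1) * exp (- l))"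
    unfolding \<tau>_def H_def
    by (rule post_mean_L2_bound[OF \<pi> \<rho> s0 M RM(1) _ RM(2) Rl _ De]) (use l in \<open>auto simp: m_def\<close>)
  have e: "exp (- l) = 1 / real n" using n by (simp add: l_def exp_minus divide_inverse)
  have l3: "1 \<le> 8 * l ^ 3"
  proof -
    have "(1 / 2) ^ 3 \<le> l ^ 3" by (rule power_mono) (use l in auto)
    then show ?thesis by (simp add: power3_eq_cube)
  qed
  have Bs: "M / \<sigma>\<^sup>2 \<le> M / k\<^sup>2" using k2 M k s0 by (intro divide_left_mono) auto
  have Bs2: "(M / \<sigma>\<^sup>2)\<^sup>2 \<le> (M / k\<^sup>2)\<^sup>2" by (rule power_mono[OF Bs]) (use M in simp)
  have \<tau>2: "\<tau>\<^sup>2 \<le> t * l ^ 3"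
  proof -
    have "R + M \<le> b * sqrt l"
    proof -
      have "(5 * M + 4) * 1 \<le> (5 * M + 4) * (2 * sqrt l)" by (rule mult_left_mono[OF sl]) (use M in simp)
      then show ?thesis by (simp add: R_def b_def algebra_simps)
    qed
    then have "(R + M) / \<sigma>\<^sup>2 \<le> b * sqrt l / k\<^sup>2"
      using k2 k s0 RM M l by (intro frac_le) (auto simp: b_def)
    then have "2 * real m * ((R + M) / \<sigma>\<^sup>2) \<le> 2 * (a * l) * (b * sqrt l / k\<^sup>2)"
      using m3 RM M l D1 by (intro mult_mono) (auto simp: a_def ln_ge_zero)
    also have "\<dots> = (2 * a * b / k\<^sup>2) * (l * sqrt l)" by simp
    finally have "(2 * real m * ((R + M) / \<sigma>\<^sup>2))\<^sup>2 \<le> ((2 * a * b / k\<^sup>2) * (l * sqrt l))\<^sup>2"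
      by (rule power_mono) (use RM M in auto)
    also have "\<dots> = (2 * a * b / k\<^sup>2)\<^sup>2 * l ^ 3"
    proof -
      have "(l * sqrt l)\<^sup>2 = l ^ 3" using l by (simp add: power_mult_distrib power2_eq_square power3_eq_cube)
      then show ?thesis by (simp only: power_mult_distrib[of "2 * a * b / k\<^sup>2"])
    qed
    finally have 1: "(2 * real m * ((R + M) / \<sigma>\<^sup>2))\<^sup>2 \<le> (2 * a * b / k\<^sup>2)\<^sup>2 * l ^ 3" .
    have "(2 * exp 1 * (M / \<sigma>\<^sup>2))\<^sup>2 \<le> (2 * exp 1 * (M / k\<^sup>2))\<^sup>2 * 1"
      unfolding mult_1_right power_mult_distrib[of "2 * exp 1"] by (rule mult_left_mono[OF Bs2]) simp
    also have "\<dots> \<le> (2 * exp 1 * (M / k\<^sup>2))\<^sup>2 * (8 * l ^ 3)"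
      by (rule mult_left_mono[OF l3]) simp
    finally have 2: "(2 * exp 1 * (M / \<sigma>\<^sup>2))\<^sup>2 \<le> 8 * (2 * exp 1 * (M / k\<^sup>2))\<^sup>2 * l ^ 3" by simp
    have "\<tau>\<^sup>2 \<le> (2 * real m * ((R + M) / \<sigma>\<^sup>2))\<^sup>2 + (2 * exp 1 * (M / \<sigma>\<^sup>2))\<^sup>2"
      unfolding \<tau>_def by (simp add: max_def)
    with 1 2 show ?thesis unfolding t_def by (simp only: distrib_right)
  qed
  have "8 * \<sigma> ^ 4 * (\<tau>\<^sup>2 + (M / \<sigma>\<^sup>2)\<^sup>2) * (4 * H + (4 * \<sigma> + 1) * exp (- l))
      \<le> 8 * K ^ 4 * ((t + 8 * (M / k\<^sup>2)\<^sup>2) * l ^ 3) * ((4 * K + 5) * (H + 1 / n))"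
  proof (intro mult_mono power_mono)
    have "(M / k\<^sup>2)\<^sup>2 * 1 \<le> (M / k\<^sup>2)\<^sup>2 * (8 * l ^ 3)" by (rule mult_left_mono[OF l3]) simp
    then show "\<tau>\<^sup>2 + (M / \<sigma>\<^sup>2)\<^sup>2 \<le> (t + 8 * (M / k\<^sup>2)\<^sup>2) * l ^ 3"
      using \<tau>2 Bs2 by (simp only: distrib_right)
    have "4 * H \<le> (4 * K + 5) * H" by (rule mult_right_mono) (use k H0 in auto)
    moreover have "(4 * \<sigma> + 1) * (1 / n) \<le> (4 * K + 5) * (1 / n)" by (rule mult_right_mono) (use \<sigma> in auto)
    ultimately show "4 * H + (4 * \<sigma> + 1) * exp (- l) \<le> (4 * K + 5) * (H + 1 / n)"
      unfolding e distrib_left by linarith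
  qed (use \<sigma> s0 t0 l k H0 in auto)
  also have "\<dots> = C * l ^ 3 * (H + 1 / n)" by (simp add: C_def)
  finally show "(LINT x|lborel. (post_mean \<pi> \<sigma> x - post_mean \<rho> \<sigma> x)\<^sup>2 * normal_mix \<rho> \<sigma> x)
      \<le> C * ln n ^ 3 * (hellinger_sq (normal_mix \<pi> \<sigma>) (normal_mix \<rho> \<sigma>) + 1 / n)"
    using main unfolding l_def H_def by linarith
qed

section \<open>A finite net of priors\<close>

text \<open>A single term of the series of \<open>exp (exp 1 * Y)\<close> is at most the whole series.\<close>
lemma power_div_fact_le:
  fixes Y :: real
  assumes "Y \<ge> 0"
  shows "Y ^ m / fact m \<le> exp (exp 1 * Y - real m)"
proof -
  have "(exp 1 * Y) ^ m / fact m \<le> exp (exp 1 * Y)"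
  proof -
    have s: "(\<lambda>n. (exp 1 * Y) ^ n / fact n) sums exp (exp 1 * Y)"
      using exp_converges[of "exp 1 * Y"] by (simp add: divide_inverse mult.commute)
    have "(\<Sum>n\<in>{m}. (exp 1 * Y) ^ n / fact n) \<le> suminf (\<lambda>n. (exp 1 * Y) ^ n / fact n)"
      by (rule sum_le_suminf[OF sums_summable[OF s]]) (use assms in auto)
    then show ?thesis using sums_unique[OF s] by simp
  qed
  moreover have "exp 1 ^ m = exp (real m)" using exp_of_nat_mult[of m "1::real"] by simp
  ultimately show ?thesis
    by (simp add: power_mult_distrib exp_diff pos_le_divide_eq mult.commute)
qed

lemma sum_power_div_fact_le_exp:
  fixes Y :: real
  assumes "Y \<ge> 0"
  shows "(\<Sum>l<m. Y ^ l / fact l) \<le> exp Y"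
proof -
  have s: "(\<lambda>n. Y ^ n / fact n) sums exp Y"
    using exp_converges[of Y] by (simp add: divide_inverse mult.commute)
  have "(\<Sum>l<m. Y ^ l / fact l) \<le> suminf (\<lambda>n. Y ^ n / fact n)"
    by (rule sum_le_suminf[OF sums_summable[OF s]]) (use assms in auto)
  then show ?thesis using sums_unique[OF s] by simp
qed

lemma exp_taylor_remainder:
  fixes y Y :: real
  assumes "\<bar>y\<bar> \<le> Y"
  shows "\<bar>exp y - (\<Sum>l<m. y ^ l / fact l)\<bar> \<le> exp (exp 1 * Y - real m) * exp Y"
proof -
  obtain t where t: "\<bar>t\<bar> \<le> \<bar>y\<bar>" "exp y = (\<Sum>l<m. y ^ l / fact l) + exp t / fact m * y ^ m"
    using Maclaurin_exp_le[of y m] by blast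
  have "\<bar>exp y - (\<Sum>l<m. y ^ l / fact l)\<bar> = exp t * (\<bar>y\<bar> ^ m / fact m)"
    unfolding t(2) by (simp add: abs_mult power_abs)
  also have "\<dots> \<le> exp Y * (Y ^ m / fact m)"
    using t(1) assms by (intro mult_mono divide_right_mono power_mono) auto
  also have "\<dots> \<le> exp Y * exp (exp 1 * Y - real m)"
    by (intro mult_left_mono power_div_fact_le) (use assms in auto)
  finally show ?thesis by (simp add: mult.commute)
qed

text \<open>Moments of the prior rescaled to \<open>[-1, 1]\<close>, so that all of them lie in \<open>[-1, 1]\<close>.\<close>
definition scaled_moment :: "real \<Rightarrow> nat \<Rightarrow> real measure \<Rightarrow> real" where
  "scaled_moment M r \<pi> = (LINT t|\<pi>. (t / M) ^ r)"

lemma scaled_abs_le_1: "\<bar>t\<bar> \<le> M \<Longrightarrow> M > 0 \<Longrightarrow> \<bar>t / M\<bar> \<le> 1" for t M :: real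
  by simp

lemma integrable_power_scaled:
  assumes \<pi>: "\<pi> \<in> prob_on M" and M: "M > 0"
  shows "integrable \<pi> (\<lambda>t. (t / M) ^ r)"
proof -
  note p = prob_onD[OF \<pi>]
  interpret prob_space \<pi> by (rule p)
  note [measurable_cong] = p(2)
  show ?thesis
  proof (rule integrable_const_bound[where B=1])
    show "AE t in \<pi>. norm ((t / M) ^ r) \<le> 1"
      using p(3)
    proof eventually_elim
      case (elim t)
      show ?case unfolding real_norm_def power_abs
        by (rule power_le_one[OF abs_ge_zero scaled_abs_le_1[OF elim M]])
    qed
  qed measurable
qed

lemma scaled_moment_abs_le_1:
  assumes \<pi>: "\<pi> \<in> prob_on M" and M: "M > 0"
  shows "\<bar>scaled_moment M r \<pi>\<bar> \<le> 1"
proof -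
  note p = prob_onD[OF \<pi>]
  interpret prob_space \<pi> by (rule p)
  have "\<bar>scaled_moment M r \<pi>\<bar> \<le> (LINT t|\<pi>. \<bar>(t / M) ^ r\<bar>)"
    unfolding scaled_moment_def by (rule integral_abs_bound)
  also have "\<dots> \<le> 1"
  proof (rule integral_le_const)
    show "AE t in \<pi>. \<bar>(t / M) ^ r\<bar> \<le> 1"
      using p(3)
    proof eventually_elim
      case (elim t)
      show ?case unfolding power_abs
        by (rule power_le_one[OF abs_ge_zero scaled_abs_le_1[OF elim M]])
    qed
  qed (use integrable_power_scaled[OF assms] in simp)
  finally show ?thesis .
qed

text \<open>In the rescaled variable the exponent of \<open>tilt\<close> is a quadratic polynomial without constant term.
  The coefficients \<open>a\<close> and \<open>b\<close> carry the dependence on \<open>x\<close> and \<open>\<sigma>\<close>.\<close>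
definition tilted_moment :: "real \<Rightarrow> nat \<Rightarrow> real \<Rightarrow> real \<Rightarrow> real measure \<Rightarrow> real" where
  "tilted_moment M j a b \<pi> = (LINT t|\<pi>. (t / M) ^ j * exp (a * (t / M) + b * (t / M)\<^sup>2))"

lemma quadratic_abs_le:
  fixes a b Y s :: real
  assumes "\<bar>a\<bar> + \<bar>b\<bar> \<le> Y" "\<bar>s\<bar> \<le> 1"
  shows "\<bar>a * s + b * s\<^sup>2\<bar> \<le> Y"
proof -
  have "\<bar>a * s\<bar> \<le> \<bar>a\<bar> * 1"
    unfolding abs_mult by (rule mult_left_mono) (use assms in auto)
  moreover have "\<bar>b * s\<^sup>2\<bar> \<le> \<bar>b\<bar> * 1"
  proof -
    have "\<bar>s\<bar>\<^sup>2 \<le> 1" by (rule power_le_one) (use assms in auto)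
    then show ?thesis unfolding abs_mult by (intro mult_left_mono) auto
  qed
  ultimately show ?thesis using abs_triangle_ineq[of "a * s" "b * s\<^sup>2"] assms by linarith
qed

lemma integrable_tilted_moment:
  assumes \<pi>: "\<pi> \<in> prob_on M" and M: "M > 0"
  shows "integrable \<pi> (\<lambda>t. (t / M) ^ j * exp (a * (t / M) + b * (t / M)\<^sup>2))"
proof -
  note p = prob_onD[OF \<pi>]
  interpret prob_space \<pi> by (rule p)
  note [measurable_cong] = p(2)
  show ?thesis
  proof (rule integrable_const_bound[where B="1 * exp (\<bar>a\<bar> + \<bar>b\<bar>)"])
    show "AE t in \<pi>. norm ((t / M) ^ j * exp (a * (t / M) + b * (t / M)\<^sup>2)) \<le> 1 * exp (\<bar>a\<bar> + \<bar>b\<bar>)"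
      using p(3)
    proof eventually_elim
      case (elim t)
      note s = scaled_abs_le_1[OF elim M]
      have "\<bar>t / M\<bar> ^ j \<le> 1" by (rule power_le_one[OF abs_ge_zero s])
      moreover have "exp (a * (t / M) + b * (t / M)\<^sup>2) \<le> exp (\<bar>a\<bar> + \<bar>b\<bar>)"
        using quadratic_abs_le[OF order_refl s, of a b] by simp
      ultimately show ?case
        unfolding real_norm_def abs_mult power_abs abs_exp_cancel by (intro mult_mono) auto
    qed
  qed measurable
qed

text \<open>Truncate the exponential series at degree \<open>m\<close>.  The truncated integrand is a polynomial of
  degree below \<open>2 * m\<close>, whose coefficients have absolute sum at most \<open>exp Y\<close>; the truncation
  error is super-exponentially small in \<open>m\<close>.\<close>
lemma tilted_moment_close:
  assumes \<pi>: "\<pi> \<in> prob_on M" and \<rho>: "\<rho> \<in> prob_on M" and M: "M > 0"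
    and Y: "\<bar>a\<bar> + \<bar>b\<bar> \<le> Y" and j: "j \<le> 1"
    and close: "\<And>r. r < 2 * m \<Longrightarrow> \<bar>scaled_moment M r \<pi> - scaled_moment M r \<rho>\<bar> \<le> \<delta>"
    and \<delta>: "\<delta> \<ge> 0"
  shows "\<bar>tilted_moment M j a b \<pi> - tilted_moment M j a b \<rho>\<bar> \<le> (\<delta> + 2 * exp (exp 1 * Y - real m)) * exp Y"
proof -
  have Y0: "Y \<ge> 0" using Y by linarith
  define p where "p = (\<lambda>t. \<Sum>l<m. (t / M) ^ j * (a * (t / M) + b * (t / M)\<^sup>2) ^ l / fact l)"
  define c where "c = (\<lambda>l i. of_nat (l choose i) * a ^ i * b ^ (l - i) / fact l)"
  have p_eq: "p = (\<lambda>t. \<Sum>l<m. \<Sum>i\<le>l. c l i * (t / M) ^ (j + i + 2 * (l - i)))"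
  proof (rule ext)
    fix t
    have "s ^ j * (a * s + b * s\<^sup>2) ^ l / fact l
        = (\<Sum>i\<le>l. c l i * s ^ (j + i + 2 * (l - i)))" for l and s :: real
      unfolding binomial_ring sum_distrib_left sum_divide_distrib
      by (rule sum.cong) (simp_all add: c_def power_mult_distrib power_add power_mult)
    note this[of "t / M"]
    then show "p t = (\<Sum>l<m. \<Sum>i\<le>l. c l i * (t / M) ^ (j + i + 2 * (l - i)))"
      by (simp add: p_def)
  qed
  have int_p: "integrable \<mu> p" "(LINT t|\<mu>. p t) = (\<Sum>l<m. \<Sum>i\<le>l. c l i * scaled_moment M (j + i + 2 * (l - i)) \<mu>)"
    if \<mu>: "\<mu> \<in> prob_on M" for \<mu>
    unfolding p_eq scaled_moment_def
    using integrable_power_scaled[OF \<mu> M]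
    by (simp_all add: Bochner_Integration.integral_sum del: power_divide)
  have rem: "\<bar>tilted_moment M j a b \<mu> - (LINT t|\<mu>. p t)\<bar> \<le> exp (exp 1 * Y - real m) * exp Y"
    if \<mu>: "\<mu> \<in> prob_on M" for \<mu>
  proof -
    note pr = prob_onD[OF \<mu>]
    interpret prob_space \<mu> by (rule pr)
    let ?q = "\<lambda>t. (t / M) ^ j * exp (a * (t / M) + b * (t / M)\<^sup>2)"
    note iq = integrable_tilted_moment[OF \<mu> M, of j a b]
    have eq: "tilted_moment M j a b \<mu> - (LINT t|\<mu>. p t) = (LINT t|\<mu>. ?q t - p t)"
      unfolding tilted_moment_def by (rule Bochner_Integration.integral_diff[symmetric, OF iq int_p(1)[OF \<mu>]])
    have "\<bar>LINT t|\<mu>. ?q t - p t\<bar> \<le> (LINT t|\<mu>. \<bar>?q t - p t\<bar>)" by (rule integral_abs_bound)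
    also have "\<dots> \<le> exp (exp 1 * Y - real m) * exp Y"
    proof (rule integral_le_const)
      show "integrable \<mu> (\<lambda>t. \<bar>?q t - p t\<bar>)"
        by (rule integrable_abs[OF Bochner_Integration.integrable_diff[OF iq int_p(1)[OF \<mu>]]])
      show "AE t in \<mu>. \<bar>?q t - p t\<bar> \<le> exp (exp 1 * Y - real m) * exp Y"
        using pr(3)
      proof eventually_elim
        case (elim t)
        define s where "s = t / M"
        have s: "\<bar>s\<bar> \<le> 1" unfolding s_def by (rule scaled_abs_le_1[OF elim M])
        define y where "y = a * s + b * s\<^sup>2"
        have "?q t - p t = s ^ j * (exp y - (\<Sum>l<m. y ^ l / fact l))"
          unfolding p_def s_def[symmetric] y_def by (simp add: right_diff_distrib sum_distrib_left)
        then have "\<bar>?q t - p t\<bar> = \<bar>s\<bar> ^ j * \<bar>exp y - (\<Sum>l<m. y ^ l / fact l)\<bar>"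
          by (simp add: abs_mult power_abs)
        also have "\<dots> \<le> 1 * (exp (exp 1 * Y - real m) * exp Y)"
          by (intro mult_mono power_le_one s exp_taylor_remainder)
            (use quadratic_abs_le[OF Y s] in \<open>auto simp: y_def\<close>)
        finally show ?case by simp
      qed
    qed
    finally show ?thesis unfolding eq .
  qed
  have poly: "\<bar>(LINT t|\<pi>. p t) - (LINT t|\<rho>. p t)\<bar> \<le> \<delta> * exp Y"
  proof -
    let ?E = "\<Sum>l<m. \<Sum>i\<le>l. c l i * (scaled_moment M (j + i + 2 * (l - i)) \<pi> - scaled_moment M (j + i + 2 * (l - i)) \<rho>)"
    have eq: "(LINT t|\<pi>. p t) - (LINT t|\<rho>. p t)
        = (\<Sum>l<m. \<Sum>i\<le>l. c l i * (scaled_moment M (j + i + 2 * (l - i)) \<pi> - scaled_moment M (j + i + 2 * (l - i)) \<rho>))"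
      by (simp add: int_p(2)[OF \<pi>] int_p(2)[OF \<rho>] sum_subtractf right_diff_distrib)
    have "\<bar>?E\<bar> \<le> (\<Sum>l<m. \<Sum>i\<le>l. \<bar>c l i\<bar> * \<delta>)"
    proof (intro order_trans[OF sum_abs] sum_mono)
      fix l i assume li: "l \<in> {..<m}" "i \<in> {..l}"
      then have "j + i + 2 * (l - i) < 2 * m" using j by auto
      then show "\<bar>c l i * (scaled_moment M (j + i + 2 * (l - i)) \<pi> - scaled_moment M (j + i + 2 * (l - i)) \<rho>)\<bar> \<le> \<bar>c l i\<bar> * \<delta>"
        unfolding abs_mult by (intro mult_left_mono close) auto
    qed
    also have "\<dots> = (\<Sum>l<m. (\<bar>a\<bar> + \<bar>b\<bar>) ^ l / fact l) * \<delta>"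
    proof -
      have "(\<Sum>i\<le>l. \<bar>c l i\<bar> * \<delta>) = (\<bar>a\<bar> + \<bar>b\<bar>) ^ l / fact l * \<delta>" for l
        unfolding binomial_ring[of "\<bar>a\<bar>"] sum_divide_distrib sum_distrib_right
        by (simp add: c_def abs_mult power_abs)
      then show ?thesis by (simp add: sum_distrib_right)
    qed
    also have "\<dots> \<le> (\<Sum>l<m. Y ^ l / fact l) * \<delta>"
      by (intro mult_right_mono sum_mono divide_right_mono power_mono Y) (use \<delta> in auto)
    also have "\<dots> \<le> exp Y * \<delta>"
      by (intro mult_right_mono sum_power_div_fact_le_exp Y0 \<delta>)
    finally show ?thesis unfolding eq by (simp only: mult.commute)
  qed
  show ?thesis
    using rem[OF \<pi>] rem[OF \<rho>] poly by (simp add: distrib_right)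
qed

lemma tilt_eq_tilted_moment:
  assumes \<sigma>: "\<sigma> > 0" and M: "M > 0"
  shows "tilt \<pi> \<sigma> j x = (M / \<sigma>\<^sup>2) ^ j * tilted_moment M j (x * M / \<sigma>\<^sup>2) (- (M\<^sup>2 / (2 * \<sigma>\<^sup>2))) \<pi>"
proof -
  have "tilt \<pi> \<sigma> j x = (LINT t|\<pi>. (M / \<sigma>\<^sup>2) ^ j * ((t / M) ^ j * exp ((x * M / \<sigma>\<^sup>2) * (t / M) + (- (M\<^sup>2 / (2 * \<sigma>\<^sup>2))) * (t / M)\<^sup>2)))"
    unfolding tilt_def
  proof (rule Bochner_Integration.integral_cong[OF refl])
    fix t
    have 1: "(t / \<sigma>\<^sup>2) ^ j = (M / \<sigma>\<^sup>2) ^ j * (t / M) ^ j"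
      unfolding power_mult_distrib[symmetric] using M by simp
    have 2: "x * (t / \<sigma>\<^sup>2) - t\<^sup>2 / (2 * \<sigma>\<^sup>2) = (x * M / \<sigma>\<^sup>2) * (t / M) + (- (M\<^sup>2 / (2 * \<sigma>\<^sup>2))) * (t / M)\<^sup>2"
      using M \<sigma> by (simp add: field_simps)
    show "(t / \<sigma>\<^sup>2) ^ j * exp (x * (t / \<sigma>\<^sup>2) - t\<^sup>2 / (2 * \<sigma>\<^sup>2)) = (M / \<sigma>\<^sup>2) ^ j * ((t / M) ^ j * exp ((x * M / \<sigma>\<^sup>2) * (t / M) + (- (M\<^sup>2 / (2 * \<sigma>\<^sup>2))) * (t / M)\<^sup>2))"
      unfolding 1 2 by (simp only: mult.assoc)
  qed
  also have "\<dots> = (M / \<sigma>\<^sup>2) ^ j * tilted_moment M j (x * M / \<sigma>\<^sup>2) (- (M\<^sup>2 / (2 * \<sigma>\<^sup>2))) \<pi>"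
    unfolding tilted_moment_def by (rule integral_mult_right_zero)
  finally show ?thesis .
qed

text \<open>Log densities and posterior means are a logarithm and a ratio of tilted moments.  Closeness of the
  moments is inherited as soon as the moment of order zero stays away from zero.\<close>
lemma ratio_diff_le:
  fixes f g f' g' :: real
  assumes f: "f \<ge> c" "g \<ge> c" "c > 0" and d: "\<bar>f - g\<bar> \<le> d" "\<bar>f' - g'\<bar> \<le> d" and r: "\<bar>g'\<bar> \<le> g"
  shows "\<bar>ln f - ln g\<bar> \<le> d / c" "\<bar>f' / f - g' / g\<bar> \<le> 2 * (d / c)"
proof -
  have pos: "f > 0" "g > 0" using f by auto
  have d0: "d \<ge> 0" using d by linarith
  have *: "ln u - ln v \<le> d / c" if "u > 0" "v \<ge> c" "\<bar>u - v\<bar> \<le> d" for u v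
  proof -
    have v: "v > 0" using that f by simp
    have "ln u - ln v = ln (u / v)" using that v by (simp add: ln_div)
    also have "\<dots> \<le> u / v - 1" by (rule ln_le_minus_one) (use that v in simp)
    also have "\<dots> = (u - v) / v" using v by (simp add: field_simps)
    also have "\<dots> \<le> d / c" by (rule frac_le) (use that f d0 in auto)
    finally show ?thesis .
  qed
  show "\<bar>ln f - ln g\<bar> \<le> d / c"
    using *[of f g] *[of g f] pos f d by (simp add: abs_le_iff)
  have "f' / f - g' / g = (f' - g') / f - (g' / g) * ((f - g) / f)"
    using pos by (simp add: field_simps)
  moreover have "\<bar>(f' - g') / f\<bar> \<le> d / c"
    unfolding abs_divide by (rule frac_le) (use f d d0 in auto)
  moreover have "\<bar>(g' / g) * ((f - g) / f)\<bar> \<le> 1 * (d / c)"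
    unfolding abs_mult
  proof (rule mult_mono)
    show "\<bar>g' / g\<bar> \<le> 1" using r pos by simp
    show "\<bar>(f - g) / f\<bar> \<le> d / c"
      unfolding abs_divide by (rule frac_le) (use f d d0 in auto)
  qed auto
  ultimately show "\<bar>f' / f - g' / g\<bar> \<le> 2 * (d / c)" by linarith
qed

text \<open>Two priors whose first \<open>d\<close> moments agree after division by \<open>\<delta>\<close> and rounding down are close;
  one prior is picked from each class that occurs.\<close>
lemma finite_moment_net:
  assumes M: "M > 0" and \<delta>: "0 < \<delta>" "\<delta> \<le> 1"
  obtains S where "finite S" "S \<subseteq> prob_on M" "real (card S) \<le> (5 / \<delta>) ^ d"
    "\<And>\<pi>. \<pi> \<in> prob_on M \<Longrightarrow> \<exists>\<rho>\<in>S. \<forall>r<d. \<bar>scaled_moment M r \<pi> - scaled_moment M r \<rho>\<bar> \<le> \<delta>"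
proof -
  define N where "N = \<lceil>1 / \<delta>\<rceil>"
  define code where "code = (\<lambda>\<pi>. \<lambda>r\<in>{..<d}. \<lfloor>scaled_moment M r \<pi> / \<delta>\<rfloor>)"
  define rep where "rep = (\<lambda>c. SOME \<pi>. \<pi> \<in> prob_on M \<and> code \<pi> = c)"
  define S where "S = rep ` (code ` prob_on M)"
  have code_in: "code \<pi> \<in> {..<d} \<rightarrow>\<^sub>E {-N..N}" if "\<pi> \<in> prob_on M" for \<pi>
  proof -
    have "\<lfloor>scaled_moment M r \<pi> / \<delta>\<rfloor> \<in> {-N..N}" for r
    proof -
      have "\<bar>scaled_moment M r \<pi>\<bar> \<le> 1" by (rule scaled_moment_abs_le_1[OF that M])
      then have "- (1 / \<delta>) \<le> scaled_moment M r \<pi> / \<delta>" "scaled_moment M r \<pi> / \<delta> \<le> 1 / \<delta>"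
        using \<delta> by (auto simp: field_simps)
      then show ?thesis unfolding N_def by (auto; linarith)
    qed
    then show ?thesis by (auto simp: code_def)
  qed
  have rep: "rep (code \<pi>) \<in> prob_on M \<and> code (rep (code \<pi>)) = code \<pi>" if "\<pi> \<in> prob_on M" for \<pi>
    unfolding rep_def by (rule someI[where x=\<pi>]) (use that in simp)
  have fin: "finite ({..<d} \<rightarrow>\<^sub>E {-N..N})" by (intro finite_PiE) auto
  have fin2: "finite (code ` prob_on M)"
    by (rule finite_subset[OF _ fin]) (use code_in in auto)
  have N: "real_of_int N \<le> 1 / \<delta> + 1" "N \<ge> 1"
    using \<delta> unfolding N_def by (linarith, simp add: one_le_ceiling)
  show thesis
  proof
    show "finite S" unfolding S_def using fin2 by simp
    show "S \<subseteq> prob_on M" unfolding S_def using rep by auto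
    have "card S \<le> card (code ` prob_on M)" unfolding S_def by (rule card_image_le[OF fin2])
    also have "\<dots> \<le> card ({..<d} \<rightarrow>\<^sub>E {-N..N})"
      by (rule card_mono[OF fin]) (use code_in in auto)
    also have "\<dots> = nat (2 * N + 1) ^ d" by (simp add: card_PiE)
    finally have "real (card S) \<le> real (nat (2 * N + 1) ^ d)" by (simp only: of_nat_le_iff)
    also have "\<dots> = (2 * real_of_int N + 1) ^ d" using N by simp
    also have "\<dots> \<le> (5 / \<delta>) ^ d"
    proof (rule power_mono)
      have "1 \<le> 1 / \<delta>" using \<delta> by simp
      then have "2 * real_of_int N + 1 \<le> 5 * (1 / \<delta>)" using N by linarith
      then show "2 * real_of_int N + 1 \<le> 5 / \<delta>" by simp
    qed (use N in simp)
    finally show "real (card S) \<le> (5 / \<delta>) ^ d" .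
    fix \<pi> assume \<pi>: "\<pi> \<in> prob_on M"
    show "\<exists>\<rho>\<in>S. \<forall>r<d. \<bar>scaled_moment M r \<pi> - scaled_moment M r \<rho>\<bar> \<le> \<delta>"
    proof (intro bexI allI impI)
      show "rep (code \<pi>) \<in> S" using \<pi> by (simp add: S_def)
      fix r assume r: "r < d"
      have "code (rep (code \<pi>)) r = code \<pi> r" using rep[OF \<pi>] by simp
      then have "\<lfloor>scaled_moment M r (rep (code \<pi>)) / \<delta>\<rfloor> = \<lfloor>scaled_moment M r \<pi> / \<delta>\<rfloor>"
        using r by (simp add: code_def)
      then have "\<bar>scaled_moment M r \<pi> / \<delta> - scaled_moment M r (rep (code \<pi>)) / \<delta>\<bar> \<le> 1" by linarith
      then have "\<bar>(scaled_moment M r \<pi> - scaled_moment M r (rep (code \<pi>))) / \<delta>\<bar> \<le> 1"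
        by (simp only: diff_divide_distrib)
      then show "\<bar>scaled_moment M r \<pi> - scaled_moment M r (rep (code \<pi>))\<bar> \<le> \<delta>"
        using \<delta> by (simp add: abs_divide)
    qed
  qed
qed

text \<open>On the range of \<open>x\<close> in question the exponent is bounded by \<open>Y\<close> of order \<open>ln n\<close>.  Degree
  \<open>m\<close> of order \<open>ln n\<close> and rounding accuracy \<open>\<delta>\<close> polynomial in \<open>1 / n\<close> therefore suffice, and
  \<open>(5 / \<delta>) ^ (2 * m)\<close> is the exponential of a multiple of \<open>(ln n)\<^sup>2\<close>.\<close>
proposition prior_net:
  assumes M: "M > 0" and k: "0 < k"
  obtains C where "C > 0"
    "\<And>n. n \<ge> (2::nat) \<Longrightarrow> \<exists>S. finite S \<and> S \<subseteq> prob_on M \<and> real (card S) \<le> exp (C * (ln n)\<^sup>2) \<and>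
      (\<forall>\<pi>\<in>prob_on M. \<exists>\<rho>\<in>S. \<forall>\<sigma> x. k < \<sigma> \<longrightarrow> \<bar>x\<bar> \<le> sqrt (2 * ln n) \<longrightarrow>
        \<bar>ln (normal_mix \<pi> \<sigma> x) - ln (normal_mix \<rho> \<sigma> x)\<bar> \<le> 1 / n \<and>
        \<bar>post_mean \<pi> \<sigma> x - post_mean \<rho> \<sigma> x\<bar> \<le> 1 / n)"
proof
  define y where "y = 2 * (M + M\<^sup>2) / k\<^sup>2"
  define c where "c = 3 * (2 * M + 1)"
  define a where "a = (exp 1 + 2) * y + 1 + 2 * ln c + 4"
  define C where "C = 2 * a * (2 * ln 5 + 2 * y + 2 * ln c + 1)"
  have y0: "y > 0" using M k by (simp add: y_def add_pos_pos)
  have c1: "c \<ge> 1" using M by (simp add: c_def)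
  have lnc: "ln c \<ge> 0" using c1 by simp
  have a0: "a > 0" using y0 lnc by (simp add: a_def add_nonneg_pos add_pos_nonneg)
  show "C > 0" unfolding C_def using a0 y0 lnc by (intro mult_pos_pos add_nonneg_pos add_nonneg_nonneg) auto
  fix n :: nat assume n: "n \<ge> 2"
  define l where "l = ln (real n)"
  have l: "l \<ge> 1 / 2" using ln_nat_ge_half[OF n] by (simp add: l_def)
  define Y where "Y = y * l"
  have Y0: "Y \<ge> 0" using y0 l by (simp add: Y_def)
  define \<delta> where "\<delta> = exp (- 2 * Y) / (c * real n)"
  have \<delta>0: "\<delta> > 0" using c1 n by (simp add: \<delta>_def)
  have \<delta>1: "\<delta> \<le> 1"
  proof -
    have "exp (- 2 * Y) \<le> 1" using Y0 by simp
    moreover have "1 * 1 \<le> c * real n" by (rule mult_mono) (use c1 n in auto)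
    ultimately have "exp (- 2 * Y) \<le> c * real n" by linarith
    then show ?thesis unfolding \<delta>_def using c1 n by (simp add: divide_le_eq)
  qed
  \<comment> \<open>The term \<open>2 * Y\<close> compensates for the lower bound \<open>exp (- Y)\<close> on the denominator and for the size
  \<open>exp Y\<close> of the integrand.\<close>
  define m where "m = nat \<lceil>(exp 1 + 2) * Y + l + ln c\<rceil>"
  have nn: "0 \<le> (exp 1 + 2) * Y + l + ln c" using Y0 l lnc by simp
  have m1: "real m \<ge> (exp 1 + 2) * Y + l + ln c"
    unfolding m_def by (rule real_nat_ceiling_ge)
  have m2: "real m \<le> a * l"
  proof -
    have "real m \<le> (exp 1 + 2) * Y + l + ln c + 1"
      unfolding m_def using nn by (simp add: of_nat_nat)
    moreover have "ln c * 1 \<le> ln c * (2 * l)" by (rule mult_left_mono) (use l lnc in auto)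
    ultimately show ?thesis using l by (simp add: a_def Y_def algebra_simps)
  qed
  obtain S where S: "finite S" "S \<subseteq> prob_on M" "real (card S) \<le> (5 / \<delta>) ^ (2 * m)"
    "\<And>\<pi>. \<pi> \<in> prob_on M \<Longrightarrow> \<exists>\<rho>\<in>S. \<forall>r<2*m. \<bar>scaled_moment M r \<pi> - scaled_moment M r \<rho>\<bar> \<le> \<delta>"
    using finite_moment_net[OF M \<delta>0 \<delta>1, of "2 * m"] by metis
  show "\<exists>S. finite S \<and> S \<subseteq> prob_on M \<and> real (card S) \<le> exp (C * (ln n)\<^sup>2) \<and>
      (\<forall>\<pi>\<in>prob_on M. \<exists>\<rho>\<in>S. \<forall>\<sigma> x. k < \<sigma> \<longrightarrow> \<bar>x\<bar> \<le> sqrt (2 * ln n) \<longrightarrow>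
        \<bar>ln (normal_mix \<pi> \<sigma> x) - ln (normal_mix \<rho> \<sigma> x)\<bar> \<le> 1 / n \<and>
        \<bar>post_mean \<pi> \<sigma> x - post_mean \<rho> \<sigma> x\<bar> \<le> 1 / n)"
  proof (intro exI[of _ S] conjI ballI S(1,2))
    have ln\<delta>: "ln (5 / \<delta>) = ln 5 + 2 * Y + ln c + l"
      using \<delta>0 c1 n by (simp add: \<delta>_def ln_div ln_mult l_def)
    have ln\<delta>2: "ln (5 / \<delta>) \<le> (2 * ln 5 + 2 * y + 2 * ln c + 1) * l"
    proof -
      have "(ln 5 + ln c) * 1 \<le> (ln 5 + ln c) * (2 * l)" by (rule mult_left_mono) (use l lnc in auto)
      then show ?thesis unfolding ln\<delta> Y_def by (simp add: algebra_simps)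
    qed
    have "5 / \<delta> \<ge> 1" using \<delta>0 \<delta>1 by simp
    then have "exp (ln (5 / \<delta>)) = 5 / \<delta>" using \<delta>0 by simp
    then have "(5 / \<delta>) ^ (2 * m) = exp (real (2 * m) * ln (5 / \<delta>))"
      unfolding exp_of_nat_mult by (simp only:)
    also have "\<dots> \<le> exp (C * l\<^sup>2)"
    proof (rule iffD2[OF exp_le_cancel_iff])
      have "real (2 * m) * ln (5 / \<delta>) \<le> (2 * (a * l)) * ((2 * ln 5 + 2 * y + 2 * ln c + 1) * l)"
        by (rule mult_mono) (use m2 ln\<delta>2 a0 l \<open>5 / \<delta> \<ge> 1\<close> in auto)
      also have "\<dots> = C * l\<^sup>2" by (simp add: C_def power2_eq_square)
      finally show "real (2 * m) * ln (5 / \<delta>) \<le> C * l\<^sup>2" .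
    qed
    finally show "real (card S) \<le> exp (C * (ln n)\<^sup>2)" using S(3) by (simp add: l_def)
  next
    fix \<pi> assume \<pi>: "\<pi> \<in> prob_on M"
    obtain \<rho> where \<rho>S: "\<rho> \<in> S" and close: "\<And>r. r < 2 * m \<Longrightarrow> \<bar>scaled_moment M r \<pi> - scaled_moment M r \<rho>\<bar> \<le> \<delta>"
      using S(4)[OF \<pi>] by auto
    have \<rho>: "\<rho> \<in> prob_on M" using \<rho>S S(2) by auto
    show "\<exists>\<rho>\<in>S. \<forall>\<sigma> x. k < \<sigma> \<longrightarrow> \<bar>x\<bar> \<le> sqrt (2 * ln n) \<longrightarrow>
        \<bar>ln (normal_mix \<pi> \<sigma> x) - ln (normal_mix \<rho> \<sigma> x)\<bar> \<le> 1 / n \<and>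
        \<bar>post_mean \<pi> \<sigma> x - post_mean \<rho> \<sigma> x\<bar> \<le> 1 / n"
    proof (intro bexI[OF _ \<rho>S] allI impI conjI)
      fix \<sigma> x :: real assume \<sigma>: "k < \<sigma>" and x: "\<bar>x\<bar> \<le> sqrt (2 * ln n)"
      have s0: "\<sigma> > 0" using \<sigma> k by simp
      have "\<bar>k\<bar> \<le> \<bar>\<sigma>\<bar>" using \<sigma> k by simp
      then have k2: "k\<^sup>2 \<le> \<sigma>\<^sup>2" by (simp only: abs_le_square_iff)
      define A B where AB: "A = x * M / \<sigma>\<^sup>2" "B = - (M\<^sup>2 / (2 * \<sigma>\<^sup>2))"
      have sl: "sqrt (2 * l) \<le> 2 * l"
      proof -
        have "2 * l \<le> (2 * l)\<^sup>2" using l by (simp add: power2_eq_square)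
        then show ?thesis using l by (intro real_le_lsqrt) auto
      qed
      have Yb: "\<bar>A\<bar> + \<bar>B\<bar> \<le> Y"
      proof -
        have "\<bar>A\<bar> = \<bar>x\<bar> * M / \<sigma>\<^sup>2" using M by (simp add: AB abs_mult)
        also have "\<dots> \<le> (2 * l) * M / k\<^sup>2"
          using x sl k2 k s0 M l by (intro frac_le mult_right_mono) (auto simp: l_def)
        finally have 1: "\<bar>A\<bar> \<le> (2 * l) * M / k\<^sup>2" .
        have "\<bar>B\<bar> = M\<^sup>2 / (2 * \<sigma>\<^sup>2)" by (simp add: AB)
        also have "\<dots> \<le> M\<^sup>2 / k\<^sup>2"
        proof (rule divide_left_mono)
          show "k\<^sup>2 \<le> 2 * \<sigma>\<^sup>2" using k2 zero_le_power2[of \<sigma>] by linarith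
        qed (use k s0 in auto)
        also have "\<dots> = 1 * (M\<^sup>2 / k\<^sup>2)" by simp
        also have "\<dots> \<le> (2 * l) * (M\<^sup>2 / k\<^sup>2)" by (rule mult_right_mono) (use l in auto)
        finally have "\<bar>B\<bar> \<le> (2 * l) * (M\<^sup>2 / k\<^sup>2)" .
        then show ?thesis using 1 by (simp add: Y_def y_def add_divide_distrib algebra_simps)
      qed
      define d where "d = (\<delta> + 2 * exp (exp 1 * Y - real m)) * exp Y"
      have cl: "\<bar>tilted_moment M j A B \<pi> - tilted_moment M j A B \<rho>\<bar> \<le> d" if "j \<le> 1" for j
        unfolding d_def by (rule tilted_moment_close[OF \<pi> \<rho> M Yb that close less_imp_le[OF \<delta>0]])
      have t: "tilt \<mu> \<sigma> 0 x = tilted_moment M 0 A B \<mu>" "tilt \<mu> \<sigma> 1 x = M / \<sigma>\<^sup>2 * tilted_moment M 1 A B \<mu>" for \<mu>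
        using tilt_eq_tilted_moment[OF s0 M, of \<mu> 0 x] tilt_eq_tilted_moment[OF s0 M, of \<mu> 1 x] by (simp_all add: AB)
      have low: "tilted_moment M 0 A B \<mu> \<ge> exp (- Y)" if \<mu>: "\<mu> \<in> prob_on M" for \<mu>
      proof -
        have "exp (- Y) \<le> exp (- (\<bar>A\<bar> + \<bar>B\<bar>))" using Yb by simp
        also have "\<bar>A\<bar> + \<bar>B\<bar> = \<bar>x\<bar> * (M / \<sigma>\<^sup>2) + M\<^sup>2 / (2 * \<sigma>\<^sup>2)" using M by (simp add: AB abs_mult)
        finally show ?thesis using tilt_0_lower[OF \<mu> s0, of x] unfolding t by (rule order_trans)
      qed
      have r: "\<bar>tilted_moment M 1 A B \<rho>\<bar> \<le> tilted_moment M 0 A B \<rho>"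
      proof -
        have "M / \<sigma>\<^sup>2 * \<bar>tilted_moment M 1 A B \<rho>\<bar> \<le> M / \<sigma>\<^sup>2 * tilted_moment M 0 A B \<rho>"
          using tilt_abs_bound[OF \<rho> s0, of 1 x] M unfolding t abs_mult by simp
        then show ?thesis using M s0 by (simp add: divide_le_cancel)
      qed
      have dd: "(2 * M + 1) * (d / exp (- Y)) \<le> 1 / n"
      proof -
        have "d / exp (- Y) = (\<delta> + 2 * exp (exp 1 * Y - real m)) * exp (2 * Y)"
          by (simp add: d_def exp_minus divide_inverse exp_add[symmetric] mult.assoc)
        also have "\<dots> = \<delta> * exp (2 * Y) + 2 * exp (exp 1 * Y - real m + 2 * Y)"
          by (simp add: distrib_right exp_add)
        also have "\<delta> * exp (2 * Y) = 1 / (c * real n)"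
          by (simp add: \<delta>_def exp_minus)
        also have "exp (exp 1 * Y - real m + 2 * Y) \<le> 1 / (c * real n)"
        proof -
          have "exp (exp 1 * Y - real m + 2 * Y) \<le> exp (- (l + ln c))"
            using m1 by (simp add: algebra_simps)
          also have "\<dots> = 1 / (c * real n)"
          proof -
            have "exp (l + ln c) = c * real n" using c1 n by (simp add: exp_add l_def)
            then show ?thesis by (simp only: exp_minus inverse_eq_divide)
          qed
          finally show ?thesis .
        qed
        finally have "d / exp (- Y) \<le> 3 / (c * real n)" by simp
        then have "(2 * M + 1) * (d / exp (- Y)) \<le> (2 * M + 1) * (3 / (c * real n))"
          by (rule mult_left_mono) (use M in simp)
        also have "\<dots> = (3 * (2 * M + 1) / c) * (1 / n)" by simp
        also have "3 * (2 * M + 1) / c = 1" using c1 unfolding c_def[symmetric] by simp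
        finally show ?thesis by simp
      qed
      have d0: "d / exp (- Y) \<ge> 0" using \<delta>0 by (simp add: d_def)
      have 1: "\<bar>ln (tilted_moment M 0 A B \<pi>) - ln (tilted_moment M 0 A B \<rho>)\<bar> \<le> d / exp (- Y)"
        and 2: "\<bar>tilted_moment M 1 A B \<pi> / tilted_moment M 0 A B \<pi> - tilted_moment M 1 A B \<rho> / tilted_moment M 0 A B \<rho>\<bar> \<le> 2 * (d / exp (- Y))"
        using ratio_diff_le[OF low[OF \<pi>] low[OF \<rho>] exp_gt_zero cl[of 0] cl[of 1] r] by auto
      have "ln (normal_mix \<pi> \<sigma> x) - ln (normal_mix \<rho> \<sigma> x) = ln (tilted_moment M 0 A B \<pi>) - ln (tilted_moment M 0 A B \<rho>)"
        using tilt_0_pos[OF \<pi> s0, of x] tilt_0_pos[OF \<rho> s0, of x] normal_density_pos[OF s0, of 0 x]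
        by (simp add: normal_mix_tilt[OF \<pi> s0] normal_mix_tilt[OF \<rho> s0] ln_mult t)
      moreover have "d / exp (- Y) \<le> (2 * M + 1) * (d / exp (- Y))"
        using mult_right_mono[of 1 "2 * M + 1", OF _ d0] M by simp
      ultimately show "\<bar>ln (normal_mix \<pi> \<sigma> x) - ln (normal_mix \<rho> \<sigma> x)\<bar> \<le> 1 / n"
        using 1 dd by linarith
      have "post_mean \<pi> \<sigma> x - post_mean \<rho> \<sigma> x
          = M * (tilted_moment M 1 A B \<pi> / tilted_moment M 0 A B \<pi> - tilted_moment M 1 A B \<rho> / tilted_moment M 0 A B \<rho>)"
        unfolding post_mean_tilt[OF \<pi> s0] post_mean_tilt[OF \<rho> s0] t using s0 by (simp add: right_diff_distrib)
      also have "\<bar>\<dots>\<bar> \<le> M * (2 * (d / exp (- Y)))"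
        unfolding abs_mult using 2 M by (intro mult_mono) auto
      also have "\<dots> \<le> (2 * M + 1) * (d / exp (- Y))"
        using d0 by (simp add: algebra_simps)
      also have "\<dots> \<le> 1 / n" by (rule dd)
      finally show "\<bar>post_mean \<pi> \<sigma> x - post_mean \<rho> \<sigma> x\<bar> \<le> 1 / n" .
    qed
  qed
qed

section \<open>Replacing observations by Gaussian ones\<close>

text \<open>A version of the conditional law is specified on rectangles only; these generate the product
  sigma-algebra, so the joint law is the composition of the law of \<open>Y\<close> with the kernel.\<close>
lemma cond_law_nn_integral:
  assumes P: "prob_space P" and X[measurable]: "X \<in> borel_measurable P" and Y[measurable]: "Y \<in> borel_measurable P"
    and \<kappa>: "is_cond_law P X Y \<kappa>" and G[measurable]: "G \<in> borel_measurable (borel \<Otimes>\<^sub>M borel)"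
  shows "(\<integral>\<^sup>+\<omega>. G (Y \<omega>, X \<omega>) \<partial>P) = (\<integral>\<^sup>+t. (\<integral>\<^sup>+x. G (t, x) \<partial>\<kappa> t) \<partial>distr P borel Y)"
proof -
  interpret prob_space P by (rule P)
  let ?B = "borel \<Otimes>\<^sub>M borel :: (real \<times> real) measure"
  have \<kappa>m: "\<kappa> \<in> borel \<rightarrow>\<^sub>M prob_algebra borel" using \<kappa> by (simp add: is_cond_law_def)
  have [measurable]: "\<kappa> \<in> borel \<rightarrow>\<^sub>M subprob_algebra borel"
    by (rule measurable_prob_algebraD[OF \<kappa>m])
  have \<kappa>p: "prob_space (\<kappa> t)" "sets (\<kappa> t) = sets borel" for t
    using measurable_space[OF \<kappa>m, of t] by (auto simp: space_prob_algebra)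
  define N where "N = distr P borel Y"
  have N: "prob_space N" "sets N = sets borel" "space N = UNIV" unfolding N_def by (auto intro: prob_space_distr)
  interpret N: prob_space N by (rule N)
  note [measurable_cong] = N(2)
  define K where "K = (\<lambda>t. distr (\<kappa> t) ?B (\<lambda>x. (t, x)))"
  have K[measurable]: "K \<in> N \<rightarrow>\<^sub>M subprob_algebra ?B"
    unfolding K_def by (rule measurable_distr2[where M=borel]) measurable
  have Pm: "(\<lambda>x. (t, x)) \<in> \<kappa> t \<rightarrow>\<^sub>M ?B" for t
    unfolding measurable_cong_sets[OF \<kappa>p(2) refl] by measurable
  let ?E = "{a \<times> b |a b. a \<in> sets (borel :: real measure) \<and> b \<in> sets (borel :: real measure)}"
  have eq: "distr P ?B (\<lambda>\<omega>. (Y \<omega>, X \<omega>)) = N \<bind> K"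
  proof (rule measure_eqI_generator_eq[where E="?E" and \<Omega>=UNIV and A="\<lambda>_. UNIV"])
    show "Int_stable ?E" by (rule Int_stable_pair_measure_generator)
    show "?E \<subseteq> Pow UNIV" by simp
    show "range (\<lambda>_. UNIV :: (real \<times> real) set) \<subseteq> ?E"
    proof -
      have "(UNIV :: (real \<times> real) set) = UNIV \<times> UNIV" by simp
      then have "(UNIV :: (real \<times> real) set) \<in> ?E" by (intro CollectI exI[of _ UNIV]) auto
      then show ?thesis by blast
    qed
    show "(\<Union>i::nat. UNIV) = (UNIV :: (real \<times> real) set)" by simp
    interpret D: prob_space "distr P ?B (\<lambda>\<omega>. (Y \<omega>, X \<omega>))" by (rule prob_space_distr) measurable
    show "emeasure (distr P ?B (\<lambda>\<omega>. (Y \<omega>, X \<omega>))) UNIV \<noteq> \<infinity>" for i :: nat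
      using D.emeasure_finite[of UNIV] by simp
    show "sets (distr P ?B (\<lambda>\<omega>. (Y \<omega>, X \<omega>))) = sigma_sets UNIV ?E"
      by (simp add: sets_pair_measure)
    show "sets (N \<bind> K) = sigma_sets UNIV ?E"
      by (subst sets_bind[where N="?B"]) (auto simp: sets_pair_measure K_def N)
    fix Z :: "(real \<times> real) set" assume "Z \<in> ?E"
    then obtain A B where Z: "Z = A \<times> B" and [measurable]: "A \<in> sets borel" "B \<in> sets borel" by auto
    have "emeasure (distr P ?B (\<lambda>\<omega>. (Y \<omega>, X \<omega>))) Z = emeasure P {\<omega> \<in> space P. Y \<omega> \<in> A \<and> X \<omega> \<in> B}"
      unfolding Z by (subst emeasure_distr) (auto intro!: arg_cong[where f="emeasure P"])
    also have "\<dots> = (\<integral>\<^sup>+t\<in>A. emeasure (\<kappa> t) B \<partial>N)"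
      using \<kappa> by (simp add: is_cond_law_def N_def)
    also have "\<dots> = (\<integral>\<^sup>+t. emeasure (K t) Z \<partial>N)"
    proof (rule nn_integral_cong)
      fix t
      have "emeasure (K t) Z = emeasure (\<kappa> t) ((\<lambda>x. (t, x)) -` (A \<times> B) \<inter> space (\<kappa> t))"
        unfolding K_def Z by (rule emeasure_distr[OF Pm]) simp
      also have "(\<lambda>x. (t, x)) -` (A \<times> B) \<inter> space (\<kappa> t) = (if t \<in> A then B else {})"
        using sets_eq_imp_space_eq[OF \<kappa>p(2)[of t]] by auto
      finally show "emeasure (\<kappa> t) B * indicator A t = emeasure (K t) Z"
        by simp
    qed
    also have "\<dots> = emeasure (N \<bind> K) Z"
      by (rule emeasure_bind[symmetric, OF _ K]) (simp_all add: N Z)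
    finally show "emeasure (distr P ?B (\<lambda>\<omega>. (Y \<omega>, X \<omega>))) Z = emeasure (N \<bind> K) Z" .
  qed
  have "(\<integral>\<^sup>+\<omega>. G (Y \<omega>, X \<omega>) \<partial>P) = (\<integral>\<^sup>+z. G z \<partial>distr P ?B (\<lambda>\<omega>. (Y \<omega>, X \<omega>)))"
    by (subst nn_integral_distr) auto
  also have "\<dots> = (\<integral>\<^sup>+t. (\<integral>\<^sup>+z. G z \<partial>K t) \<partial>N)"
    unfolding eq by (rule nn_integral_bind[OF G K])
  also have "\<dots> = (\<integral>\<^sup>+t. (\<integral>\<^sup>+x. G (t, x) \<partial>\<kappa> t) \<partial>N)"
    unfolding K_def by (subst nn_integral_distr[OF Pm]) auto
  finally show ?thesis unfolding N_def .
qed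

lemma square_add_le_young:
  fixes a b s :: real
  assumes s: "s > 0"
  shows "(a + b)\<^sup>2 \<le> (1 + s) * a\<^sup>2 + (1 + 1 / s) * b\<^sup>2"
proof -
  have "0 \<le> (sqrt s * a - b / sqrt s)\<^sup>2" by simp
  also have "\<dots> = s * a\<^sup>2 - 2 * a * b + b\<^sup>2 / s"
    using s by (simp add: power2_diff power_mult_distrib power_divide)
  finally show ?thesis by (simp add: power2_sum algebra_simps)
qed

text \<open>Solved for the transport cost, so that the infimum over couplings is taken of the right-hand side
  alone.  The second integral must be finite because subtraction on the extended reals does
  not cancel infinity.\<close>
lemma wasserstein_lipschitz_square:
  assumes \<mu>: "sets \<mu> = sets borel" and \<nu>: "sets \<nu> = sets borel"
    and g[measurable]: "g \<in> borel_measurable borel" and lip: "\<And>x y. \<bar>g x - g y\<bar> \<le> L * \<bar>x - y\<bar>"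
    and L: "L > 0" and s: "s > 0" and fin: "(\<integral>\<^sup>+z. ennreal ((g z)\<^sup>2) \<partial>\<nu>) \<noteq> \<top>"
  shows "((\<integral>\<^sup>+x. ennreal ((g x)\<^sup>2) \<partial>\<mu>) - ennreal (1 + s) * (\<integral>\<^sup>+z. ennreal ((g z)\<^sup>2) \<partial>\<nu>)) / ennreal ((1 + 1 / s) * L\<^sup>2)
    \<le> wasserstein2_sq \<mu> \<nu>"
  unfolding wasserstein2_sq_def
proof (rule INF_greatest)
  fix \<gamma> assume "\<gamma> \<in> couplings \<mu> \<nu>"
  then have \<gamma>: "sets \<gamma> = sets (borel \<Otimes>\<^sub>M borel)" and fst: "distr \<gamma> borel fst = \<mu>" and snd: "distr \<gamma> borel snd = \<nu>"
    by (auto simp: couplings_def space_prob_algebra)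
  note [measurable_cong] = \<gamma>
  have c: "(1 + 1 / s) * L\<^sup>2 > 0" using s L by (intro mult_pos_pos) (auto simp: add_pos_pos)
  have "(\<integral>\<^sup>+x. ennreal ((g x)\<^sup>2) \<partial>\<mu>) = (\<integral>\<^sup>+z. ennreal ((g (fst z))\<^sup>2) \<partial>\<gamma>)"
    unfolding fst[symmetric] by (subst nn_integral_distr) auto
  also have "\<dots> \<le> (\<integral>\<^sup>+z. ennreal (1 + s) * ennreal ((g (snd z))\<^sup>2) + ennreal ((1 + 1 / s) * L\<^sup>2) * ennreal (\<bar>fst z - snd z\<bar>\<^sup>2) \<partial>\<gamma>)"
  proof (rule nn_integral_mono)
    fix z :: "real \<times> real"
    have "(g (fst z))\<^sup>2 = (g (snd z) + (g (fst z) - g (snd z)))\<^sup>2" by simp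
    also have "\<dots> \<le> (1 + s) * (g (snd z))\<^sup>2 + (1 + 1 / s) * (g (fst z) - g (snd z))\<^sup>2"
      by (rule square_add_le_young[OF s])
    also have "(g (fst z) - g (snd z))\<^sup>2 \<le> (L * \<bar>fst z - snd z\<bar>)\<^sup>2"
      using power_mono[OF lip[of "fst z" "snd z"] abs_ge_zero, of 2] by simp
    also have "(L * \<bar>fst z - snd z\<bar>)\<^sup>2 = L\<^sup>2 * \<bar>fst z - snd z\<bar>\<^sup>2" by (rule power_mult_distrib)
    finally have "(g (fst z))\<^sup>2 \<le> (1 + s) * (g (snd z))\<^sup>2 + (1 + 1 / s) * L\<^sup>2 * \<bar>fst z - snd z\<bar>\<^sup>2"
      using s by (simp add: mult.assoc mult_left_mono)
    then show "ennreal ((g (fst z))\<^sup>2) \<le> ennreal (1 + s) * ennreal ((g (snd z))\<^sup>2) + ennreal ((1 + 1 / s) * L\<^sup>2) * ennreal (\<bar>fst z - snd z\<bar>\<^sup>2)"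
      using s c by (simp only: ennreal_mult''[symmetric] ennreal_plus[symmetric] zero_le_power2 mult_nonneg_nonneg less_imp_le add_nonneg_nonneg zero_le_one ennreal_leI)
  qed
  also have "\<dots> = ennreal (1 + s) * (\<integral>\<^sup>+z. ennreal ((g (snd z))\<^sup>2) \<partial>\<gamma>) + ennreal ((1 + 1 / s) * L\<^sup>2) * (\<integral>\<^sup>+z. ennreal (\<bar>fst z - snd z\<bar>\<^sup>2) \<partial>\<gamma>)"
    by (subst nn_integral_add) (auto simp: nn_integral_cmult)
  also have "(\<integral>\<^sup>+z. ennreal ((g (snd z))\<^sup>2) \<partial>\<gamma>) = (\<integral>\<^sup>+z. ennreal ((g z)\<^sup>2) \<partial>\<nu>)"
    unfolding snd[symmetric] by (subst nn_integral_distr) auto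
  finally have *: "(\<integral>\<^sup>+x. ennreal ((g x)\<^sup>2) \<partial>\<mu>) \<le> ennreal (1 + s) * (\<integral>\<^sup>+z. ennreal ((g z)\<^sup>2) \<partial>\<nu>)
      + ennreal ((1 + 1 / s) * L\<^sup>2) * (\<integral>\<^sup>+z. ennreal (\<bar>fst z - snd z\<bar>\<^sup>2) \<partial>\<gamma>)" .
  show "((\<integral>\<^sup>+x. ennreal ((g x)\<^sup>2) \<partial>\<mu>) - ennreal (1 + s) * (\<integral>\<^sup>+z. ennreal ((g z)\<^sup>2) \<partial>\<nu>)) / ennreal ((1 + 1 / s) * L\<^sup>2)
      \<le> (\<integral>\<^sup>+z. ennreal (\<bar>fst z - snd z\<bar>\<^sup>2) \<partial>\<gamma>)"
    using c by (intro divide_le_posI_ennreal ennreal_minus_le_iff[THEN iffD2])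
      (use * fin in \<open>auto simp: ennreal_mult_eq_top_iff mult.commute add.commute\<close>)
qed

text \<open>The normal laws are translates of one law, so measurability reduces to that of the translation.\<close>
lemma normal_density_kernel:
  assumes \<sigma>: "\<sigma> > 0"
  shows "(\<lambda>t. density lborel (normal_density t \<sigma>)) \<in> borel \<rightarrow>\<^sub>M prob_algebra borel"
proof (rule measurable_prob_algebraI)
  show "prob_space (density lborel (normal_density t \<sigma>))" for t
    by (rule prob_space_normal_density[OF \<sigma>])
  have eq: "density lborel (normal_density t \<sigma>) = distr (density lborel (normal_density 0 \<sigma>)) borel (\<lambda>e. t + e)" for t
  proof (rule measure_eqI)
    fix A assume "A \<in> sets (density lborel (normal_density t \<sigma>))"
    then have [measurable]: "A \<in> sets borel" by simp
    have "emeasure (density lborel (normal_density t \<sigma>)) A = (\<integral>\<^sup>+x. ennreal (normal_density t \<sigma> x) * indicator A x \<partial>lborel)"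
      by (rule emeasure_density) auto
    also have "\<dots> = (\<integral>\<^sup>+x. ennreal (normal_density t \<sigma> (t + 1 * x)) * indicator A (t + 1 * x) \<partial>lborel)"
      by (subst nn_integral_real_affine[where c=1 and t=t]) auto
    also have "\<dots> = (\<integral>\<^sup>+x. ennreal (normal_density 0 \<sigma> x) * indicator ((\<lambda>e. t + e) -` A) x \<partial>lborel)"
      by (intro nn_integral_cong) (auto simp: normal_density_def split: split_indicator)
    also have "\<dots> = emeasure (density lborel (normal_density 0 \<sigma>)) ((\<lambda>e. t + e) -` A)"
      by (rule emeasure_density[symmetric]) (use measurable_sets[of "\<lambda>e. t + e" borel borel A] in auto)
    also have "\<dots> = emeasure (distr (density lborel (normal_density 0 \<sigma>)) borel (\<lambda>e. t + e)) A"
      by (subst emeasure_distr) auto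
    finally show "emeasure (density lborel (normal_density t \<sigma>)) A = emeasure (distr (density lborel (normal_density 0 \<sigma>)) borel (\<lambda>e. t + e)) A" .
  qed simp
  have eq': "(\<lambda>t. density lborel (normal_density t \<sigma>)) = (\<lambda>t. distr (density lborel (normal_density 0 \<sigma>)) borel (\<lambda>e. t + e))"
    by (rule ext) (rule eq)
  interpret prob_space "density lborel (normal_density 0 \<sigma>)" by (rule prob_space_normal_density[OF \<sigma>])
  show "(\<lambda>t. density lborel (normal_density t \<sigma>)) \<in> borel \<rightarrow>\<^sub>M subprob_algebra borel"
    unfolding eq'
  proof (rule measurable_distr2[where M=borel])
    have "density lborel (normal_density 0 \<sigma>) \<in> space (subprob_algebra borel)"
      by (simp add: space_subprob_algebra prob_space_imp_subprob_space[OF prob_space_axioms])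
    then show "(\<lambda>t. density lborel (normal_density 0 \<sigma>)) \<in> borel \<rightarrow>\<^sub>M subprob_algebra borel"
      by (rule measurable_const)
  qed measurable
qed

lemma normal_noise_nn_integral:
  assumes P: "prob_space P" and \<sigma>: "\<sigma> > 0" and ind: "prob_space.indep_var P borel \<epsilon> borel Y"
    and \<epsilon>: "distributed P lborel \<epsilon> (normal_density 0 \<sigma>)" and G[measurable]: "G \<in> borel_measurable (borel \<Otimes>\<^sub>M borel)"
  shows "(\<integral>\<^sup>+\<omega>. G (Y \<omega>, Y \<omega> + \<epsilon> \<omega>) \<partial>P)
    = (\<integral>\<^sup>+t. (\<integral>\<^sup>+z. G (t, z) \<partial>density lborel (normal_density t \<sigma>)) \<partial>distr P borel Y)"
proof -
  interpret prob_space P by (rule P)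
  have [measurable]: "\<epsilon> \<in> borel_measurable P" "Y \<in> borel_measurable P"
    using indep_var_rv1[OF ind] indep_var_rv2[OF ind] by auto
  have \<epsilon>d: "distr P borel \<epsilon> = density lborel (normal_density 0 \<sigma>)"
    using distributed_distr_eq_density[OF \<epsilon>] distr_cong[OF refl sets_lborel, of P \<epsilon> \<epsilon>] by simp
  interpret E: prob_space "distr P borel \<epsilon>" by (rule prob_space_distr) measurable
  interpret Y: prob_space "distr P borel Y" by (rule prob_space_distr) measurable
  interpret pair_sigma_finite "distr P borel \<epsilon>" "distr P borel Y" ..
  have "(\<integral>\<^sup>+\<omega>. G (Y \<omega>, Y \<omega> + \<epsilon> \<omega>) \<partial>P) = (\<integral>\<^sup>+p. G (snd p, snd p + fst p) \<partial>distr P (borel \<Otimes>\<^sub>M borel) (\<lambda>\<omega>. (\<epsilon> \<omega>, Y \<omega>)))"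
    by (subst nn_integral_distr) auto
  also have "\<dots> = (\<integral>\<^sup>+p. G (snd p, snd p + fst p) \<partial>(distr P borel \<epsilon> \<Otimes>\<^sub>M distr P borel Y))"
    using ind by (simp add: indep_var_distribution_eq)
  also have "\<dots> = (\<integral>\<^sup>+t. (\<integral>\<^sup>+e. G (t, t + e) \<partial>distr P borel \<epsilon>) \<partial>distr P borel Y)"
    by (subst nn_integral_snd[symmetric]) auto
  also have "\<dots> = (\<integral>\<^sup>+t. (\<integral>\<^sup>+z. G (t, z) \<partial>density lborel (normal_density t \<sigma>)) \<partial>distr P borel Y)"
  proof (rule nn_integral_cong)
    fix t
    have "(\<integral>\<^sup>+e. G (t, t + e) \<partial>distr P borel \<epsilon>) = (\<integral>\<^sup>+e. ennreal (normal_density 0 \<sigma> e) * G (t, t + e) \<partial>lborel)"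
      unfolding \<epsilon>d by (rule nn_integral_density) auto
    also have "\<dots> = (\<integral>\<^sup>+e. ennreal (normal_density t \<sigma> (t + 1 * e)) * G (t, t + 1 * e) \<partial>lborel)"
      by (intro nn_integral_cong) (simp add: normal_density_def)
    also have "\<dots> = (\<integral>\<^sup>+z. ennreal (normal_density t \<sigma> z) * G (t, z) \<partial>lborel)"
      by (subst nn_integral_real_affine[where c=1 and t=t]) auto
    also have "\<dots> = (\<integral>\<^sup>+z. G (t, z) \<partial>density lborel (normal_density t \<sigma>))"
      by (rule nn_integral_density[symmetric]) auto
    finally show "(\<integral>\<^sup>+e. G (t, t + e) \<partial>distr P borel \<epsilon>) = (\<integral>\<^sup>+z. G (t, z) \<partial>density lborel (normal_density t \<sigma>))" .
  qed
  finally show ?thesis .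
qed

text \<open>The infimum over couplings is taken for each \<open>t\<close> separately, so no selection of couplings has to be
  measurable in \<open>t\<close>.  The bound for fixed \<open>t\<close> has a measurable left-hand side, and the integral is
  monotone for arbitrary functions on the right.\<close>
proposition second_moment_transfer:
  assumes \<pi>: "sets \<pi> = sets borel" and \<kappa>: "\<kappa> \<in> borel \<rightarrow>\<^sub>M prob_algebra borel" and \<sigma>: "\<sigma> > 0"
    and g: "(\<lambda>(t, x). g t x) \<in> borel_measurable (borel \<Otimes>\<^sub>M borel)"
    and lip: "\<And>t x y. \<bar>g t x - g t y\<bar> \<le> L * \<bar>x - y\<bar>" and L: "L > 0" and s: "s > 0"
    and bounded: "\<And>t x. \<bar>g t x\<bar> \<le> b t"
  shows "(\<integral>\<^sup>+t. (\<integral>\<^sup>+x. ennreal ((g t x)\<^sup>2) \<partial>\<kappa> t) \<partial>\<pi>)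
    \<le> ennreal (1 + s) * (\<integral>\<^sup>+t. (\<integral>\<^sup>+z. ennreal ((g t z)\<^sup>2) \<partial>density lborel (normal_density t \<sigma>)) \<partial>\<pi>)
      + ennreal ((1 + 1 / s) * L\<^sup>2) * (\<integral>\<^sup>+t. wasserstein2_sq (\<kappa> t) (density lborel (normal_density t \<sigma>)) \<partial>\<pi>)"
proof -
  note [measurable_cong] = \<pi>
  let ?N = "\<lambda>t. density lborel (normal_density t \<sigma>)"
  define c where "c = ennreal ((1 + 1 / s) * L\<^sup>2)"
  have "(1 + 1 / s) * L\<^sup>2 > 0" using s L by (intro mult_pos_pos) (auto simp: add_pos_pos)
  then have c: "c \<noteq> 0" "c \<noteq> \<top>" by (auto simp: c_def)
  have g2: "(\<lambda>(t, x). ennreal ((g t x)\<^sup>2)) \<in> borel_measurable (borel \<Otimes>\<^sub>M borel)"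
    using g by (simp add: case_prod_beta')
  define a where "a = (\<lambda>t. \<integral>\<^sup>+x. ennreal ((g t x)\<^sup>2) \<partial>\<kappa> t)"
  define q where "q = (\<lambda>t. \<integral>\<^sup>+z. ennreal ((g t z)\<^sup>2) \<partial>?N t)"
  have [measurable]: "a \<in> borel_measurable borel" "q \<in> borel_measurable borel"
    unfolding a_def q_def
    using nn_integral_measurable_subprob_algebra2[OF g2 measurable_prob_algebraD[OF \<kappa>]]
      nn_integral_measurable_subprob_algebra2[OF g2 measurable_prob_algebraD[OF normal_density_kernel[OF \<sigma>]]] by auto
  have w: "(a t - ennreal (1 + s) * q t) / c \<le> wasserstein2_sq (\<kappa> t) (?N t)" for t
    unfolding a_def q_def c_def
  proof (rule wasserstein_lipschitz_square[OF _ _ _ lip L s])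
    show "sets (\<kappa> t) = sets borel"
      using measurable_space[OF \<kappa>, of t] by (auto simp: space_prob_algebra)
    show "g t \<in> borel_measurable borel"
      using measurable_compose[OF measurable_Pair1'[of t borel borel] g] by simp
    interpret prob_space "?N t" by (rule prob_space_normal_density[OF \<sigma>])
    have "(\<integral>\<^sup>+z. ennreal ((g t z)\<^sup>2) \<partial>?N t) \<le> (\<integral>\<^sup>+z. ennreal ((b t)\<^sup>2) \<partial>?N t)"
      using power_mono[OF bounded abs_ge_zero, of t _ 2] by (intro nn_integral_mono ennreal_leI) simp
    also have "\<dots> < \<top>" using emeasure_space_1 by simp
    finally show "(\<integral>\<^sup>+z. ennreal ((g t z)\<^sup>2) \<partial>?N t) \<noteq> \<top>" by simp
  qed simp
  have "(\<integral>\<^sup>+t. a t \<partial>\<pi>) \<le> (\<integral>\<^sup>+t. ennreal (1 + s) * q t + c * ((a t - ennreal (1 + s) * q t) / c) \<partial>\<pi>)"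
  proof (rule nn_integral_mono)
    fix t
    have "c * ((a t - ennreal (1 + s) * q t) / c) = a t - ennreal (1 + s) * q t"
      using c by (simp add: ennreal_times_divide mult.commute[of c] ennreal_mult_divide_eq)
    then show "a t \<le> ennreal (1 + s) * q t + c * ((a t - ennreal (1 + s) * q t) / c)"
      by (metis add_diff_eq_iff_ennreal le_cases diff_add_self_ennreal add.commute le_add_same_cancel1 le_iff_add zero_le order_trans)
  qed
  also have "\<dots> = ennreal (1 + s) * (\<integral>\<^sup>+t. q t \<partial>\<pi>) + c * (\<integral>\<^sup>+t. (a t - ennreal (1 + s) * q t) / c \<partial>\<pi>)"
    by (subst nn_integral_add) (auto simp: nn_integral_cmult)
  also have "\<dots> \<le> ennreal (1 + s) * (\<integral>\<^sup>+t. q t \<partial>\<pi>) + c * (\<integral>\<^sup>+t. wasserstein2_sq (\<kappa> t) (?N t) \<partial>\<pi>)"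
    by (intro add_left_mono mult_left_mono nn_integral_mono w) auto
  finally show ?thesis by (simp add: a_def q_def c_def)
qed

section \<open>Exponential moments and a maximal inequality\<close>

text \<open>For negative \<open>u\<close>, bound \<open>exp (- u)\<close> from below by its quadratic Taylor polynomial and invert.\<close>
lemma exp_le_quadratic:
  fixes u :: real
  assumes "u \<le> 1"
  shows "exp u \<le> 1 + u + u\<^sup>2"
proof (cases "u \<ge> 0")
  case True
  then show ?thesis using exp_bound[of u] assms by simp
next
  case False
  define v where "v = - u"
  have v: "v > 0" using False by (simp add: v_def)
  have e: "exp v \<ge> 1 + v + v\<^sup>2 / 2" using exp_lower_Taylor_quadratic[of v] v by simp
  have p: "1 - v + v\<^sup>2 > 0"
  proof -
    have "1 - v + v\<^sup>2 = (v - 1 / 2)\<^sup>2 + 3 / 4" by (simp add: power2_eq_square algebra_simps)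
    then show ?thesis by (simp add: add_nonneg_pos)
  qed
  have "1 \<le> 1 + v\<^sup>2 / 2 + v ^ 3 / 2 + v ^ 4 / 2" using v by simp
  also have "\<dots> = (1 - v + v\<^sup>2) * (1 + v + v\<^sup>2 / 2)"
    by (simp add: field_simps power2_eq_square power3_eq_cube power4_eq_xxxx)
  also have "\<dots> \<le> (1 - v + v\<^sup>2) * exp v" by (rule mult_left_mono[OF e]) (use p in simp)
  finally have "exp (- v) \<le> 1 - v + v\<^sup>2"
    by (simp add: exp_minus inverse_eq_divide pos_divide_le_eq)
  then show ?thesis by (simp add: v_def)
qed

text \<open>Replacing \<open>Y\<close> by \<open>min Y (1 / (2 * l))\<close> keeps the exponent below one, where the exponential is
  dominated by a quadratic, and can only lower the first and the second moment of \<open>Y\<close>.  The moment bounds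
  assumed for \<open>Y\<close> itself therefore enter the exponent as they are.\<close>
lemma (in prob_space) truncated_exp_moment:
  fixes Y D :: "'a \<Rightarrow> real"
  assumes [measurable]: "Y \<in> borel_measurable M" "D \<in> borel_measurable M"
    and Y2: "(\<integral>\<^sup>+x. ennreal ((Y x)\<^sup>2) \<partial>M) \<le> ennreal e2" and e2: "e2 \<ge> 0"
    and Y1: "expectation Y \<le> e1"
    and D: "\<And>x. 0 \<le> D x" "\<And>x. D x \<le> d" and ED: "(\<integral>\<^sup>+x. ennreal (D x) \<partial>M) \<le> ennreal eD" and eD: "eD \<ge> 0"
    and l: "l > 0" and b: "b \<ge> 0" "2 * b * d \<le> 1"
  shows "(\<integral>\<^sup>+x. ennreal (exp (l * min (Y x) (1 / (2 * l)) + b * D x)) \<partial>M)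
    \<le> ennreal (exp (l * e1 + 2 * l\<^sup>2 * e2 + 2 * b * eD))"
proof -
  have iY2: "integrable M (\<lambda>x. (Y x)\<^sup>2)"
    by (rule integrableI_bounded) (use Y2 in \<open>auto simp: le_less_trans\<close>)
  have iY: "integrable M Y" by (rule square_integrable_imp_integrable[OF _ iY2]) simp
  have iD: "integrable M D"
    by (rule integrable_const_bound[where B=d]) (use D in auto)
  have EY2: "expectation (\<lambda>x. (Y x)\<^sup>2) \<le> e2"
    using Y2 e2 nn_integral_eq_integral[OF iY2] by simp
  have ED': "expectation D \<le> eD"
    using ED eD nn_integral_eq_integral[OF iD] D by simp
  define Z where "Z = (\<lambda>x. min (Y x) (1 / (2 * l)))"
  have [measurable]: "Z \<in> borel_measurable M" unfolding Z_def by measurable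
  have iZ: "integrable M Z" unfolding Z_def using iY by (intro integrable_min) auto
  have Z2: "(Z x)\<^sup>2 \<le> (Y x)\<^sup>2" for x
  proof -
    have "\<bar>Z x\<bar> \<le> \<bar>Y x\<bar>" using l by (auto simp: Z_def min_def abs_if divide_less_0_iff)
    then show ?thesis by (simp only: abs_le_square_iff)
  qed
  have iZ2: "integrable M (\<lambda>x. (Z x)\<^sup>2)"
    by (rule Bochner_Integration.integrable_bound[OF iY2]) (use Z2 in auto)
  define U where "U = (\<lambda>x. l * Z x + b * D x)"
  have iU: "integrable M U" unfolding U_def using iZ iD by simp
  have U1: "U x \<le> 1" for x
  proof -
    have "l * Z x \<le> l * (1 / (2 * l))" by (rule mult_left_mono) (use l in \<open>auto simp: Z_def\<close>)
    moreover have "b * D x \<le> b * d" by (rule mult_left_mono) (use b D in auto)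
    ultimately show ?thesis using l b by (simp add: U_def)
  qed
  define R where "R = (\<lambda>x. 1 + U x + (2 * l\<^sup>2 * (Z x)\<^sup>2 + b * D x))"
  have iR: "integrable M R" unfolding R_def using iU iZ2 iD by simp
  have le: "exp (U x) \<le> R x" for x
  proof -
    have "exp (U x) \<le> 1 + U x + (U x)\<^sup>2" by (rule exp_le_quadratic[OF U1])
    also have "(U x)\<^sup>2 \<le> 2 * (l * Z x)\<^sup>2 + 2 * (b * D x)\<^sup>2"
      using zero_le_power2[of "l * Z x - b * D x"] by (simp add: U_def power2_sum power2_diff)
    also have "2 * (b * D x)\<^sup>2 \<le> b * D x"
    proof -
      have "2 * (b * D x)\<^sup>2 = (b * D x) * (2 * b * D x)" by (simp add: power2_eq_square)
      also have "\<dots> \<le> (b * D x) * 1"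
      proof (rule mult_left_mono)
        have "2 * b * D x \<le> 2 * b * d" by (rule mult_left_mono) (use b D in auto)
        then show "2 * b * D x \<le> 1" using b by simp
      qed (use b D in auto)
      finally show ?thesis by simp
    qed
    finally show ?thesis by (simp add: R_def power_mult_distrib)
  qed
  have "(\<integral>\<^sup>+x. ennreal (exp (U x)) \<partial>M) \<le> (\<integral>\<^sup>+x. ennreal (R x) \<partial>M)"
    by (intro nn_integral_mono ennreal_leI le)
  also have "\<dots> = ennreal (expectation R)"
    by (rule nn_integral_eq_integral[OF iR]) (use le in \<open>auto intro: order_trans[OF exp_ge_zero]\<close>)
  also have "expectation R \<le> exp (l * e1 + 2 * l\<^sup>2 * e2 + 2 * b * eD)"
  proof -
    have "expectation R = 1 + (l * expectation Z + b * expectation D) + (2 * l\<^sup>2 * expectation (\<lambda>x. (Z x)\<^sup>2) + b * expectation D)"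
      unfolding R_def U_def using iZ iD iZ2 by (simp add: prob_space)
    moreover have "l * expectation Z \<le> l * e1"
    proof (rule mult_left_mono)
      have "expectation Z \<le> expectation Y" by (rule integral_mono[OF iZ iY]) (simp add: Z_def)
      then show "expectation Z \<le> e1" using Y1 by simp
    qed (use l in simp)
    moreover have "2 * l\<^sup>2 * expectation (\<lambda>x. (Z x)\<^sup>2) \<le> 2 * l\<^sup>2 * e2"
    proof (rule mult_left_mono)
      have "expectation (\<lambda>x. (Z x)\<^sup>2) \<le> expectation (\<lambda>x. (Y x)\<^sup>2)" by (rule integral_mono[OF iZ2 iY2 Z2])
      then show "expectation (\<lambda>x. (Z x)\<^sup>2) \<le> e2" using EY2 by simp
    qed simp
    moreover have "b * expectation D \<le> b * eD" by (rule mult_left_mono[OF ED']) (use b in simp)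
    ultimately have "expectation R \<le> 1 + (l * e1 + 2 * l\<^sup>2 * e2 + 2 * b * eD)" by linarith
    also have "\<dots> \<le> exp (l * e1 + 2 * l\<^sup>2 * e2 + 2 * b * eD)" by (rule exp_ge_add_one_self)
    finally show ?thesis .
  qed
  finally show ?thesis by (simp add: U_def Z_def ennreal_leI)
qed

text \<open>For \<open>y \<ge> 1 / n\<close> the logarithm is at most \<open>ln T + ln n\<close>.  For smaller \<open>y\<close>, the bound
  \<open>z * (ln z)\<^sup>2 \<le> 4\<close> at \<open>z = n * y\<close> shows that the additional contribution is of order \<open>1 / n\<close>.\<close>
lemma g_fun_le_linear:
  assumes T: "T \<ge> 1"
  obtains C where "C > 0" "\<And>n y. n \<ge> (2::nat) \<Longrightarrow> 0 \<le> y \<Longrightarrow> y \<le> 1 \<Longrightarrow> g_fun T y \<le> C * (ln n)\<^sup>2 * (y + 1 / n)"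
proof
  define c where "c = 2 * ln T + 1"
  have T0: "ln T \<ge> 0" using T by simp
  show "2 * c\<^sup>2 + 32 > 0" by (simp add: add_nonneg_pos)
  fix n :: nat and y :: real assume n: "n \<ge> 2" and y: "0 \<le> y" "y \<le> 1"
  define l where "l = ln (real n)"
  have l: "l \<ge> 1 / 2" using ln_nat_ge_half[OF n] by (simp add: l_def)
  have cl: "ln T + l \<le> c * l"
  proof -
    have "ln T * 1 \<le> ln T * (2 * l)" by (rule mult_left_mono) (use l T0 in auto)
    then show ?thesis by (simp add: c_def algebra_simps)
  qed
  have "g_fun T y \<le> (2 * c\<^sup>2 + 32) * l\<^sup>2 * (y + 1 / n)"
  proof (cases "y = 0")
    case True
    then show ?thesis by (simp add: g_fun_def)
  next
    case False
    then have y0: "y > 0" using y by simp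
    have g: "g_fun T y = y * (ln (T / y))\<^sup>2" using y0 by (simp add: g_fun_def)
    have lnT: "ln (T / y) = ln T - ln y" using T y0 by (simp add: ln_div)
    have lny: "ln y \<le> 0" using y y0 by simp
    define z where "z = real n * y"
    have z0: "z > 0" using y0 n by (simp add: z_def)
    have lz: "ln y = ln z - l" using y0 n by (simp add: z_def l_def ln_mult)
    show ?thesis
    proof (cases "z \<ge> 1")
      case True
      then have "ln z \<ge> 0" by simp
      then have "ln (T / y) \<le> c * l" using cl lz lnT by linarith
      then have "(ln (T / y))\<^sup>2 \<le> (c * l)\<^sup>2" by (rule power_mono) (use lnT lny T0 in linarith)
      then have "y * (ln (T / y))\<^sup>2 \<le> y * (c * l)\<^sup>2" by (rule mult_left_mono[OF _ y(1)])
      also have "\<dots> = c\<^sup>2 * l\<^sup>2 * y" by (simp add: power_mult_distrib)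
      also have "\<dots> \<le> (2 * c\<^sup>2 + 32) * l\<^sup>2 * (y + 1 / n)"
        by (intro mult_mono) (use y in \<open>auto intro!: mult_nonneg_nonneg\<close>)
      finally show ?thesis unfolding g .
    next
      case False
      have "(ln (T / y))\<^sup>2 = ((ln T + l) + (- ln z))\<^sup>2"
        by (rule arg_cong[where f="\<lambda>u. u\<^sup>2"]) (simp add: lnT lz)
      also have "\<dots> \<le> 2 * (ln T + l)\<^sup>2 + 2 * (- ln z)\<^sup>2"
        using square_add_le_young[of 1 "ln T + l" "- ln z"] by (simp only: div_by_1 one_add_one zero_less_one)
      also have "\<dots> \<le> 2 * (c * l)\<^sup>2 + 2 * (4 / z)"
      proof (intro add_mono mult_left_mono)
        show "(ln T + l)\<^sup>2 \<le> (c * l)\<^sup>2" by (rule power_mono[OF cl]) (use T0 l in simp)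
        have "- ln z = 2 * ln (1 / sqrt z)" using z0 by (simp add: ln_div ln_sqrt)
        moreover have "ln (1 / sqrt z) \<le> 1 / sqrt z" using ln_le_minus_one[of "1 / sqrt z"] z0 by simp
        ultimately have "- ln z \<le> 2 / sqrt z" by simp
        moreover have "ln z \<le> 0" using False z0 by simp
        ultimately have "(- ln z)\<^sup>2 \<le> (2 / sqrt z)\<^sup>2" by (intro power_mono) auto
        then show "(- ln z)\<^sup>2 \<le> 4 / z" using z0 by (simp add: power_divide)
      qed auto
      finally have "y * (ln (T / y))\<^sup>2 \<le> y * (2 * (c * l)\<^sup>2 + 2 * (4 / z))" by (rule mult_left_mono[OF _ y(1)])
      also have "\<dots> = 2 * c\<^sup>2 * l\<^sup>2 * y + 8 * (1 / n)"
        using y0 n by (simp add: z_def power_mult_distrib field_simps)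
      also have "\<dots> \<le> (2 * c\<^sup>2 + 32) * l\<^sup>2 * y + (2 * c\<^sup>2 + 32) * l\<^sup>2 * (1 / n)"
      proof (intro add_mono mult_right_mono)
        have "(1 / 2)\<^sup>2 \<le> l\<^sup>2" by (rule power_mono[OF l]) simp
        then have "8 \<le> 32 * l\<^sup>2" by (simp add: power2_eq_square)
        also have "\<dots> \<le> (2 * c\<^sup>2 + 32) * l\<^sup>2" by (rule mult_right_mono) auto
        finally show "8 \<le> (2 * c\<^sup>2 + 32) * l\<^sup>2" .
      qed (use y in auto)
      also have "\<dots> = (2 * c\<^sup>2 + 32) * l\<^sup>2 * (y + 1 / n)" by (simp only: distrib_left)
      finally show ?thesis unfolding g .
    qed
  qed
  then show "g_fun T y \<le> (2 * c\<^sup>2 + 32) * (ln n)\<^sup>2 * (y + 1 / n)" by (simp add: l_def)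
qed

text \<open>The maximum over \<open>S\<close> is replaced by a smooth and measurable majorant, from \<open>v \<le> exp v\<close> at
  \<open>v = U s x - (N + G)\<close>.  Being nonnegative, the majorant can be used on part of the sample space only.\<close>
lemma (in prob_space) soft_maximum:
  fixes U :: "'b \<Rightarrow> 'a \<Rightarrow> real"
  assumes S: "finite S" "real (card S) \<le> exp N"
    and meas[measurable]: "\<And>s. s \<in> S \<Longrightarrow> U s \<in> borel_measurable M"
    and exp: "\<And>s. s \<in> S \<Longrightarrow> (\<integral>\<^sup>+x. ennreal (exp (U s x)) \<partial>M) \<le> ennreal (exp G)"
    and N: "N \<ge> 0" and G: "G \<ge> 0"
  obtains V where "integrable M V" "\<And>x. V x \<ge> 0" "\<And>s x. s \<in> S \<Longrightarrow> U s x \<le> V x" "expectation V \<le> N + G + 1"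
proof
  define V where "V = (\<lambda>x. (N + G) + (\<Sum>s\<in>S. exp (U s x - (N + G))))"
  have i: "integrable M (\<lambda>x. exp (U s x))" "expectation (\<lambda>x. exp (U s x)) \<le> exp G" if s: "s \<in> S" for s
  proof -
    note [measurable] = meas[OF s]
    show i: "integrable M (\<lambda>x. exp (U s x))"
      by (rule integrableI_bounded) (use exp[OF s] in \<open>auto simp: le_less_trans\<close>)
    show "expectation (\<lambda>x. exp (U s x)) \<le> exp G"
      using exp[OF s] nn_integral_eq_integral[OF i] by simp
  qed
  have e: "exp (U s x - (N + G)) = exp (U s x) * exp (- (N + G))" for s x
    by (simp add: exp_add[symmetric])
  show "integrable M V" unfolding V_def e using i by simp
  show "V x \<ge> 0" for x unfolding V_def using N G by (intro add_nonneg_nonneg sum_nonneg) auto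
  show "U s x \<le> V x" if s: "s \<in> S" for s x
  proof -
    have "U s x - (N + G) \<le> exp (U s x - (N + G))"
      using exp_ge_add_one_self[of "U s x - (N + G)"] by linarith
    also have "\<dots> \<le> (\<Sum>s\<in>S. exp (U s x - (N + G)))"
      by (rule member_le_sum[OF s]) (use S in auto)
    finally show ?thesis by (simp add: V_def)
  qed
  have "expectation V = (N + G) + (\<Sum>s\<in>S. expectation (\<lambda>x. exp (U s x)) * exp (- (N + G)))"
    unfolding V_def e using i by (simp add: prob_space)
  also have "(\<Sum>s\<in>S. expectation (\<lambda>x. exp (U s x)) * exp (- (N + G))) \<le> (\<Sum>s\<in>S. exp G * exp (- (N + G)))"
    by (intro sum_mono mult_right_mono i) auto
  also have "\<dots> = real (card S) * exp (- N)"
    by (simp add: exp_add[symmetric])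
  also have "\<dots> \<le> exp N * exp (- N)"
    by (rule mult_right_mono[OF S(2)]) simp
  also have "\<dots> = 1" by (simp add: exp_add[symmetric])
  finally show "expectation V \<le> N + G + 1" by simp
qed

text \<open>Log-likelihood ratios grow at most linearly in \<open>x\<close>; hence they stay below a multiple of
  \<open>l\<close> for \<open>\<bar>x\<bar> \<le> sqrt (2 * l)\<close>, since \<open>sqrt (2 * l) \<le> 2 * l\<close>.\<close>
lemma ln_ratio_bound:
  assumes \<pi>: "\<pi> \<in> prob_on M" and \<rho>: "\<rho> \<in> prob_on M" and M: "M > 0" and k: "0 < k" "k < \<sigma>"
    and l: "l \<ge> 1 / 2" and x: "\<bar>x\<bar> \<le> sqrt (2 * l)"
  shows "ln (normal_mix \<pi> \<sigma> x / normal_mix \<rho> \<sigma> x) \<le> (4 * M + 2 * M\<^sup>2) / k\<^sup>2 * l"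
proof -
  have s0: "\<sigma> > 0" using k by simp
  have "\<bar>k\<bar> \<le> \<bar>\<sigma>\<bar>" using k by simp
  then have k2: "k\<^sup>2 \<le> \<sigma>\<^sup>2" by (simp only: abs_le_square_iff)
  have "2 * l \<le> (2 * l)\<^sup>2" using l by (simp add: power2_eq_square)
  then have "sqrt (2 * l) \<le> 2 * l" using l by (intro real_le_lsqrt) auto
  then have xl: "\<bar>x\<bar> \<le> 2 * l" using x by simp
  have t: "tilt \<pi> \<sigma> 0 x > 0" "tilt \<rho> \<sigma> 0 x > 0" using tilt_0_pos \<pi> \<rho> s0 by auto
  have "ln (normal_mix \<pi> \<sigma> x / normal_mix \<rho> \<sigma> x) = ln (tilt \<pi> \<sigma> 0 x) - ln (tilt \<rho> \<sigma> 0 x)"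
    using t normal_density_pos[OF s0, of 0 x]
    by (simp add: normal_mix_tilt[OF \<pi> s0] normal_mix_tilt[OF \<rho> s0] ln_div)
  moreover have "ln (tilt \<pi> \<sigma> 0 x) \<le> \<bar>x\<bar> * (M / \<sigma>\<^sup>2)"
    using ln_mono[OF tilt_0_upper[OF \<pi> s0, of x] t(1)] by simp
  moreover have "- (\<bar>x\<bar> * (M / \<sigma>\<^sup>2) + M\<^sup>2 / (2 * \<sigma>\<^sup>2)) \<le> ln (tilt \<rho> \<sigma> 0 x)"
    using tilt_0_lower[OF \<rho> s0, of x] t by (subst ln_ge_iff) auto
  ultimately have "ln (normal_mix \<pi> \<sigma> x / normal_mix \<rho> \<sigma> x) \<le> 2 * (\<bar>x\<bar> * (M / \<sigma>\<^sup>2)) + M\<^sup>2 / (2 * \<sigma>\<^sup>2)" by linarith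
  also have "\<dots> \<le> 2 * ((2 * l) * (M / k\<^sup>2)) + (2 * l) * (M\<^sup>2 / k\<^sup>2)"
  proof (intro add_mono mult_left_mono)
    show "\<bar>x\<bar> * (M / \<sigma>\<^sup>2) \<le> (2 * l) * (M / k\<^sup>2)"
      using xl k2 M k l s0 by (intro mult_mono divide_left_mono) auto
    have "M\<^sup>2 / (2 * \<sigma>\<^sup>2) \<le> M\<^sup>2 / k\<^sup>2"
    proof (rule divide_left_mono)
      show "k\<^sup>2 \<le> 2 * \<sigma>\<^sup>2" using k2 zero_le_power2[of \<sigma>] by linarith
    qed (use k s0 in auto)
    also have "\<dots> \<le> (2 * l) * (M\<^sup>2 / k\<^sup>2)"
      using mult_right_mono[of 1 "2 * l" "M\<^sup>2 / k\<^sup>2"] l by simp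
    finally show "M\<^sup>2 / (2 * \<sigma>\<^sup>2) \<le> (2 * l) * (M\<^sup>2 / k\<^sup>2)" .
  qed auto
  also have "\<dots> = (4 * M + 2 * M\<^sup>2) / k\<^sup>2 * l" by (simp add: add_divide_distrib algebra_simps)
  finally show ?thesis .
qed

section \<open>The cost of estimating the prior\<close>

lemma (in prob_space) sum_exp_moment:
  fixes X :: "'i \<Rightarrow> 'a \<Rightarrow> real" and u :: "'i \<Rightarrow> real \<Rightarrow> real"
  assumes I: "finite I" and X: "indep_vars (\<lambda>_. borel) X I"
    and u: "\<And>i. i \<in> I \<Longrightarrow> u i \<in> borel_measurable borel"
    and le: "\<And>i. i \<in> I \<Longrightarrow> (\<integral>\<^sup>+x. ennreal (exp (u i x)) \<partial>distr M borel (X i)) \<le> ennreal (exp (e i))"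
  shows "(\<integral>\<^sup>+\<omega>. ennreal (exp (\<Sum>i\<in>I. u i (X i \<omega>))) \<partial>M) \<le> ennreal (exp (\<Sum>i\<in>I. e i))"
proof -
  have Xm: "X i \<in> borel_measurable M" if "i \<in> I" for i
    using X that by (auto simp: indep_vars_def)
  have ind: "indep_vars (\<lambda>_. borel) (\<lambda>i \<omega>. ennreal (exp (u i (X i \<omega>)))) I"
  proof (rule indep_vars_compose2[OF X, where Y="\<lambda>i x. ennreal (exp (u i x))"])
    fix i assume "i \<in> I"
    note [measurable] = u[OF this]
    show "(\<lambda>x. ennreal (exp (u i x))) \<in> borel_measurable borel" by measurable
  qed
  have "(\<integral>\<^sup>+\<omega>. ennreal (exp (\<Sum>i\<in>I. u i (X i \<omega>))) \<partial>M) = (\<integral>\<^sup>+\<omega>. (\<Prod>i\<in>I. ennreal (exp (u i (X i \<omega>)))) \<partial>M)"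
    by (simp add: exp_sum I prod_ennreal)
  also have "\<dots> = (\<Prod>i\<in>I. \<integral>\<^sup>+\<omega>. ennreal (exp (u i (X i \<omega>))) \<partial>M)"
    by (rule indep_vars_nn_integral[OF I ind]) simp
  also have "\<dots> \<le> (\<Prod>i\<in>I. ennreal (exp (e i)))"
  proof (rule prod_mono_ennreal)
    fix i assume i: "i \<in> I"
    note [measurable] = u[OF i] Xm[OF i]
    have "(\<integral>\<^sup>+\<omega>. ennreal (exp (u i (X i \<omega>))) \<partial>M) = (\<integral>\<^sup>+x. ennreal (exp (u i x)) \<partial>distr M borel (X i))"
      by (subst nn_integral_distr) auto
    then show "(\<integral>\<^sup>+\<omega>. ennreal (exp (u i (X i \<omega>))) \<partial>M) \<le> ennreal (exp (e i))"
      using le[OF i] by simp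
  qed
  also have "\<dots> = ennreal (exp (\<Sum>i\<in>I. e i))"
    by (simp add: exp_sum I prod_ennreal)
  finally show ?thesis .
qed

text \<open>The total squared difference involves the random prior; it is dominated by an explicit integrable
  \<open>V\<close> that depends on the sample only through the net and the bad event.  The numbers \<open>w i\<close> stand
  for transport costs: the last premise says that replacing the law of \<open>X i\<close> by the mixture costs
  at most a multiple of \<open>w i\<close>.\<close>
proposition estimated_rule_excess:
  assumes M: "M > 0" and T: "T \<ge> 1" and c: "c1 > 0" "c2 > 0" and q: "q \<ge> 0"
    and k: "0 < k" "k < K" and C1: "C1 > 0" and L: "L \<ge> 0"
  obtains C where "C > 0"
    "\<And>n P X \<sigma> \<pi>s \<pi>h r1 r2 w. n \<ge> (2::nat) \<Longrightarrow> prob_space P \<Longrightarrow> \<pi>s \<in> prob_on M \<Longrightarrow>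
      prob_space.indep_vars P (\<lambda>_. borel) X {1..n} \<Longrightarrow>
      (\<And>\<omega>. \<omega> \<in> space P \<Longrightarrow> \<pi>h \<omega> \<in> prob_on M) \<Longrightarrow>
      (AE \<omega> in P. 1 / real n * (\<Sum>i=1..n. ln (normal_mix (\<pi>h \<omega>) (\<sigma> i) (X i \<omega>)))
        \<ge> 1 / real n * (\<Sum>i=1..n. ln (normal_mix \<pi>s (\<sigma> i) (X i \<omega>))) - q * ln n / n) \<Longrightarrow>
      (\<And>i. i \<in> {1..n} \<Longrightarrow> measure P {\<omega> \<in> space P. \<bar>X i \<omega>\<bar> > sqrt (2 * ln n)} \<le> C1 / (real n)\<^sup>2) \<Longrightarrow>
      (\<And>i. i \<in> {1..n} \<Longrightarrow> k < \<sigma> i \<and> \<sigma> i < K) \<Longrightarrow>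
      (\<And>i. i \<in> {1..n} \<Longrightarrow> approx_normal_conv M T c1 c2 (distr P borel (X i)) \<pi>s (\<sigma> i) (r1 i) (r2 i)) \<Longrightarrow>
      (\<And>i. i \<in> {1..n} \<Longrightarrow> w i \<ge> 0) \<Longrightarrow>
      (\<And>i \<pi>. i \<in> {1..n} \<Longrightarrow> \<pi> \<in> prob_on M \<Longrightarrow>
        (\<integral>\<^sup>+x. ennreal ((post_mean \<pi> (\<sigma> i) x - post_mean \<pi>s (\<sigma> i) x)\<^sup>2) \<partial>distr P borel (X i))
        \<le> ennreal (2 * (LINT x|lborel. (post_mean \<pi> (\<sigma> i) x - post_mean \<pi>s (\<sigma> i) x)\<^sup>2 * normal_mix \<pi>s (\<sigma> i) x) + L * w i)) \<Longrightarrow>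
      \<exists>V. integrable P V \<and> (\<forall>\<omega>. V \<omega> \<ge> 0) \<and>
        (AE \<omega> in P. (\<Sum>i=1..n. (post_mean (\<pi>h \<omega>) (\<sigma> i) (X i \<omega>) - post_mean \<pi>s (\<sigma> i) (X i \<omega>))\<^sup>2) \<le> V \<omega>) \<and>
        (LINT \<omega>|P. V \<omega>) \<le> C * n * (rho_sq n r1 r2 * ln n ^ 3 + (\<Sum>i=1..n. w i) / n)"
proof -
  obtain Cg where Cg: "Cg > 0"
    "\<And>n y. n \<ge> (2::nat) \<Longrightarrow> 0 \<le> y \<Longrightarrow> y \<le> 1 \<Longrightarrow> g_fun T y \<le> Cg * (ln n)\<^sup>2 * (y + 1 / n)"
    by (rule g_fun_le_linear[OF T]) blast
  obtain Ch where Ch: "Ch > 0"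
    "\<And>n \<sigma> \<pi> \<rho>. n \<ge> (2::nat) \<Longrightarrow> k < \<sigma> \<Longrightarrow> \<sigma> < K \<Longrightarrow> \<pi> \<in> prob_on M \<Longrightarrow> \<rho> \<in> prob_on M \<Longrightarrow>
      (LINT x|lborel. (post_mean \<pi> \<sigma> x - post_mean \<rho> \<sigma> x)\<^sup>2 * normal_mix \<rho> \<sigma> x)
      \<le> Ch * ln n ^ 3 * (hellinger_sq (normal_mix \<pi> \<sigma>) (normal_mix \<rho> \<sigma>) + 1 / n)"
    by (rule post_mean_L2_hellinger[OF M k]) blast
  obtain Cs where Cs: "Cs > 0"
    "\<And>n. n \<ge> (2::nat) \<Longrightarrow> \<exists>S. finite S \<and> S \<subseteq> prob_on M \<and> real (card S) \<le> exp (Cs * (ln n)\<^sup>2) \<and>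
      (\<forall>\<pi>\<in>prob_on M. \<exists>\<rho>\<in>S. \<forall>\<sigma> x. k < \<sigma> \<longrightarrow> \<bar>x\<bar> \<le> sqrt (2 * ln n) \<longrightarrow>
        \<bar>ln (normal_mix \<pi> \<sigma> x) - ln (normal_mix \<rho> \<sigma> x)\<bar> \<le> 1 / n \<and>
        \<bar>post_mean \<pi> \<sigma> x - post_mean \<rho> \<sigma> x\<bar> \<le> 1 / n)"
    by (rule prior_net[OF M k(1)]) blast
  define y1 where "y1 = (4 * M + 2 * M\<^sup>2) / k\<^sup>2"
  have y1: "y1 > 0" using M k by (simp add: y1_def add_pos_pos)
  \<comment> \<open>The three bounds on \<open>a\<close> keep \<open>lam\<close> of order one, keep the log-likelihood ratio below the truncation
  level \<open>1 / (2 * lam)\<close> on the good event, and make the variance at most a quarter of the drift.\<close>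
  define a where "a = min 1 (min (1 / (4 * y1)) (c1 / (8 * c2 * Cg)))"
  have a: "a > 0" "a \<le> 1" "a \<le> 1 / (4 * y1)" "a \<le> c1 / (8 * c2 * Cg)"
    using y1 c Cg by (auto simp: a_def)
  have a2: "4 * a * y1 \<le> 1" "8 * a * c2 * Cg \<le> c1"
    using a(3,4) y1 c Cg by (simp_all add: pos_le_divide_eq mult_ac)
  \<comment> \<open>The two bounds on \<open>b\<close> keep \<open>bet\<close> times the squared difference below \<open>1 / 2\<close> and make its mean at
  most a quarter of the drift.\<close>
  define b where "b = min (1 / (256 * M\<^sup>2)) (c1 / (16 * Ch))"
  have b: "b > 0" "b \<le> 1 / (256 * M\<^sup>2)" "b \<le> c1 / (16 * Ch)" using M c Ch by (auto simp: b_def)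
  have b2: "256 * b * M\<^sup>2 \<le> 1" "16 * b * Ch \<le> c1"
    using b(2,3) M Ch by (simp_all add: pos_le_divide_eq mult_ac)
  define A1 where "A1 = 2 / b * ((2 * q + 4) + c1 + 2 * c1 + 8 * c2)"
  define A2 where "A2 = 2 / (a * b) * (Cs + 4)"
  define C where "C = 16 * A1 + A2 + 128 * (2 + 4 * M\<^sup>2 * C1) + 4 * L + 1"
  have A: "A1 \<ge> 0" "A2 \<ge> 0" unfolding A1_def A2_def using a b q c Cs by (auto intro!: mult_nonneg_nonneg add_nonneg_nonneg)
  have C0: "C > 0" unfolding C_def using A C1 L by (intro add_nonneg_pos add_nonneg_nonneg) auto
  show thesis
  proof (rule that[OF C0])
    fix n :: nat and P :: "'b measure" and X :: "nat \<Rightarrow> 'b \<Rightarrow> real" and \<sigma> r1 r2 w :: "nat \<Rightarrow> real"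
      and \<pi>s :: "real measure" and \<pi>h :: "'b \<Rightarrow> real measure"
    assume n: "n \<ge> 2" and P: "prob_space P" and \<pi>s: "\<pi>s \<in> prob_on M"
      and ind: "prob_space.indep_vars P (\<lambda>_. borel) X {1..n}"
      and \<pi>h: "\<And>\<omega>. \<omega> \<in> space P \<Longrightarrow> \<pi>h \<omega> \<in> prob_on M"
      and lik: "AE \<omega> in P. 1 / real n * (\<Sum>i=1..n. ln (normal_mix (\<pi>h \<omega>) (\<sigma> i) (X i \<omega>)))
        \<ge> 1 / real n * (\<Sum>i=1..n. ln (normal_mix \<pi>s (\<sigma> i) (X i \<omega>))) - q * ln n / n"
      and tail: "\<And>i. i \<in> {1..n} \<Longrightarrow> measure P {\<omega> \<in> space P. \<bar>X i \<omega>\<bar> > sqrt (2 * ln n)} \<le> C1 / (real n)\<^sup>2"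
      and \<sigma>: "\<And>i. i \<in> {1..n} \<Longrightarrow> k < \<sigma> i \<and> \<sigma> i < K"
      and approx: "\<And>i. i \<in> {1..n} \<Longrightarrow> approx_normal_conv M T c1 c2 (distr P borel (X i)) \<pi>s (\<sigma> i) (r1 i) (r2 i)"
      and w: "\<And>i. i \<in> {1..n} \<Longrightarrow> w i \<ge> 0"
      and trans: "\<And>i \<pi>. i \<in> {1..n} \<Longrightarrow> \<pi> \<in> prob_on M \<Longrightarrow>
        (\<integral>\<^sup>+x. ennreal ((post_mean \<pi> (\<sigma> i) x - post_mean \<pi>s (\<sigma> i) x)\<^sup>2) \<partial>distr P borel (X i))
        \<le> ennreal (2 * (LINT x|lborel. (post_mean \<pi> (\<sigma> i) x - post_mean \<pi>s (\<sigma> i) x)\<^sup>2 * normal_mix \<pi>s (\<sigma> i) x) + L * w i)"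
    interpret prob_space P by (rule P)
    define l where "l = ln (real n)"
    have l: "l \<ge> 1 / 2" using ln_nat_ge_half[OF n] by (simp add: l_def)
    have l0: "l > 0" using l by linarith
    have n0: "real n > 0" using n by simp
    have pw: "1 \<le> 2 ^ j * l ^ j" for j
    proof -
      have "1 \<le> (2 * l) ^ j" by (rule one_le_power) (use l in simp)
      then show ?thesis by (simp add: power_mult_distrib)
    qed
    have s0: "\<sigma> i > 0" if "i \<in> {1..n}" for i using \<sigma>[OF that] k by simp
    have r: "r1 i \<ge> 0" "r2 i \<ge> 0" if "i \<in> {1..n}" for i
      using approx[OF that] by (auto simp: approx_normal_conv_def)
    have Xm: "X i \<in> borel_measurable P" if "i \<in> {1..n}" for i
      using ind that by (auto simp: indep_vars_def)
    define lam where "lam = a / l\<^sup>2"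
    define bet where "bet = b * lam / l ^ 3"
    have lam: "lam > 0" using a l0 by (simp add: lam_def)
    have bet: "bet > 0" using b lam l0 by (simp add: bet_def)
    define Y where "Y = (\<lambda>\<pi> i x. ln (normal_mix \<pi> (\<sigma> i) x / normal_mix \<pi>s (\<sigma> i) x))"
    define D where "D = (\<lambda>\<pi> i x. (post_mean \<pi> (\<sigma> i) x - post_mean \<pi>s (\<sigma> i) x)\<^sup>2)"
    define u where "u = (\<lambda>\<pi> i x. lam * min (Y \<pi> i x) (1 / (2 * lam)) + bet * D \<pi> i x)"
    define U where "U = (\<lambda>\<pi> \<omega>. \<Sum>i=1..n. u \<pi> i (X i \<omega>))"
    have Dmeas[measurable]: "D \<pi> i \<in> borel_measurable borel" "Y \<pi> i \<in> borel_measurable borel"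
      if \<pi>: "\<pi> \<in> prob_on M" and i: "i \<in> {1..n}" for \<pi> i
    proof -
      note [measurable] = borel_measurable_post_mean[OF \<pi> s0[OF i]] borel_measurable_post_mean[OF \<pi>s s0[OF i]]
        borel_measurable_normal_mix[OF \<pi> s0[OF i]] borel_measurable_normal_mix[OF \<pi>s s0[OF i]]
      show "D \<pi> i \<in> borel_measurable borel" "Y \<pi> i \<in> borel_measurable borel"
        unfolding D_def Y_def by measurable
    qed
    have Dbound: "D \<pi> i x \<le> 4 * M\<^sup>2" if \<pi>: "\<pi> \<in> prob_on M" and i: "i \<in> {1..n}" for \<pi> i x
    proof -
      have "\<bar>post_mean \<pi> (\<sigma> i) x - post_mean \<pi>s (\<sigma> i) x\<bar> \<le> 2 * M"
        using post_mean_bound[OF \<pi> s0[OF i], of x] post_mean_bound[OF \<pi>s s0[OF i], of x] by linarith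
      then have "\<bar>post_mean \<pi> (\<sigma> i) x - post_mean \<pi>s (\<sigma> i) x\<bar>\<^sup>2 \<le> (2 * M)\<^sup>2" by (rule power_mono) simp
      then show ?thesis by (simp add: D_def power_mult_distrib)
    qed
    have betM: "2 * bet * (4 * M\<^sup>2) \<le> 1"
    proof -
      have "bet = b * a / l ^ 5" by (simp add: bet_def lam_def power_add[symmetric] flip: power_add)
      also have "\<dots> \<le> b * 1 / (1 / 2 ^ 5)"
        using a b pw[of 5] l0 by (intro frac_le mult_left_mono) (auto simp: field_simps)
      finally have "bet \<le> 32 * b" by simp
      then have "2 * bet * (4 * M\<^sup>2) \<le> 2 * (32 * b) * (4 * M\<^sup>2)" by (intro mult_right_mono mult_left_mono) auto
      also have "\<dots> = 256 * b * M\<^sup>2" by simp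
      also have "\<dots> \<le> 1" by (rule b2)
      finally show ?thesis .
    qed
    \<comment> \<open>What is left of the exponent once the Hellinger terms have been absorbed by the drift.\<close>
    define G where "G = lam * (c1 + c1 * (\<Sum>i=1..n. r1 i) + 8 * c2 * (\<Sum>i=1..n. r2 i)) + 2 * bet * L * (\<Sum>i=1..n. w i)"
    have sums0: "(\<Sum>i=1..n. r1 i) \<ge> 0" "(\<Sum>i=1..n. r2 i) \<ge> 0" "(\<Sum>i=1..n. w i) \<ge> 0"
      by (intro sum_nonneg r w; simp)+
    have G0: "G \<ge> 0" unfolding G_def using lam bet c L sums0 by (intro add_nonneg_nonneg mult_nonneg_nonneg) auto
    \<comment> \<open>The exponential moment for a fixed prior: the Hellinger terms of mean, variance and squared difference add up
  to a negative multiple of \<open>H i\<close> and a remainder of at most \<open>c1 / n\<close>, which sums to \<open>c1\<close>.\<close>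
    have exp_moment: "(\<integral>\<^sup>+\<omega>. ennreal (exp (U \<pi> \<omega>)) \<partial>P) \<le> ennreal (exp G)" if \<pi>: "\<pi> \<in> prob_on M" for \<pi>
    proof -
      define H where "H = (\<lambda>i. hellinger_sq (normal_mix \<pi> (\<sigma> i)) (normal_mix \<pi>s (\<sigma> i)))"
      define e1 where "e1 = (\<lambda>i. c1 * (- H i + r1 i))"
      define e2 where "e2 = (\<lambda>i. c2 * (g_fun T (H i) + r2 i))"
      define eD where "eD = (\<lambda>i. 2 * (Ch * l ^ 3 * (H i + 1 / n)) + L * w i)"
      define e where "e = (\<lambda>i. lam * e1 i + 2 * lam\<^sup>2 * e2 i + 2 * bet * eD i)"
      have H: "0 \<le> H i" "H i \<le> 1" if i: "i \<in> {1..n}" for i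
        unfolding H_def using hellinger_sq_normal_mix(2,3)[OF \<pi> \<pi>s s0[OF i]] by auto
      have "(\<integral>\<^sup>+\<omega>. ennreal (exp (U \<pi> \<omega>)) \<partial>P) \<le> ennreal (exp (\<Sum>i=1..n. e i))"
        unfolding U_def
      proof (rule sum_exp_moment[OF _ ind])
        fix i assume i: "i \<in> {1..n}"
        note [measurable] = Dmeas[OF \<pi> i] Xm[OF i]
        show "u \<pi> i \<in> borel_measurable borel" unfolding u_def by measurable
        interpret X: prob_space "distr P borel (X i)" by (rule prob_space_distr) measurable
        show "(\<integral>\<^sup>+x. ennreal (exp (u \<pi> i x)) \<partial>distr P borel (X i)) \<le> ennreal (exp (e i))"
          unfolding u_def e_def
        proof (rule X.truncated_exp_moment[where d="4 * M\<^sup>2"])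
          show "(\<integral>\<^sup>+x. ennreal ((Y \<pi> i x)\<^sup>2) \<partial>distr P borel (X i)) \<le> ennreal (e2 i)"
            and "(LINT x|distr P borel (X i). Y \<pi> i x) \<le> e1 i"
            using approx[OF i] \<pi> unfolding approx_normal_conv_def Y_def e1_def e2_def H_def by auto
          show "0 \<le> e2 i" unfolding e2_def using c r[OF i] H[OF i] by (auto simp: g_fun_def)
          show "0 \<le> eD i" unfolding eD_def using Ch l0 H[OF i] L w[OF i] by (intro add_nonneg_nonneg mult_nonneg_nonneg) auto
          show "(\<integral>\<^sup>+x. ennreal (D \<pi> i x) \<partial>distr P borel (X i)) \<le> ennreal (eD i)"
          proof -
            have "(LINT x|lborel. (post_mean \<pi> (\<sigma> i) x - post_mean \<pi>s (\<sigma> i) x)\<^sup>2 * normal_mix \<pi>s (\<sigma> i) x)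
                \<le> Ch * l ^ 3 * (H i + 1 / n)"
              using Ch(2)[OF n _ _ \<pi> \<pi>s, of "\<sigma> i"] \<sigma>[OF i] unfolding l_def H_def by blast
            then show ?thesis
              unfolding D_def eD_def using trans[OF i \<pi>] by (intro order_trans[OF trans[OF i \<pi>]] ennreal_leI) linarith
          qed
          show "Y \<pi> i \<in> borel_measurable (distr P borel (X i))" "D \<pi> i \<in> borel_measurable (distr P borel (X i))"
            using Dmeas[OF \<pi> i] by simp_all
        qed (use Dbound[OF \<pi> i] lam bet betM in \<open>auto simp: D_def\<close>)
      qed simp
      also have "(\<Sum>i=1..n. e i) \<le> (\<Sum>i=1..n. lam * (c1 / n + c1 * r1 i + 8 * c2 * r2 i) + 2 * bet * L * w i)"
      proof (rule sum_mono)
        fix i assume i: "i \<in> {1..n}"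
        have "2 * lam\<^sup>2 * e2 i \<le> lam * (c1 / 4 * (H i + 1 / n) + 8 * c2 * r2 i)"
        proof -
          have "2 * lam * e2 i \<le> 2 * lam * (c2 * (Cg * l\<^sup>2 * (H i + 1 / n) + r2 i))"
            unfolding e2_def using Cg(2)[OF n H[OF i]] c lam
            by (intro mult_left_mono add_right_mono) (auto simp: l_def)
          also have "\<dots> = (2 * a * c2 * Cg) * (H i + 1 / n) + 2 * lam * c2 * r2 i"
            using l0 by (simp add: lam_def field_simps)
          also have "\<dots> \<le> c1 / 4 * (H i + 1 / n) + 8 * c2 * r2 i"
          proof (rule add_mono)
            show "2 * a * c2 * Cg * (H i + 1 / n) \<le> c1 / 4 * (H i + 1 / n)"
              by (rule mult_right_mono) (use a2 H[OF i] in auto)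
            have "lam \<le> 1 / (1 / 2 ^ 2)"
              unfolding lam_def using a pw[of 2] l0 by (intro frac_le) (auto simp: field_simps)
            then have "2 * lam * (c2 * r2 i) \<le> 8 * (c2 * r2 i)"
              by (intro mult_right_mono) (use c r[OF i] in auto)
            then show "2 * lam * c2 * r2 i \<le> 8 * c2 * r2 i" by (simp only: mult.assoc)
          qed
          finally have "lam * (2 * lam * e2 i) \<le> lam * (c1 / 4 * (H i + 1 / n) + 8 * c2 * r2 i)"
            by (rule mult_left_mono) (use lam in simp)
          then show ?thesis by (simp add: power2_eq_square mult_ac)
        qed
        moreover have "2 * bet * eD i \<le> lam * (c1 / 4 * (H i + 1 / n)) + 2 * bet * L * w i"
        proof -
          have "2 * bet * (2 * (Ch * l ^ 3 * (H i + 1 / n))) = lam * (4 * b * Ch * (H i + 1 / n))"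
            using l0 by (simp add: bet_def)
          also have "\<dots> \<le> lam * (c1 / 4 * (H i + 1 / n))"
            by (intro mult_left_mono mult_right_mono) (use b2 lam H[OF i] in auto)
          finally show ?thesis by (simp add: eD_def distrib_left mult.assoc)
        qed
        moreover have "lam * e1 i = lam * (- c1 * H i + c1 * r1 i)"
          by (simp add: e1_def algebra_simps)
        moreover have "lam * (- c1 * H i + c1 * r1 i) + lam * (c1 / 4 * (H i + 1 / n) + 8 * c2 * r2 i) + lam * (c1 / 4 * (H i + 1 / n))
            \<le> lam * (c1 / n + c1 * r1 i + 8 * c2 * r2 i)"
        proof -
          have "c1 * H i \<ge> 0" "c1 / n \<ge> 0" using c H[OF i] by auto
          then have "(- c1 * H i + c1 * r1 i) + (c1 / 4 * (H i + 1 / n) + 8 * c2 * r2 i) + c1 / 4 * (H i + 1 / n)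
            \<le> c1 / n + c1 * r1 i + 8 * c2 * r2 i"
            by (simp add: distrib_left)
          then show ?thesis unfolding distrib_left[symmetric] by (rule mult_left_mono) (use lam in simp)
        qed
        ultimately show "e i \<le> lam * (c1 / n + c1 * r1 i + 8 * c2 * r2 i) + 2 * bet * L * w i"
          unfolding e_def by linarith
      qed
      also have "\<dots> = G"
        unfolding G_def using n by (simp add: sum.distrib sum_distrib_left distrib_left)
      finally show ?thesis by (simp add: ennreal_leI)
    qed
    obtain S where S: "finite S" "S \<subseteq> prob_on M" "real (card S) \<le> exp (Cs * l\<^sup>2)"
      and net: "\<And>\<pi>. \<pi> \<in> prob_on M \<Longrightarrow> \<exists>\<rho>\<in>S. \<forall>\<sigma> x. k < \<sigma> \<longrightarrow> \<bar>x\<bar> \<le> sqrt (2 * l) \<longrightarrow>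
        \<bar>ln (normal_mix \<pi> \<sigma> x) - ln (normal_mix \<rho> \<sigma> x)\<bar> \<le> 1 / n \<and>
        \<bar>post_mean \<pi> \<sigma> x - post_mean \<rho> \<sigma> x\<bar> \<le> 1 / n"
      using Cs(2)[OF n] unfolding l_def by metis
    obtain V0 where V0: "integrable P V0" "\<And>x. V0 x \<ge> 0" "\<And>s x. s \<in> S \<Longrightarrow> U s x \<le> V0 x"
      "expectation V0 \<le> Cs * l\<^sup>2 + G + 1"
    proof (rule soft_maximum[OF S(1,3), of U G])
      fix s assume s: "s \<in> S"
      then have sM: "s \<in> prob_on M" using S by auto
      show "U s \<in> borel_measurable P"
        unfolding U_def u_def
      proof (rule borel_measurable_sum)
        fix i assume i: "i \<in> {1..n}"
        note [measurable] = Dmeas[OF sM i] Xm[OF i]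
        show "(\<lambda>\<omega>. lam * min (Y s i (X i \<omega>)) (1 / (2 * lam)) + bet * D s i (X i \<omega>)) \<in> borel_measurable P"
          by measurable
      qed
      show "(\<integral>\<^sup>+x. ennreal (exp (U s x)) \<partial>P) \<le> ennreal (exp G)" by (rule exp_moment[OF sM])
    qed (use Cs G0 in auto)
    define B where "B = (\<lambda>i. {\<omega> \<in> space P. \<bar>X i \<omega>\<bar> > sqrt (2 * l)})"
    \<comment> \<open>Off this event the net approximates the estimated prior at every observation.  On it, the trivial bound
  \<open>4 * M\<^sup>2\<close> for each squared difference suffices, as its probability is of order \<open>1 / n\<close>.\<close>
    define bad where "bad = (\<Union>i\<in>{1..n}. B i)"
    have Bm: "B i \<in> events" if "i \<in> {1..n}" for i
    proof -
      note [measurable] = Xm[OF that]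
      show ?thesis unfolding B_def by measurable
    qed
    have badm[measurable]: "bad \<in> events" unfolding bad_def using Bm by (intro sets.finite_UN) auto
    have badp: "prob bad \<le> C1 / n"
    proof -
      have "prob bad \<le> (\<Sum>i=1..n. prob (B i))"
        unfolding bad_def by (rule measure_UNION_le) (use Bm in auto)
      also have "\<dots> \<le> (\<Sum>i=1..n. C1 / (real n)\<^sup>2)"
        by (rule sum_mono) (use tail in \<open>auto simp: B_def l_def\<close>)
      also have "\<dots> = C1 / n" using n by (simp add: power2_eq_square)
      finally show ?thesis .
    qed
    \<comment> \<open>The factor two and the term \<open>2 / n\<close> pay for replacing the estimated prior by its representative in the net.\<close>
    define V where "V = (\<lambda>\<omega>. 2 / bet * (lam * (q * l + 1) + V0 \<omega>) + 2 / n + 4 * M\<^sup>2 * n * indicator bad \<omega>)"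
    show "\<exists>V. integrable P V \<and> (\<forall>\<omega>. V \<omega> \<ge> 0) \<and>
        (AE \<omega> in P. (\<Sum>i=1..n. (post_mean (\<pi>h \<omega>) (\<sigma> i) (X i \<omega>) - post_mean \<pi>s (\<sigma> i) (X i \<omega>))\<^sup>2) \<le> V \<omega>) \<and>
        (LINT \<omega>|P. V \<omega>) \<le> C * n * (rho_sq n r1 r2 * ln n ^ 3 + (\<Sum>i=1..n. w i) / n)"
    proof (intro exI[of _ V] conjI allI)
      have ibad: "integrable P (\<lambda>\<omega>. indicator bad \<omega> :: real)"
        by (simp add: integrable_indicator_iff less_top[symmetric])
      show "integrable P V" unfolding V_def using V0(1) ibad by simp
      show "V \<omega> \<ge> 0" for \<omega> unfolding V_def using bet lam q l0 V0(2)[of \<omega>]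
        by (intro add_nonneg_nonneg mult_nonneg_nonneg divide_nonneg_nonneg) auto
      have ln_ratio: "Y \<pi> i x = ln (normal_mix \<pi> (\<sigma> i) x) - ln (normal_mix \<pi>s (\<sigma> i) x)"
        if "\<pi> \<in> prob_on M" "i \<in> {1..n}" for \<pi> i x
        unfolding Y_def using normal_mix_pos[OF that(1) s0[OF that(2)], of x] normal_mix_pos[OF \<pi>s s0[OF that(2)], of x]
        by (simp add: ln_div)
      show "AE \<omega> in P. (\<Sum>i=1..n. (post_mean (\<pi>h \<omega>) (\<sigma> i) (X i \<omega>) - post_mean \<pi>s (\<sigma> i) (X i \<omega>))\<^sup>2) \<le> V \<omega>"
        using lik AE_space
      proof eventually_elim
        case (elim \<omega>)
        note \<pi> = \<pi>h[OF elim(2)]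
        have "(\<Sum>i=1..n. D (\<pi>h \<omega>) i (X i \<omega>)) \<le> V \<omega>"
        proof (cases "\<omega> \<in> bad")
          case True
          have "(\<Sum>i=1..n. D (\<pi>h \<omega>) i (X i \<omega>)) \<le> (\<Sum>i=1..n. 4 * M\<^sup>2)"
            by (intro sum_mono Dbound \<pi>) auto
          also have "\<dots> = 4 * M\<^sup>2 * n * indicator bad \<omega>" using True by simp
          also have "\<dots> \<le> V \<omega>"
            unfolding V_def using bet lam q l0 V0(2)[of \<omega>] by simp
          finally show ?thesis .
        next
          case False
          then have x: "\<bar>X i \<omega>\<bar> \<le> sqrt (2 * l)" if "i \<in> {1..n}" for i
            using that elim(2) by (auto simp: bad_def B_def not_less)
          \<comment> \<open>The representative of the estimated prior in the net: the likelihood condition transfers to it with a loss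
  of \<open>n * (1 / n) = 1\<close>.\<close>
          obtain \<rho> where \<rho>: "\<rho> \<in> S" and near: "\<And>\<sigma> x. k < \<sigma> \<Longrightarrow> \<bar>x\<bar> \<le> sqrt (2 * l) \<Longrightarrow>
            \<bar>ln (normal_mix (\<pi>h \<omega>) \<sigma> x) - ln (normal_mix \<rho> \<sigma> x)\<bar> \<le> 1 / n \<and>
            \<bar>post_mean (\<pi>h \<omega>) \<sigma> x - post_mean \<rho> \<sigma> x\<bar> \<le> 1 / n"
            using net[OF \<pi>] by blast
          have \<rho>M: "\<rho> \<in> prob_on M" using \<rho> S by auto
          have close: "\<bar>ln (normal_mix (\<pi>h \<omega>) (\<sigma> i) (X i \<omega>)) - ln (normal_mix \<rho> (\<sigma> i) (X i \<omega>))\<bar> \<le> 1 / n"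
            "\<bar>post_mean (\<pi>h \<omega>) (\<sigma> i) (X i \<omega>) - post_mean \<rho> (\<sigma> i) (X i \<omega>)\<bar> \<le> 1 / n" if "i \<in> {1..n}" for i
            using near[of "\<sigma> i" "X i \<omega>"] \<sigma>[OF that] x[OF that] by auto
          have "(\<Sum>i=1..n. Y \<rho> i (X i \<omega>)) \<ge> - (q * l + 1)"
          proof -
            have "1 / real n * ((\<Sum>i=1..n. ln (normal_mix (\<pi>h \<omega>) (\<sigma> i) (X i \<omega>))) - (\<Sum>i=1..n. ln (normal_mix \<pi>s (\<sigma> i) (X i \<omega>))))
                \<ge> 1 / real n * (- (q * l))"
              using elim(1) by (simp add: l_def right_diff_distrib)
            then have "(\<Sum>i=1..n. ln (normal_mix (\<pi>h \<omega>) (\<sigma> i) (X i \<omega>))) - (\<Sum>i=1..n. ln (normal_mix \<pi>s (\<sigma> i) (X i \<omega>))) \<ge> - (q * l)"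
              using n0 by (simp only: mult_le_cancel_left_pos zero_less_divide_1_iff)
            moreover have "(\<Sum>i=1..n. Y \<rho> i (X i \<omega>)) \<ge> (\<Sum>i=1..n. ln (normal_mix (\<pi>h \<omega>) (\<sigma> i) (X i \<omega>)) - ln (normal_mix \<pi>s (\<sigma> i) (X i \<omega>)) - 1 / n)"
            proof (rule sum_mono)
              fix i assume i: "i \<in> {1..n}"
              show "ln (normal_mix (\<pi>h \<omega>) (\<sigma> i) (X i \<omega>)) - ln (normal_mix \<pi>s (\<sigma> i) (X i \<omega>)) - 1 / n \<le> Y \<rho> i (X i \<omega>)"
                using close(1)[OF i] unfolding ln_ratio[OF \<rho>M i] by linarith
            qed
            ultimately show ?thesis using n by (simp add: sum_subtractf)
          qed
          moreover have "U \<rho> \<omega> = lam * (\<Sum>i=1..n. Y \<rho> i (X i \<omega>)) + bet * (\<Sum>i=1..n. D \<rho> i (X i \<omega>))"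
          proof -
            have "min (Y \<rho> i (X i \<omega>)) (1 / (2 * lam)) = Y \<rho> i (X i \<omega>)" if i: "i \<in> {1..n}" for i
            proof -
              have "Y \<rho> i (X i \<omega>) \<le> y1 * l"
                unfolding Y_def y1_def using \<sigma>[OF i] by (intro ln_ratio_bound[OF \<rho>M \<pi>s M k(1) _ l x[OF i]]) auto
              also have "\<dots> \<le> 1 / (2 * lam)"
              proof -
                have "2 * a * y1 * l \<le> 1 / 2 * l"
                  by (rule mult_right_mono) (use a2 l0 in auto)
                also have "\<dots> \<le> l * l" by (rule mult_right_mono) (use l in auto)
                finally show ?thesis using a l0 by (simp add: lam_def field_simps power2_eq_square)
              qed
              finally show ?thesis by simp
            qed
            then show ?thesis unfolding U_def u_def by (simp add: sum.distrib sum_distrib_left)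
          qed
          ultimately have "bet * (\<Sum>i=1..n. D \<rho> i (X i \<omega>)) \<le> V0 \<omega> + lam * (q * l + 1)"
          proof -
            assume *: "(\<Sum>i=1..n. Y \<rho> i (X i \<omega>)) \<ge> - (q * l + 1)"
              "U \<rho> \<omega> = lam * (\<Sum>i=1..n. Y \<rho> i (X i \<omega>)) + bet * (\<Sum>i=1..n. D \<rho> i (X i \<omega>))"
            have "lam * (- (q * l + 1)) \<le> lam * (\<Sum>i=1..n. Y \<rho> i (X i \<omega>))"
              by (rule mult_left_mono[OF *(1)]) (use lam in simp)
            then show ?thesis using *(2) V0(3)[OF \<rho>, of \<omega>] by (simp only: mult_minus_right)
          qed
          then have sD: "(\<Sum>i=1..n. D \<rho> i (X i \<omega>)) \<le> (lam * (q * l + 1) + V0 \<omega>) / bet"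
            using bet by (simp add: pos_le_divide_eq mult.commute add.commute)
          have "(\<Sum>i=1..n. D (\<pi>h \<omega>) i (X i \<omega>)) \<le> (\<Sum>i=1..n. 2 * D \<rho> i (X i \<omega>) + 2 / (real n)\<^sup>2)"
          proof (rule sum_mono)
            fix i assume i: "i \<in> {1..n}"
            have sq: "(v + z)\<^sup>2 \<le> 2 * v\<^sup>2 + 2 * z\<^sup>2" for v z :: real
              using zero_le_power2[of "v - z"] by (simp add: power2_sum power2_diff)
            have "(post_mean (\<pi>h \<omega>) (\<sigma> i) (X i \<omega>) - post_mean \<rho> (\<sigma> i) (X i \<omega>))\<^sup>2 \<le> (1 / n)\<^sup>2"
              using power_mono[OF close(2)[OF i] abs_ge_zero, of 2] by simp
            then show "D (\<pi>h \<omega>) i (X i \<omega>) \<le> 2 * D \<rho> i (X i \<omega>) + 2 / (real n)\<^sup>2"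
              using sq[of "post_mean \<rho> (\<sigma> i) (X i \<omega>) - post_mean \<pi>s (\<sigma> i) (X i \<omega>)" "post_mean (\<pi>h \<omega>) (\<sigma> i) (X i \<omega>) - post_mean \<rho> (\<sigma> i) (X i \<omega>)"]
              unfolding D_def by (simp add: power_divide)
          qed
          also have "\<dots> = 2 * (\<Sum>i=1..n. D \<rho> i (X i \<omega>)) + 2 / n"
            using n by (simp add: sum.distrib sum_distrib_left power2_eq_square)
          also have "\<dots> \<le> 2 * ((lam * (q * l + 1) + V0 \<omega>) / bet) + 2 / n"
            by (intro add_right_mono mult_left_mono sD) simp
          also have "\<dots> = V \<omega>" using False by (simp add: V_def)
          finally show ?thesis .
        qed
        then show ?case by (simp add: D_def)
      qed
      define \<rho>2 where "\<rho>2 = rho_sq n r1 r2"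
      have \<rho>2: "real n * \<rho>2 = l ^ 4 + (\<Sum>i=1..n. r1 i) + (\<Sum>i=1..n. r2 i)"
        unfolding \<rho>2_def rho_sq_def l_def using n by (simp add: distrib_left)
      define Q where "Q = l ^ 3 * (real n * \<rho>2)"
      have Q7: "l ^ 7 \<le> Q"
      proof -
        have "l ^ 7 = l ^ 3 * l ^ 4" by (simp flip: power_add)
        also have "\<dots> \<le> Q" unfolding Q_def \<rho>2 by (rule mult_left_mono) (use sums0 l0 in auto)
        finally show ?thesis .
      qed
      have Q0: "Q \<ge> 0" using Q7 l0 by (meson order_trans zero_le_power less_imp_le)
      have lb: "lam / bet = l ^ 3 / b" using lam b l0 by (simp add: bet_def)
      have ib: "1 / bet = l ^ 5 / (a * b)" using a b l0 by (simp add: bet_def lam_def flip: power_add)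
      have "expectation V = 2 / bet * (lam * (q * l + 1) + expectation V0) + 2 / n + 4 * M\<^sup>2 * n * prob bad"
        unfolding V_def using V0(1) ibad by (simp add: prob_space)
      also have "\<dots> \<le> 2 / bet * (lam * (q * l + 1) + (Cs * l\<^sup>2 + G + 1)) + 2 / n + 4 * M\<^sup>2 * n * (C1 / n)"
        using V0(4) bet badp q lam by (intro add_mono mult_left_mono) auto
      also have "\<dots> = 2 / bet * (lam * (q * l + 1) + lam * (c1 + c1 * (\<Sum>i=1..n. r1 i) + 8 * c2 * (\<Sum>i=1..n. r2 i)))
          + 2 / bet * (Cs * l\<^sup>2 + 1) + (2 / n + 4 * M\<^sup>2 * C1) + 4 * L * (\<Sum>i=1..n. w i)"
        using bet n by (simp add: G_def algebra_simps)
      also have "2 / bet * (lam * (q * l + 1) + lam * (c1 + c1 * (\<Sum>i=1..n. r1 i) + 8 * c2 * (\<Sum>i=1..n. r2 i)))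
          \<le> 16 * A1 * Q"
      proof -
        have "2 / bet * (lam * (q * l + 1) + lam * (c1 + c1 * (\<Sum>i=1..n. r1 i) + 8 * c2 * (\<Sum>i=1..n. r2 i)))
            = 2 * (lam / bet) * (q * l + 1 + c1 + c1 * (\<Sum>i=1..n. r1 i) + 8 * c2 * (\<Sum>i=1..n. r2 i))"
          by (simp add: algebra_simps add_divide_distrib)
        also have "\<dots> \<le> 2 * (lam / bet) * (((2 * q + 4) + c1 + 2 * c1 + 8 * c2) * (8 * (real n * \<rho>2)))"
        proof (rule mult_left_mono)
          have l4: "1 \<le> 16 * l ^ 4" using pw[of 4] by simp
          have l3: "1 \<le> 8 * l ^ 3" using pw[of 3] by simp
          have "l * 1 \<le> l * (8 * l ^ 3)" by (rule mult_left_mono[OF l3]) (use l0 in simp)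
          also have "l * (8 * l ^ 3) = 8 * l ^ 4" by (simp add: power3_eq_cube power4_eq_xxxx)
          finally have "l \<le> 8 * l ^ 4" by simp
          then have "q * l \<le> q * (8 * l ^ 4)" by (rule mult_left_mono) (rule q)
          moreover have "c1 * 1 \<le> c1 * (16 * l ^ 4)" by (rule mult_left_mono[OF l4]) (use c in simp)
          moreover have "0 \<le> q * l ^ 4" "0 \<le> c1 * l ^ 4" "0 \<le> c2 * l ^ 4" using q c l0 by auto
          moreover have "0 \<le> q * (\<Sum>i=1..n. r1 i)" "0 \<le> c1 * (\<Sum>i=1..n. r1 i)" "0 \<le> c2 * (\<Sum>i=1..n. r1 i)"
            "0 \<le> q * (\<Sum>i=1..n. r2 i)" "0 \<le> c1 * (\<Sum>i=1..n. r2 i)" "0 \<le> c2 * (\<Sum>i=1..n. r2 i)"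
            using q c sums0 by auto
          ultimately show "q * l + 1 + c1 + c1 * (\<Sum>i=1..n. r1 i) + 8 * c2 * (\<Sum>i=1..n. r2 i)
              \<le> ((2 * q + 4) + c1 + 2 * c1 + 8 * c2) * (8 * (real n * \<rho>2))"
            using l4 sums0 unfolding \<rho>2 by (simp add: algebra_simps)
        qed (use lam bet in auto)
        also have "\<dots> = 8 * A1 * Q" unfolding lb A1_def Q_def by simp
        also have "\<dots> \<le> 16 * A1 * Q" using A Q0 by (simp add: mult_right_mono)
        finally show ?thesis .
      qed
      also have "2 / bet * (Cs * l\<^sup>2 + 1) \<le> A2 * Q"
      proof -
        have "2 / bet * (Cs * l\<^sup>2 + 1) \<le> 2 / bet * ((Cs + 4) * l\<^sup>2)"
          by (rule mult_left_mono) (use pw[of 2] bet in \<open>auto simp: distrib_right\<close>)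
        also have "\<dots> = 2 * (1 / bet) * ((Cs + 4) * l\<^sup>2)" by simp
        also have "\<dots> = 2 / (a * b) * (Cs + 4) * (l ^ 5 * l\<^sup>2)"
        proof -
          have "2 * (u / d) * (e * v) = 2 / d * e * (u * v)" for u v d e :: real by simp
          then show ?thesis unfolding ib by blast
        qed
        also have "l ^ 5 * l\<^sup>2 = l ^ 7" by (simp flip: power_add)
        also have "2 / (a * b) * (Cs + 4) * l ^ 7 = A2 * l ^ 7" by (simp add: A2_def)
        also have "\<dots> \<le> A2 * Q" by (rule mult_left_mono[OF Q7]) (use A in simp)
        finally show ?thesis .
      qed
      also have "2 / n + 4 * M\<^sup>2 * C1 \<le> 128 * (2 + 4 * M\<^sup>2 * C1) * Q"
      proof -
        have "1 \<le> 128 * Q" using pw[of 7] Q7 by simp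
        have "2 / n + 4 * M\<^sup>2 * C1 \<le> (2 + 4 * M\<^sup>2 * C1) * 1" using n by (simp add: divide_le_eq)
        also have "\<dots> \<le> (2 + 4 * M\<^sup>2 * C1) * (128 * Q)"
          by (rule mult_left_mono[OF \<open>1 \<le> 128 * Q\<close>]) (use C1 in simp)
        also have "\<dots> = 128 * (2 + 4 * M\<^sup>2 * C1) * Q" by simp
        finally show ?thesis .
      qed
      also have "16 * A1 * Q + A2 * Q + 128 * (2 + 4 * M\<^sup>2 * C1) * Q + 4 * L * (\<Sum>i=1..n. w i)
          \<le> C * Q + C * (\<Sum>i=1..n. w i)"
      proof -
        have "16 * A1 * Q + A2 * Q + 128 * (2 + 4 * M\<^sup>2 * C1) * Q = (16 * A1 + A2 + 128 * (2 + 4 * M\<^sup>2 * C1)) * Q"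
          by (simp only: distrib_right)
        also have "\<dots> \<le> C * Q"
          by (rule mult_right_mono[OF _ Q0]) (use A C1 L in \<open>simp add: C_def\<close>)
        finally have "16 * A1 * Q + A2 * Q + 128 * (2 + 4 * M\<^sup>2 * C1) * Q \<le> C * Q" .
        moreover have "4 * L * (\<Sum>i=1..n. w i) \<le> C * (\<Sum>i=1..n. w i)"
          by (rule mult_right_mono[OF _ sums0(3)]) (use A C1 L in \<open>simp add: C_def\<close>)
        ultimately show ?thesis by linarith
      qed
      finally show "(LINT \<omega>|P. V \<omega>) \<le> C * n * (rho_sq n r1 r2 * ln n ^ 3 + (\<Sum>i=1..n. w i) / n)"
        unfolding \<rho>2_def[symmetric] l_def[symmetric] Q_def using n0 by (simp add: algebra_simps)
    qed
  qed
qed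

section \<open>The regret bound\<close>

text \<open>What remains is to combine the excess of the estimated rule with the transport bound.  If the
  mean transport cost is infinite the claim is trivial.  Otherwise the transport bound is used twice: for the
  oracle rule itself, and for the difference of two posterior means, whose Lipschitz constant is
  \<open>2 * L0\<close>; the factor \<open>8 * L0\<^sup>2\<close> is \<open>(1 + 1 / s) * (2 * L0)\<^sup>2\<close> at \<open>s = 1\<close>.\<close>
theorem theorem2p3:
  fixes M T c1 c2 q C1 C2 k K :: real
    and \<pi>s :: "real measure"
    and P :: "nat \<Rightarrow> 'a measure"
    and \<theta> X \<epsilon> :: "nat \<Rightarrow> nat \<Rightarrow> 'a \<Rightarrow> real"
    and \<kappa> :: "nat \<Rightarrow> nat \<Rightarrow> real \<Rightarrow> real measure"
    and \<sigma> r1 r2 :: "nat \<Rightarrow> nat \<Rightarrow> real"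
    and \<pi>h :: "nat \<Rightarrow> 'a \<Rightarrow> real measure"
  assumes "M > 0" and "T \<ge> 1" and "c1 > 0" and "c2 > 0" and "q \<ge> 0"
    and \<pi>s: "\<pi>s \<in> prob_on M"
    and prob: "\<And>n. n \<ge> 1 \<Longrightarrow> prob_space (P n)"
    and \<theta>_law: "\<And>n i. i \<in> {1..n} \<Longrightarrow> distr (P n) borel (\<theta> n i) = \<pi>s"
    and pairs_indep: "\<And>n. n \<ge> 1 \<Longrightarrow>
      prob_space.indep_vars (P n) (\<lambda>_. borel \<Otimes>\<^sub>M borel) (\<lambda>i \<omega>. (X n i \<omega>, \<theta> n i \<omega>)) {1..n}"
    and cond_law: "\<And>n i. i \<in> {1..n} \<Longrightarrow> is_cond_law (P n) (X n i) (\<theta> n i) (\<kappa> n i)"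
    and \<epsilon>_law: "\<And>n i. i \<in> {1..n} \<Longrightarrow>
      distributed (P n) lborel (\<epsilon> n i) (normal_density 0 (\<sigma> n i))"
    and \<epsilon>_indep: "\<And>n. n \<ge> 1 \<Longrightarrow> prob_space.indep_vars (P n) (\<lambda>_. borel) (\<epsilon> n) {1..n}"
    and \<epsilon>_\<theta>_indep: "\<And>n. n \<ge> 1 \<Longrightarrow>
      prob_space.indep_var (P n)
        (Pi\<^sub>M {1..n} (\<lambda>_. borel)) (\<lambda>\<omega>. \<lambda>i\<in>{1..n}. \<epsilon> n i \<omega>)
        (Pi\<^sub>M {1..n} (\<lambda>_. borel)) (\<lambda>\<omega>. \<lambda>i\<in>{1..n}. \<theta> n i \<omega>)"
    and \<pi>h_meas: "\<And>n. n \<ge> 1 \<Longrightarrow> \<pi>h n \<in> P n \<rightarrow>\<^sub>M prob_algebra borel"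
    and \<pi>h_supp: "\<And>n. n \<ge> 1 \<Longrightarrow> \<forall>\<omega>\<in>space (P n). \<pi>h n \<omega> \<in> prob_on M"
    and \<pi>h_likelihood: "\<And>n. n \<ge> 1 \<Longrightarrow> AE \<omega> in P n.
      1 / real n * (\<Sum>i=1..n. ln (normal_mix (\<pi>h n \<omega>) (\<sigma> n i) (X n i \<omega>)))
        \<ge> 1 / real n * (\<Sum>i=1..n. ln (normal_mix \<pi>s (\<sigma> n i) (X n i \<omega>))) - q * ln (real n) / real n"
    and "C1 > 0" and "C2 > 1"
    and tails: "\<And>n i t. i \<in> {1..n} \<Longrightarrow> t \<ge> 1 \<Longrightarrow>
      measure (P n) {\<omega> \<in> space (P n). \<bar>X n i \<omega>\<bar> > t} \<le> C1 * exp (- C2 * t\<^sup>2)"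
    and "0 < k" and "k < K"
    and scales: "\<And>n i. i \<in> {1..n} \<Longrightarrow> k < \<sigma> n i \<and> \<sigma> n i < K"
    and approx: "\<And>n i. i \<in> {1..n} \<Longrightarrow>
      approx_normal_conv M T c1 c2 (distr (P n) borel (X n i)) \<pi>s (\<sigma> n i) (r1 n i) (r2 n i)"
  shows "\<exists>C>0. \<forall>n\<ge>2.
    ennreal ((max (regret (P n) n (\<theta> n) (X n) (\<lambda>i \<omega>. \<theta> n i \<omega> + \<epsilon> n i \<omega>) (\<sigma> n) (\<pi>h n) \<pi>s) 0)\<^sup>2)
      \<le> ennreal C *
          (ennreal (rho_sq n (r1 n) (r2 n) * (ln (real n)) ^ 3)
            + mean_wasserstein_sq n (\<kappa> n) (\<sigma> n) \<pi>s)"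
proof -
  define L0 where "L0 = M\<^sup>2 / k\<^sup>2"
  have L0: "L0 > 0" using \<open>M > 0\<close> \<open>0 < k\<close> by (simp add: L0_def)
  show ?thesis
  proof (rule estimated_rule_excess[OF \<open>M > 0\<close> \<open>T \<ge> 1\<close> \<open>c1 > 0\<close> \<open>c2 > 0\<close> \<open>q \<ge> 0\<close> \<open>0 < k\<close> \<open>k < K\<close> \<open>C1 > 0\<close>,
      of "8 * L0\<^sup>2", where ?'a = 'a], goal_cases)
    case 1
    show ?case by simp
  next
    case (2 C)
    note C = 2(1) and excess = 2(2)
    define C' where "C' = 2 * C + 2 * L0\<^sup>2"
    show ?thesis
    proof (intro exI[of _ C'] conjI allI impI)
      show "C' > 0" using C by (simp add: C'_def add_pos_nonneg)
      fix n :: nat assume n2: "n \<ge> 2"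
      then have n: "n \<ge> 1" and n0: "real n > 0" by auto
      show "ennreal ((max (regret (P n) n (\<theta> n) (X n) (\<lambda>i \<omega>. \<theta> n i \<omega> + \<epsilon> n i \<omega>) (\<sigma> n) (\<pi>h n) \<pi>s) 0)\<^sup>2)
        \<le> ennreal C' * (ennreal (rho_sq n (r1 n) (r2 n) * (ln (real n)) ^ 3) + mean_wasserstein_sq n (\<kappa> n) (\<sigma> n) \<pi>s)"
      proof (cases "mean_wasserstein_sq n (\<kappa> n) (\<sigma> n) \<pi>s = \<top>")
        case True
        then show ?thesis using \<open>C' > 0\<close> by (simp add: ennreal_mult_top)
      next
        case finW: False
        note P = prob[OF n]
        interpret prob_space "P n" by (rule P)
        let ?I = "{1..n}"
        have XYm: "(\<lambda>\<omega>. (X n i \<omega>, \<theta> n i \<omega>)) \<in> P n \<rightarrow>\<^sub>M borel \<Otimes>\<^sub>M borel" if "i \<in> ?I" for i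
          using pairs_indep[OF n] that by (auto simp: indep_vars_def)
        have Xm[measurable]: "X n i \<in> borel_measurable (P n)" if "i \<in> ?I" for i
          using measurable_compose[OF XYm[OF that] measurable_fst] by simp
        have \<theta>m[measurable]: "\<theta> n i \<in> borel_measurable (P n)" if "i \<in> ?I" for i
          using measurable_compose[OF XYm[OF that] measurable_snd] by simp
        have Xind: "indep_vars (\<lambda>_. borel) (X n) ?I"
          using indep_vars_compose2[OF pairs_indep[OF n], of "\<lambda>_. fst" "\<lambda>_. borel"] by simp
        have \<epsilon>\<theta>: "indep_var borel (\<epsilon> n i) borel (\<theta> n i)" if i: "i \<in> ?I" for i
        proof -
          have "indep_var borel ((\<lambda>f. f i) \<circ> (\<lambda>\<omega>. \<lambda>i\<in>?I. \<epsilon> n i \<omega>)) borel ((\<lambda>f. f i) \<circ> (\<lambda>\<omega>. \<lambda>i\<in>?I. \<theta> n i \<omega>))"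
            by (rule indep_var_compose[OF \<epsilon>_\<theta>_indep[OF n]]) (use i in \<open>auto intro: measurable_component_singleton\<close>)
          then show ?thesis using i by (simp add: comp_def)
        qed
        have \<epsilon>m[measurable]: "\<epsilon> n i \<in> borel_measurable (P n)" if "i \<in> ?I" for i
          using indep_var_rv1[OF \<epsilon>\<theta>[OF that]] by simp
        have sig: "k < \<sigma> n i" "\<sigma> n i < K" "\<sigma> n i > 0" if "i \<in> ?I" for i
          using scales[OF that] \<open>0 < k\<close> by auto
        have \<kappa>m: "\<kappa> n i \<in> borel \<rightarrow>\<^sub>M prob_algebra borel" if "i \<in> ?I" for i
          using cond_law[OF that] by (simp add: is_cond_law_def)
        note \<pi>sp = prob_onD[OF \<pi>s]
        define W where "W = (\<lambda>i. \<integral>\<^sup>+t. wasserstein2_sq (\<kappa> n i t) (density lborel (normal_density t (\<sigma> n i))) \<partial>\<pi>s)"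
        define w where "w = (\<lambda>i. enn2real (W i))"
        define wbar where "wbar = (\<Sum>i=1..n. w i) / n"
        have Wfin: "W i = ennreal (w i)" if i: "i \<in> ?I" for i
        proof -
          have "(\<Sum>i=1..n. W i) \<noteq> \<top>"
            using finW n0 unfolding mean_wasserstein_sq_def W_def[symmetric] by (auto simp: ennreal_mult_eq_top_iff)
          moreover have "W i \<le> (\<Sum>i=1..n. W i)" by (rule member_le_sum[OF i]) auto
          ultimately have "W i \<noteq> \<top>" by (auto simp: top_unique)
          then show ?thesis by (simp add: w_def less_top)
        qed
        have w0: "w i \<ge> 0" for i by (simp add: w_def)
        have wbar0: "wbar \<ge> 0" unfolding wbar_def by (intro divide_nonneg_nonneg sum_nonneg w0) simp
        have mw: "mean_wasserstein_sq n (\<kappa> n) (\<sigma> n) \<pi>s = ennreal wbar"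
        proof -
          have "mean_wasserstein_sq n (\<kappa> n) (\<sigma> n) \<pi>s = ennreal (1 / real n) * (\<Sum>i=1..n. ennreal (w i))"
            unfolding mean_wasserstein_sq_def W_def[symmetric] using Wfin by simp
          also have "\<dots> = ennreal (1 / real n * (\<Sum>i=1..n. w i))"
          proof -
            have "(\<Sum>i=1..n. ennreal (w i)) = ennreal (\<Sum>i=1..n. w i)"
              by (rule sum_ennreal) (rule w0)
            moreover have "ennreal (1 / real n * (\<Sum>i=1..n. w i)) = ennreal (1 / real n) * ennreal (\<Sum>i=1..n. w i)"
              by (rule ennreal_mult') simp
            ultimately show ?thesis by simp
          qed
          finally show ?thesis by (simp add: wbar_def)
        qed
        have lip: "\<bar>post_mean \<pi> (\<sigma> n i) x - post_mean \<pi> (\<sigma> n i) y\<bar> \<le> L0 * \<bar>x - y\<bar>"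
          if \<pi>: "\<pi> \<in> prob_on M" and i: "i \<in> ?I" for \<pi> i x y
        proof -
          have "\<bar>k\<bar> \<le> \<bar>\<sigma> n i\<bar>" using sig[OF i] \<open>0 < k\<close> by simp
          then have "k\<^sup>2 \<le> (\<sigma> n i)\<^sup>2" by (simp only: abs_le_square_iff)
          then have "M\<^sup>2 / (\<sigma> n i)\<^sup>2 \<le> L0"
            unfolding L0_def using \<open>0 < k\<close> sig[OF i] by (intro divide_left_mono) auto
          then show ?thesis
            using post_mean_lipschitz[OF \<pi> sig(3)[OF i], of x y] by (meson abs_ge_zero mult_right_mono order_trans)
        qed
        \<comment> \<open>The difference of two posterior means is Lipschitz as well, so its second moment under the law of an
  observation is bounded by the one under the mixture plus a transport cost.\<close>
        have trans: "(\<integral>\<^sup>+x. ennreal ((post_mean \<pi> (\<sigma> n i) x - post_mean \<pi>s (\<sigma> n i) x)\<^sup>2) \<partial>distr (P n) borel (X n i))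
          \<le> ennreal (2 * (LINT x|lborel. (post_mean \<pi> (\<sigma> n i) x - post_mean \<pi>s (\<sigma> n i) x)\<^sup>2 * normal_mix \<pi>s (\<sigma> n i) x) + (8 * L0\<^sup>2) * w i)"
          if i: "i \<in> ?I" and \<pi>: "\<pi> \<in> prob_on M" for i \<pi>
        proof -
          note s0 = sig(3)[OF i]
          note [measurable] = borel_measurable_post_mean[OF \<pi> s0] borel_measurable_post_mean[OF \<pi>s s0] borel_measurable_normal_mix[OF \<pi>s s0] Xm[OF i]
          define g where "g = (\<lambda>x. post_mean \<pi> (\<sigma> n i) x - post_mean \<pi>s (\<sigma> n i) x)"
          have [measurable]: "g \<in> borel_measurable borel" unfolding g_def by measurable
          have gb: "\<bar>g x\<bar> \<le> 2 * M" for x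
            using post_mean_bound[OF \<pi> s0, of x] post_mean_bound[OF \<pi>s s0, of x] by (simp add: g_def)
          have glip: "\<bar>g x - g y\<bar> \<le> (2 * L0) * \<bar>x - y\<bar>" for x y
            using lip[OF \<pi> i, of x y] lip[OF \<pi>s i, of x y] by (simp add: g_def)
          have int: "integrable lborel (\<lambda>x. (g x)\<^sup>2 * normal_mix \<pi>s (\<sigma> n i) x)"
          proof (rule Bochner_Integration.integrable_bound)
            show "integrable lborel (\<lambda>x. (2 * M)\<^sup>2 * normal_mix \<pi>s (\<sigma> n i) x)"
              using integrable_normal_mix(1)[OF \<pi>s s0] by simp
            have "(g x)\<^sup>2 \<le> (2 * M)\<^sup>2" for x
              using power_mono[OF gb abs_ge_zero, of x 2] by simp
            then show "AE x in lborel. norm ((g x)\<^sup>2 * normal_mix \<pi>s (\<sigma> n i) x) \<le> norm ((2 * M)\<^sup>2 * normal_mix \<pi>s (\<sigma> n i) x)"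
              unfolding norm_mult by (intro AE_I2 mult_right_mono) auto
          qed measurable
          have "(\<integral>\<^sup>+x. ennreal ((g x)\<^sup>2) \<partial>distr (P n) borel (X n i)) = (\<integral>\<^sup>+\<omega>. ennreal ((g (snd (\<theta> n i \<omega>, X n i \<omega>)))\<^sup>2) \<partial>P n)"
            by (subst nn_integral_distr) auto
          also have "\<dots> = (\<integral>\<^sup>+t. (\<integral>\<^sup>+x. ennreal ((g (snd (t, x)))\<^sup>2) \<partial>\<kappa> n i t) \<partial>\<pi>s)"
            unfolding \<theta>_law[OF i, symmetric]
            by (rule cond_law_nn_integral[OF P Xm[OF i] \<theta>m[OF i] cond_law[OF i]]) measurable
          also have "\<dots> = (\<integral>\<^sup>+t. (\<integral>\<^sup>+x. ennreal ((g x)\<^sup>2) \<partial>\<kappa> n i t) \<partial>\<pi>s)" by simp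
          also have "\<dots> \<le> ennreal (1 + 1) * (\<integral>\<^sup>+t. (\<integral>\<^sup>+z. ennreal ((g z)\<^sup>2) \<partial>density lborel (normal_density t (\<sigma> n i))) \<partial>\<pi>s)
              + ennreal ((1 + 1 / 1) * (2 * L0)\<^sup>2) * W i"
            unfolding W_def
          proof (rule second_moment_transfer[where b="\<lambda>_. 2 * M", OF \<pi>sp(2) \<kappa>m[OF i] s0 _ glip _ _ gb])
            show "(\<lambda>(t, x). g x) \<in> borel_measurable (borel \<Otimes>\<^sub>M borel)" by measurable
          qed (use L0 in auto)
          also have "(\<integral>\<^sup>+t. (\<integral>\<^sup>+z. ennreal ((g z)\<^sup>2) \<partial>density lborel (normal_density t (\<sigma> n i))) \<partial>\<pi>s)
              = (\<integral>\<^sup>+z. ennreal ((g z)\<^sup>2) * ennreal (normal_mix \<pi>s (\<sigma> n i) z) \<partial>lborel)"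
            by (rule nn_integral_normal_mixture[OF \<pi>s s0]) measurable
          also have "\<dots> = ennreal (LINT x|lborel. (g x)\<^sup>2 * normal_mix \<pi>s (\<sigma> n i) x)"
            using nn_integral_eq_integral[OF int] normal_mix_pos[OF \<pi>s s0] by (simp add: ennreal_mult' less_imp_le)
          also have "ennreal (1 + 1) * ennreal (LINT x|lborel. (g x)\<^sup>2 * normal_mix \<pi>s (\<sigma> n i) x) + ennreal ((1 + 1 / 1) * (2 * L0)\<^sup>2) * W i
              = ennreal (2 * (LINT x|lborel. (g x)\<^sup>2 * normal_mix \<pi>s (\<sigma> n i) x) + (8 * L0\<^sup>2) * w i)"
          proof -
            have "0 \<le> (LINT x|lborel. (g x)\<^sup>2 * normal_mix \<pi>s (\<sigma> n i) x)"
              using normal_mix_pos[OF \<pi>s s0] by (intro integral_nonneg_AE) (simp add: less_imp_le)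
            then show ?thesis
            proof -
              assume I0: "0 \<le> (LINT x|lborel. (g x)\<^sup>2 * normal_mix \<pi>s (\<sigma> n i) x)"
              have "(1 + 1 / 1) * (2 * L0)\<^sup>2 * w i = (8 * L0\<^sup>2) * w i" by (simp add: power_mult_distrib)
              then have 1: "ennreal ((1 + 1 / 1) * (2 * L0)\<^sup>2) * ennreal (w i) = ennreal ((8 * L0\<^sup>2) * w i)"
                using ennreal_mult''[OF w0[of i], of "(1 + 1 / 1) * (2 * L0)\<^sup>2"] by (simp only:)
              have 2: "ennreal (1 + 1) * ennreal (LINT x|lborel. (g x)\<^sup>2 * normal_mix \<pi>s (\<sigma> n i) x)
                  = ennreal (2 * (LINT x|lborel. (g x)\<^sup>2 * normal_mix \<pi>s (\<sigma> n i) x))"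
                using ennreal_mult''[OF I0, of "1 + 1"] by (simp only: one_add_one)
              show ?thesis
                unfolding Wfin[OF i] 1 2 by (rule ennreal_plus[symmetric]) (use I0 w0[of i] in auto)
            qed
          qed
          finally show ?thesis unfolding g_def .
        qed
        have tail2: "measure (P n) {\<omega> \<in> space (P n). \<bar>X n i \<omega>\<bar> > sqrt (2 * ln n)} \<le> C1 / (real n)\<^sup>2" if i: "i \<in> ?I" for i
        proof -
          have l: "ln (real n) \<ge> 1 / 2" by (rule ln_nat_ge_half[OF n2])
          have "1 \<le> sqrt (2 * ln n)" using l by simp
          from tails[OF i this] have "measure (P n) {\<omega> \<in> space (P n). \<bar>X n i \<omega>\<bar> > sqrt (2 * ln n)} \<le> C1 * exp (- C2 * (sqrt (2 * ln n))\<^sup>2)" .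
          also have "\<dots> \<le> C1 * exp (- (2 * ln n))"
            using mult_right_mono[of 1 C2 "2 * ln n"] \<open>C2 > 1\<close> l \<open>C1 > 0\<close> by simp
          also have "exp (- (2 * ln n)) = 1 / (real n)\<^sup>2"
            using n0 by (simp add: exp_minus exp_double inverse_eq_divide)
          finally show ?thesis by simp
        qed
        have "\<exists>V. integrable (P n) V \<and> (\<forall>\<omega>. V \<omega> \<ge> 0) \<and>
          (AE \<omega> in P n. (\<Sum>i=1..n. (post_mean (\<pi>h n \<omega>) (\<sigma> n i) (X n i \<omega>) - post_mean \<pi>s (\<sigma> n i) (X n i \<omega>))\<^sup>2) \<le> V \<omega>) \<and>
          (LINT \<omega>|P n. V \<omega>) \<le> C * n * (rho_sq n (r1 n) (r2 n) * ln n ^ 3 + (\<Sum>i=1..n. w i) / n)"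
        proof (rule excess[OF n2 P \<pi>s Xind])
          show "\<pi>h n \<omega> \<in> prob_on M" if "\<omega> \<in> space (P n)" for \<omega>
            using \<pi>h_supp[OF n] that by blast
        qed (fact \<pi>h_likelihood[OF n] tail2 scales approx | rule w0 | erule (1) trans)+
        then obtain V where V: "integrable (P n) V" "\<And>\<omega>. V \<omega> \<ge> 0"
          "AE \<omega> in P n. (\<Sum>i=1..n. (post_mean (\<pi>h n \<omega>) (\<sigma> n i) (X n i \<omega>) - post_mean \<pi>s (\<sigma> n i) (X n i \<omega>))\<^sup>2) \<le> V \<omega>"
          "(LINT \<omega>|P n. V \<omega>) \<le> C * n * (rho_sq n (r1 n) (r2 n) * ln n ^ 3 + wbar)"
          unfolding wbar_def by blast
        define h where "h = (\<lambda>i. post_mean \<pi>s (\<sigma> n i))"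
        have hm[measurable]: "h i \<in> borel_measurable borel" if "i \<in> ?I" for i
          unfolding h_def by (rule borel_measurable_post_mean[OF \<pi>s sig(3)[OF that]])
        have \<theta>M: "AE \<omega> in P n. \<bar>\<theta> n i \<omega>\<bar> \<le> M" if i: "i \<in> ?I" for i
        proof -
          have "AE t in distr (P n) borel (\<theta> n i). \<bar>t\<bar> \<le> M" unfolding \<theta>_law[OF i] by (rule \<pi>sp(3))
          then show ?thesis by (subst (asm) AE_distr_iff) (use \<theta>m[OF i] in auto)
        qed
        have int_sq: "integrable (P n) (\<lambda>\<omega>. (\<theta> n i \<omega> - h i (Z \<omega>))\<^sup>2)"
          if i: "i \<in> ?I" and Z: "Z \<in> borel_measurable (P n)" for i Z
        proof (rule integrable_const_bound[where B="(2 * M)\<^sup>2"])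
          note [measurable] = hm[OF i] \<theta>m[OF i] Z
          show "(\<lambda>\<omega>. (\<theta> n i \<omega> - h i (Z \<omega>))\<^sup>2) \<in> borel_measurable (P n)" by measurable
          show "AE \<omega> in P n. norm ((\<theta> n i \<omega> - h i (Z \<omega>))\<^sup>2) \<le> (2 * M)\<^sup>2"
            using \<theta>M[OF i]
          proof eventually_elim
            case (elim \<omega>)
            have "\<bar>\<theta> n i \<omega> - h i (Z \<omega>)\<bar> \<le> 2 * M"
              using elim post_mean_bound[OF \<pi>s sig(3)[OF i], of "Z \<omega>"] unfolding h_def by linarith
            from power_mono[OF this abs_ge_zero, of 2] show ?case by simp
          qed
        qed
        define S0 where "S0 = 1 / real n * (\<Sum>i=1..n. LINT \<omega>|P n. \<bar>\<theta> n i \<omega> - post_mean (\<pi>h n \<omega>) (\<sigma> n i) (X n i \<omega>)\<bar>\<^sup>2)"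
        define S1 where "S1 = 1 / real n * (\<Sum>i=1..n. LINT \<omega>|P n. (\<theta> n i \<omega> - h i (X n i \<omega>))\<^sup>2)"
        define S2 where "S2 = 1 / real n * (\<Sum>i=1..n. LINT \<omega>|P n. (\<theta> n i \<omega> - h i (\<theta> n i \<omega> + \<epsilon> n i \<omega>))\<^sup>2)"
        define Q where "Q = (LINT \<omega>|P n. V \<omega>) / n"
        have Q0: "Q \<ge> 0" unfolding Q_def using V(2) by (intro divide_nonneg_nonneg integral_nonneg_AE) auto
        have scale: "1 / real n * (u * x + y * v) = u * (1 / real n * x) + y * (v / real n)" for u x y v
          by (simp add: distrib_left mult_ac add_divide_distrib)
        have S1_0: "S1 \<ge> 0" and S2_0: "S2 \<ge> 0"
          unfolding S1_def S2_def by (intro mult_nonneg_nonneg sum_nonneg integral_nonneg_AE; simp)+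
        \<comment> \<open>First use of Minkowski: from the estimated rule to the oracle rule, both at the actual observations.\<close>
        have "sqrt S0 \<le> sqrt S1 + sqrt Q"
        proof (rule sqrt_le_sqrt_add_sqrt_if_young[OF _ S1_0 Q0])
          fix s :: real assume s: "s > 0"
          define A where "A = (\<lambda>i \<omega>. \<bar>\<theta> n i \<omega> - post_mean (\<pi>h n \<omega>) (\<sigma> n i) (X n i \<omega>)\<bar>\<^sup>2)"
          \<comment> \<open>A summand that is not integrable has integral zero by convention, so only the integrable ones contribute.\<close>
          define J where "J = {i \<in> ?I. integrable (P n) (A i)}"
          have "(\<Sum>i=1..n. LINT \<omega>|P n. A i \<omega>) = (\<Sum>i\<in>J. LINT \<omega>|P n. A i \<omega>)"
            by (rule sum.mono_neutral_right) (auto simp: J_def not_integrable_integral_eq)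
          also have "\<dots> = (LINT \<omega>|P n. (\<Sum>i\<in>J. A i \<omega>))"
            by (rule Bochner_Integration.integral_sum[symmetric]) (simp add: J_def)
          also have "\<dots> \<le> (LINT \<omega>|P n. (1 + s) * (\<Sum>i=1..n. (\<theta> n i \<omega> - h i (X n i \<omega>))\<^sup>2) + (1 + 1 / s) * V \<omega>)"
          proof (rule integral_mono_AE)
            show "integrable (P n) (\<lambda>\<omega>. \<Sum>i\<in>J. A i \<omega>)" by (rule Bochner_Integration.integrable_sum) (simp add: J_def)
            show "integrable (P n) (\<lambda>\<omega>. (1 + s) * (\<Sum>i=1..n. (\<theta> n i \<omega> - h i (X n i \<omega>))\<^sup>2) + (1 + 1 / s) * V \<omega>)"
              using V(1) int_sq Xm by (intro Bochner_Integration.integrable_add integrable_mult_right Bochner_Integration.integrable_sum) auto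
            show "AE \<omega> in P n. (\<Sum>i\<in>J. A i \<omega>) \<le> (1 + s) * (\<Sum>i=1..n. (\<theta> n i \<omega> - h i (X n i \<omega>))\<^sup>2) + (1 + 1 / s) * V \<omega>"
              using V(3)
            proof eventually_elim
              case (elim \<omega>)
              have "(\<Sum>i\<in>J. A i \<omega>) \<le> (\<Sum>i=1..n. A i \<omega>)"
                by (rule sum_mono2) (auto simp: J_def A_def)
              also have "\<dots> \<le> (\<Sum>i=1..n. (1 + s) * (\<theta> n i \<omega> - h i (X n i \<omega>))\<^sup>2
                  + (1 + 1 / s) * (post_mean (\<pi>h n \<omega>) (\<sigma> n i) (X n i \<omega>) - post_mean \<pi>s (\<sigma> n i) (X n i \<omega>))\<^sup>2)"
              proof (rule sum_mono)
                fix i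
                show "A i \<omega> \<le> (1 + s) * (\<theta> n i \<omega> - h i (X n i \<omega>))\<^sup>2
                  + (1 + 1 / s) * (post_mean (\<pi>h n \<omega>) (\<sigma> n i) (X n i \<omega>) - post_mean \<pi>s (\<sigma> n i) (X n i \<omega>))\<^sup>2"
                  using square_add_le_young[OF s, of "\<theta> n i \<omega> - h i (X n i \<omega>)" "h i (X n i \<omega>) - post_mean (\<pi>h n \<omega>) (\<sigma> n i) (X n i \<omega>)"]
                  by (simp add: A_def h_def power2_commute[of "post_mean (\<pi>h n \<omega>) (\<sigma> n i) (X n i \<omega>)"])
              qed
              also have "\<dots> \<le> (1 + s) * (\<Sum>i=1..n. (\<theta> n i \<omega> - h i (X n i \<omega>))\<^sup>2) + (1 + 1 / s) * V \<omega>"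
                unfolding sum.distrib sum_distrib_left[symmetric]
                by (intro add_left_mono mult_left_mono elim) (use s in auto)
              finally show ?case .
            qed
          qed
          also have "\<dots> = (1 + s) * (\<Sum>i=1..n. LINT \<omega>|P n. (\<theta> n i \<omega> - h i (X n i \<omega>))\<^sup>2) + (1 + 1 / s) * (LINT \<omega>|P n. V \<omega>)"
          proof -
            have i: "integrable (P n) (\<lambda>\<omega>. (\<theta> n i \<omega> - h i (X n i \<omega>))\<^sup>2)" if "i \<in> ?I" for i
              by (rule int_sq[OF that Xm[OF that]])
            then have "integrable (P n) (\<lambda>\<omega>. \<Sum>i=1..n. (\<theta> n i \<omega> - h i (X n i \<omega>))\<^sup>2)"
              by (intro Bochner_Integration.integrable_sum) auto
            then show ?thesis using V(1) i by (simp add: Bochner_Integration.integral_sum)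
          qed
          finally have "1 / real n * (\<Sum>i=1..n. LINT \<omega>|P n. A i \<omega>) \<le> 1 / real n * ((1 + s) * (\<Sum>i=1..n. LINT \<omega>|P n. (\<theta> n i \<omega> - h i (X n i \<omega>))\<^sup>2) + (1 + 1 / s) * (LINT \<omega>|P n. V \<omega>))"
            by (rule mult_left_mono) simp
          then show "S0 \<le> (1 + s) * S1 + (1 + 1 / s) * Q"
            unfolding S0_def S1_def Q_def A_def scale .
        qed
        \<comment> \<open>Second use of Minkowski: from the actual to the Gaussian observations, both with the oracle rule.\<close>
        moreover have "sqrt S1 \<le> sqrt S2 + sqrt (L0\<^sup>2 * wbar)"
        proof (rule sqrt_le_sqrt_add_sqrt_if_young[OF _ S2_0])
          fix s :: real assume s: "s > 0"
          have "(LINT \<omega>|P n. (\<theta> n i \<omega> - h i (X n i \<omega>))\<^sup>2)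
              \<le> (1 + s) * (LINT \<omega>|P n. (\<theta> n i \<omega> - h i (\<theta> n i \<omega> + \<epsilon> n i \<omega>))\<^sup>2) + (1 + 1 / s) * L0\<^sup>2 * w i" if i: "i \<in> ?I" for i
          proof -
            note [measurable] = hm[OF i] \<theta>m[OF i] Xm[OF i] \<epsilon>m[OF i]
            define g where "g = (\<lambda>t x. t - h i x)"
            have gm: "(\<lambda>(t, x). g t x) \<in> borel_measurable (borel \<Otimes>\<^sub>M borel)" unfolding g_def by measurable
            have gm2: "(\<lambda>z. ennreal ((g (fst z) (snd z))\<^sup>2)) \<in> borel_measurable (borel \<Otimes>\<^sub>M borel)"
              unfolding g_def by measurable
            have gl: "\<bar>g t x - g t y\<bar> \<le> L0 * \<bar>x - y\<bar>" for t x y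
              using lip[OF \<pi>s i, of y x] by (simp add: g_def h_def abs_minus_commute)
            have gb: "\<bar>g t x\<bar> \<le> \<bar>t\<bar> + M" for t x
              using post_mean_bound[OF \<pi>s sig(3)[OF i], of x] by (simp add: g_def h_def)
            have cn: "(1 + 1 / s) * L0\<^sup>2 \<ge> 0" using s by simp
            let ?Z = "\<lambda>\<omega>. \<theta> n i \<omega> + \<epsilon> n i \<omega>"
            have iX: "integrable (P n) (\<lambda>\<omega>. (\<theta> n i \<omega> - h i (X n i \<omega>))\<^sup>2)" by (rule int_sq[OF i]) measurable
            have iZ: "integrable (P n) (\<lambda>\<omega>. (\<theta> n i \<omega> - h i (?Z \<omega>))\<^sup>2)" by (rule int_sq[OF i]) measurable
            have "ennreal (LINT \<omega>|P n. (\<theta> n i \<omega> - h i (X n i \<omega>))\<^sup>2) = (\<integral>\<^sup>+\<omega>. ennreal ((g (fst (\<theta> n i \<omega>, X n i \<omega>)) (snd (\<theta> n i \<omega>, X n i \<omega>)))\<^sup>2) \<partial>P n)"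
              using nn_integral_eq_integral[OF iX] by (simp add: g_def)
            also have "\<dots> = (\<integral>\<^sup>+t. (\<integral>\<^sup>+x. ennreal ((g (fst (t, x)) (snd (t, x)))\<^sup>2) \<partial>\<kappa> n i t) \<partial>\<pi>s)"
              unfolding \<theta>_law[OF i, symmetric]
              by (rule cond_law_nn_integral[OF P Xm[OF i] \<theta>m[OF i] cond_law[OF i] gm2])
            also have "\<dots> = (\<integral>\<^sup>+t. (\<integral>\<^sup>+x. ennreal ((g t x)\<^sup>2) \<partial>\<kappa> n i t) \<partial>\<pi>s)" by simp
            also have "\<dots> \<le> ennreal (1 + s) * (\<integral>\<^sup>+t. (\<integral>\<^sup>+z. ennreal ((g t z)\<^sup>2) \<partial>density lborel (normal_density t (\<sigma> n i))) \<partial>\<pi>s)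
                + ennreal ((1 + 1 / s) * L0\<^sup>2) * W i"
              unfolding W_def
              by (rule second_moment_transfer[OF \<pi>sp(2) \<kappa>m[OF i] sig(3)[OF i] gm gl L0 s gb])
            also have "(\<integral>\<^sup>+t. (\<integral>\<^sup>+z. ennreal ((g t z)\<^sup>2) \<partial>density lborel (normal_density t (\<sigma> n i))) \<partial>\<pi>s)
                = (\<integral>\<^sup>+\<omega>. ennreal ((g (\<theta> n i \<omega>) (?Z \<omega>))\<^sup>2) \<partial>P n)"
              using normal_noise_nn_integral[OF P sig(3)[OF i] \<epsilon>\<theta>[OF i] \<epsilon>_law[OF i] gm2] unfolding \<theta>_law[OF i] by simp
            also have "\<dots> = ennreal (LINT \<omega>|P n. (\<theta> n i \<omega> - h i (?Z \<omega>))\<^sup>2)"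
              using nn_integral_eq_integral[OF iZ] by (simp add: g_def)
            also have "ennreal (1 + s) * ennreal (LINT \<omega>|P n. (\<theta> n i \<omega> - h i (?Z \<omega>))\<^sup>2) + ennreal ((1 + 1 / s) * L0\<^sup>2) * W i
                = ennreal ((1 + s) * (LINT \<omega>|P n. (\<theta> n i \<omega> - h i (?Z \<omega>))\<^sup>2) + (1 + 1 / s) * L0\<^sup>2 * w i)"
              unfolding Wfin[OF i] using s cn w0[of i]
              by (simp only: ennreal_mult''[symmetric] integral_nonneg_AE zero_le_power2 AE_I2 ennreal_plus[symmetric] mult_nonneg_nonneg add_nonneg_nonneg less_imp_le zero_le_one)
            finally show ?thesis
            proof (subst (asm) ennreal_le_iff)
              show "0 \<le> (1 + s) * (LINT \<omega>|P n. (\<theta> n i \<omega> - h i (?Z \<omega>))\<^sup>2) + (1 + 1 / s) * L0\<^sup>2 * w i"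
                using s cn w0[of i] by (intro add_nonneg_nonneg mult_nonneg_nonneg integral_nonneg_AE) auto
            qed
          qed
          then have "(\<Sum>i=1..n. LINT \<omega>|P n. (\<theta> n i \<omega> - h i (X n i \<omega>))\<^sup>2)
              \<le> (\<Sum>i=1..n. (1 + s) * (LINT \<omega>|P n. (\<theta> n i \<omega> - h i (\<theta> n i \<omega> + \<epsilon> n i \<omega>))\<^sup>2) + (1 + 1 / s) * L0\<^sup>2 * w i)"
            by (rule sum_mono)
          also have "\<dots> = (1 + s) * (\<Sum>i=1..n. LINT \<omega>|P n. (\<theta> n i \<omega> - h i (\<theta> n i \<omega> + \<epsilon> n i \<omega>))\<^sup>2) + (1 + 1 / s) * L0\<^sup>2 * (\<Sum>i=1..n. w i)"
            by (simp only: sum.distrib sum_distrib_left)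
          finally have "1 / real n * (\<Sum>i=1..n. LINT \<omega>|P n. (\<theta> n i \<omega> - h i (X n i \<omega>))\<^sup>2)
              \<le> 1 / real n * ((1 + s) * (\<Sum>i=1..n. LINT \<omega>|P n. (\<theta> n i \<omega> - h i (\<theta> n i \<omega> + \<epsilon> n i \<omega>))\<^sup>2) + (1 + 1 / s) * L0\<^sup>2 * (\<Sum>i=1..n. w i))"
            by (rule mult_left_mono) simp
          then show "S1 \<le> (1 + s) * S2 + (1 + 1 / s) * (L0\<^sup>2 * wbar)"
            unfolding S1_def S2_def wbar_def scale by (simp only: mult.assoc times_divide_eq_right)
        qed (use wbar0 in simp)
        ultimately have reg: "regret (P n) n (\<theta> n) (X n) (\<lambda>i \<omega>. \<theta> n i \<omega> + \<epsilon> n i \<omega>) (\<sigma> n) (\<pi>h n) \<pi>s \<le> sqrt Q + sqrt (L0\<^sup>2 * wbar)"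
          unfolding regret_def S0_def[symmetric] power2_abs S2_def h_def by (simp add: S0_def)
        define E where "E = rho_sq n (r1 n) (r2 n) * ln n ^ 3"
        have E0: "E \<ge> 0"
        proof -
          have "r1 n i \<ge> 0" "r2 n i \<ge> 0" if "i \<in> ?I" for i
            using approx[OF that] by (auto simp: approx_normal_conv_def)
          then have "(\<Sum>i=1..n. r1 n i) \<ge> 0" "(\<Sum>i=1..n. r2 n i) \<ge> 0" by (auto intro!: sum_nonneg)
          then show ?thesis unfolding E_def rho_sq_def using n by (intro mult_nonneg_nonneg add_nonneg_nonneg) auto
        qed
        have "Q \<le> C * (E + wbar)"
        proof -
          have "Q \<le> (C * n * (E + wbar)) / n" unfolding Q_def E_def by (rule divide_right_mono[OF V(4)]) simp
          then show ?thesis using n0 by simp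
        qed
        have "(max (regret (P n) n (\<theta> n) (X n) (\<lambda>i \<omega>. \<theta> n i \<omega> + \<epsilon> n i \<omega>) (\<sigma> n) (\<pi>h n) \<pi>s) 0)\<^sup>2 \<le> (sqrt Q + sqrt (L0\<^sup>2 * wbar))\<^sup>2"
          by (rule power_mono) (use reg Q0 wbar0 in auto)
        also have "\<dots> \<le> (1 + 1) * (sqrt Q)\<^sup>2 + (1 + 1 / 1) * (sqrt (L0\<^sup>2 * wbar))\<^sup>2"
          by (rule square_add_le_young) simp
        also have "\<dots> = 2 * Q + 2 * L0\<^sup>2 * wbar" using Q0 wbar0 by simp
        also have "\<dots> \<le> 2 * (C * (E + wbar)) + 2 * L0\<^sup>2 * (E + wbar)"
          using \<open>Q \<le> C * (E + wbar)\<close> E0 by (intro add_mono mult_left_mono) auto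
        also have "\<dots> = C' * (E + wbar)" by (simp add: C'_def algebra_simps)
        finally have "ennreal ((max (regret (P n) n (\<theta> n) (X n) (\<lambda>i \<omega>. \<theta> n i \<omega> + \<epsilon> n i \<omega>) (\<sigma> n) (\<pi>h n) \<pi>s) 0)\<^sup>2) \<le> ennreal (C' * (E + wbar))"
          by (rule ennreal_leI)
        also have "\<dots> = ennreal C' * (ennreal E + ennreal wbar)"
          using E0 wbar0 \<open>C' > 0\<close> by (simp add: ennreal_mult')
        finally show ?thesis unfolding mw E_def .
      qed
    qed
  qed
qed

end
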